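(* Let $c>0$ and $\lambda>0$. The composition with distribution $$\mathfrak{q}(x,y,t)=\int_0^\infty \mathfrak{r}(x,y,s)\left[p_{|B|}(s,t)+\frac{1}{2\lambda}\frac{\partial^{1/2}}{\partial t^{1/2}}p_{|B|}(s,t)\right]ds,$$ which satisfies the time-fractional equation $$\left(\frac{\partial}{\partial t}+2\lambda\frac{{}^{C}\partial^{1/2}}{\partial t^{1/2}}\right)\mathfrak{q}(x,y,t)=c^2\left(\frac{\partial^2}{\partial x^2}+\frac{\partial^2}{\partial y^2}\right)\mathfrak{q}(x,y,t),$$ has the same law as the process $\boldsymbol{W}_2(t)=\boldsymbol{B}_2\left(c^2\mathcal{L}^{1/2}(t)\right)$, $t>0$.
   Context: The function $\mathfrak{r}$ is $$\mathfrak{r}(x,y,t)=\frac{\lambda e^{-\lambda t}}{2\pi c}\left[\frac{e^{\frac{\lambda}{c}\sqrt{c^2t^2-(x^2+y^2)}}+e^{-\frac{\lambda}{c}\sqrt{c^2t^2-(x^2+y^2)}}}{\sqrt{c^2t^2-(x^2+y^2)}}\right],\qquad x^2+y^2<c^2t^2,\ t>0,$$ and $\mathfrak{r}(x,y,t)=0$ for $x^2+y^2>c^2t^2$. The density of reflecting Brownian motion is $p_{|B|}(s,t)=\frac{e^{-s^2/(4t)}}{\sqrt{\pi t}}$, $s>0$, $t>0$. $\boldsymbol{B}_2$ is a planar Brownian motion normalized so that $\mathbb{E}e^{i\boldsymbol\xi\cdot\boldsymbol{B}_2(t)}=e^{-t\|\boldsymbol\xi\|^2}$, $\boldsymbol\xi\in\mathbb{R}^2$,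 independent of $\mathcal{L}^{1/2}$. Here $H^{1/2}$ is the stable subordinator with $\mathbb{E}e^{-\mu H^{1/2}(t)}=e^{-t\sqrt\mu}$, $\mathcal{H}^{1/2}(t)=t+(2\lambda)^2H^{1/2}(t)$, and $\mathcal{L}^{1/2}(t)=\inf\{s>0:\mathcal{H}^{1/2}(s)\ge t\}$, $t>0$. The Riemann-Liouville derivative of order $\frac12$ is $\frac{\partial^{1/2}}{\partial t^{1/2}}f(t)=\frac{1}{\Gamma(1/2)}\frac{d}{dt}\int_0^t\frac{f(s)}{(t-s)^{1/2}}\,ds$, and the Dzerbayshan-Caputo derivative of order $\frac12$ is $\frac{{}^{C}\partial^{1/2}}{\partial t^{1/2}}f(t)=\frac{1}{\Gamma(1/2)}\int_0^t\frac{f'(s)}{(t-s)^{1/2}}\,ds$. *)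

theory Defs
  imports "HOL-Probability.Probability"
begin

definition RL_half_integral :: "(real \<Rightarrow> real) \<Rightarrow> real \<Rightarrow> real" where
  "RL_half_integral f t = (LBINT s:{0<..<t}. f s / (t - s) powr (1/2))"

definition RL_half_deriv :: "(real \<Rightarrow> real) \<Rightarrow> real \<Rightarrow> real" where
  "RL_half_deriv f t = 1 / Gamma (1/2) * deriv (RL_half_integral f) t"

definition caputo_half_deriv :: "(real \<Rightarrow> real) \<Rightarrow> real \<Rightarrow> real" where
  "caputo_half_deriv f t =
     1 / Gamma (1/2) * (LBINT s:{0<..<t}. deriv f s / (t - s) powr (1/2))"

text \<open>The operators above are total functions; the next predicate says that the Caputo
  derivative at \<open>t\<close> is really defined.\<close>

definition caputo_half_differentiable :: "(real \<Rightarrow> real) \<Rightarrow> real \<Rightarrow> bool" where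
  "caputo_half_differentiable f t \<longleftrightarrow>
     (\<forall>s\<in>{0<..<t}. f differentiable (at s)) \<and>
     set_integrable lborel {0<..<t} (\<lambda>s. deriv f s / (t - s) powr (1/2))"

definition twice_differentiable_at :: "(real \<Rightarrow> real) \<Rightarrow> real \<Rightarrow> bool" where
  "twice_differentiable_at f x \<longleftrightarrow>
     (\<forall>\<^sub>F y in nhds x. f differentiable (at y)) \<and> deriv f differentiable (at x)"

text \<open>\<open>p_absB\<close> is only used for \<open>s > 0\<close> and \<open>t > 0\<close>. The value \<open>0\<close> of \<open>r_density\<close> on the circle
  \<open>x\<^sup>2 + y\<^sup>2 = c\<^sup>2 * t\<^sup>2\<close> is a convention; for fixed \<open>x\<close>, \<open>y\<close> it concerns at most one \<open>t > 0\<close>.\<close>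

definition r_density :: "real \<Rightarrow> real \<Rightarrow> real \<Rightarrow> real \<Rightarrow> real \<Rightarrow> real" where
  "r_density c lam x y t =
     (if t > 0 \<and> x\<^sup>2 + y\<^sup>2 < c\<^sup>2 * t\<^sup>2
      then lam * exp (- lam * t) / (2 * pi * c) *
           ((exp (lam / c * sqrt (c\<^sup>2 * t\<^sup>2 - (x\<^sup>2 + y\<^sup>2))) +
             exp (- (lam / c) * sqrt (c\<^sup>2 * t\<^sup>2 - (x\<^sup>2 + y\<^sup>2)))) /
            sqrt (c\<^sup>2 * t\<^sup>2 - (x\<^sup>2 + y\<^sup>2)))
      else 0)"

definition p_absB :: "real \<Rightarrow> real \<Rightarrow> real" where
  "p_absB s t = exp (- s\<^sup>2 / (4 * t)) / sqrt (pi * t)"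

definition q_integrand :: "real \<Rightarrow> real \<Rightarrow> real \<Rightarrow> real \<Rightarrow> real \<Rightarrow> real \<Rightarrow> real" where
  "q_integrand c lam x y t s =
     r_density c lam x y s *
       (p_absB s t + 1 / (2 * lam) * RL_half_deriv (\<lambda>u. p_absB s u) t)"

definition q_density :: "real \<Rightarrow> real \<Rightarrow> real \<Rightarrow> real \<Rightarrow> real \<Rightarrow> real" where
  "q_density c lam x y t = (LBINT s:{0<..}. q_integrand c lam x y t s)"

text \<open>Processes are indexed by \<open>t \<ge> 0\<close>; their values at negative times are never used.\<close>

definition stationary_indep_increments ::
    "'a measure \<Rightarrow> (real \<Rightarrow> 'a \<Rightarrow> 'b::euclidean_space) \<Rightarrow> bool" where
  "stationary_indep_increments M X \<longleftrightarrow>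
     (\<forall>t\<ge>0. X t \<in> borel_measurable M) \<and>
     (\<forall>\<omega>\<in>space M. X 0 \<omega> = 0) \<and>
     (\<forall>s\<ge>0. \<forall>h\<ge>0. distr M borel (\<lambda>\<omega>. X (s + h) \<omega> - X s \<omega>) = distr M borel (X h)) \<and>
     (\<forall>n (\<tau> :: nat \<Rightarrow> real). 0 \<le> \<tau> 0 \<and> (\<forall>i<n. \<tau> i \<le> \<tau> (Suc i)) \<longrightarrow>
        prob_space.indep_vars M (\<lambda>_. borel) (\<lambda>i \<omega>. X (\<tau> (Suc i)) \<omega> - X (\<tau> i) \<omega>) {..<n})"

text \<open>With this normalization each coordinate of \<open>B t\<close> has variance \<open>2 * t\<close>.\<close>

definition planar_brownian_motion ::
    "'a measure \<Rightarrow> (real \<Rightarrow> 'a \<Rightarrow> real \<times> real) \<Rightarrow> bool" where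
  "planar_brownian_motion M B \<longleftrightarrow>
     stationary_indep_increments M B \<and>
     (\<forall>\<omega>\<in>space M. continuous_on {0..} (\<lambda>t. B t \<omega>)) \<and>
     (\<forall>t\<ge>0. \<forall>\<xi>. (CLINT \<omega>|M. iexp (\<xi> \<bullet> B t \<omega>)) = complex_of_real (exp (- t * (norm \<xi>)\<^sup>2)))"

text \<open>Left limits need not be required, since the paths are monotone.\<close>

definition stable_half_subordinator :: "'a measure \<Rightarrow> (real \<Rightarrow> 'a \<Rightarrow> real) \<Rightarrow> bool" where
  "stable_half_subordinator M H \<longleftrightarrow>
     stationary_indep_increments M H \<and>
     (\<forall>\<omega>\<in>space M. mono_on {0..} (\<lambda>t. H t \<omega>) \<and>
        (\<forall>t\<ge>0. continuous (at_right t) (\<lambda>s. H s \<omega>))) \<and>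
     (\<forall>t\<ge>0. \<forall>\<mu>\<ge>0. (LINT \<omega>|M. exp (- \<mu> * H t \<omega>)) = exp (- t * sqrt \<mu>))"

definition calH :: "real \<Rightarrow> (real \<Rightarrow> 'a \<Rightarrow> real) \<Rightarrow> real \<Rightarrow> 'a \<Rightarrow> real" where
  "calH lam H t \<omega> = t + (2 * lam)\<^sup>2 * H t \<omega>"

definition calL :: "real \<Rightarrow> (real \<Rightarrow> 'a \<Rightarrow> real) \<Rightarrow> real \<Rightarrow> 'a \<Rightarrow> real" where
  "calL lam H t \<omega> = Inf {s. s > 0 \<and> calH lam H s \<omega> \<ge> t}"

text \<open>Independence of the sigma-algebras generated by the two whole processes. (The library
  constant \<open>indep_var\<close> would require \<open>X\<close> and \<open>Y\<close> to have the same value type.)\<close>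

definition process_sigma ::
    "'a measure \<Rightarrow> real set \<Rightarrow> (real \<Rightarrow> 'a \<Rightarrow> 'b::topological_space) \<Rightarrow> 'a set set" where
  "process_sigma M I X =
     sets (vimage_algebra (space M) (\<lambda>\<omega>. \<lambda>t\<in>I. X t \<omega>) (Pi\<^sub>M I (\<lambda>_. borel)))"

definition indep_processes ::
    "'a measure \<Rightarrow> real set \<Rightarrow> (real \<Rightarrow> 'a \<Rightarrow> 'b::topological_space)
       \<Rightarrow> real set \<Rightarrow> (real \<Rightarrow> 'a \<Rightarrow> 'c::topological_space) \<Rightarrow> bool" where
  "indep_processes M I X J Y \<longleftrightarrow>
     (\<forall>t\<in>I. X t \<in> borel_measurable M) \<and> (\<forall>t\<in>J. Y t \<in> borel_measurable M) \<and>
     prob_space.indep_set M (process_sigma M I X) (process_sigma M J Y)"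

definition W2 :: "real \<Rightarrow> real \<Rightarrow> (real \<Rightarrow> 'a \<Rightarrow> real \<times> real) \<Rightarrow> (real \<Rightarrow> 'a \<Rightarrow> real)
    \<Rightarrow> real \<Rightarrow> 'a \<Rightarrow> real \<times> real" where
  "W2 c lam B H t \<omega> = B (c\<^sup>2 * calL lam H t \<omega>) \<omega>"

end

(*
  In Laplace variables the bracket in q is e^(-s sqrt mu) (1 / sqrt mu + 1 / (2 lam)), so everything
  is governed by the heat kernel p = p_absB: the Riemann-Liouville half derivative of p is -dp/ds,
  and on K = p - (dp/ds) / (2 lam) the operator d/dt + 2 lam (Caputo half derivative) acts as
  d^2/ds^2 - 2 lam d/ds.

  The equation: the substitution s = sqrt (R + tau^2) with R = (x^2 + y^2) / c^2 writes q as
  an integral over tau of e^(lam tau) e^(-lam s) K(s, t) / s. Without the factor e^(lam tau) this is a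
  radial function in three dimensions (method of descent), for which the equation holds pointwise;
  the term d^2/dtau^2 becomes lam^2 after two integrations by parts.

  The law: H(s) has the law of s^2 / (4 r^2) with r half-Gaussian, because both have the Laplace
  transform e^(-s sqrt mu). Since {L > s} = {calH(s) < t}, this gives the density of L(t).
  By independence the characteristic function of W2(t) is E e^(-c^2 |xi|^2 L(t)), so W2(t) has as
  density the corresponding mixture of planar heat kernels. The mixture equals q because
  e^(lam tau) times a one-dimensional heat kernel integrates to e^(lam^2 s), which leaves
  an integral of inverse Gaussian type.
*)

theory Submission
  imports Defs
begin

section \<open>Lebesgue integrals over subsets of the line\<close>

text \<open>The obstacle is the wave front: \<open>r_density\<close> has an inverse square root
  singularity at s = sqrt R, and its position moves with x and y, so q as given cannot simply be
  differentiated under the integral sign. In the variable tau the domain is fixed, and the growth of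
  e^(lam tau) is harmless because s >= |tau|: the product with e^(-lam s) is at most 1 and a
  Gaussian remains to dominate all derivatives. Everything is then a combination of kernels z^m t^n
  e^(-lam sqrt z - z / (4 t)) with z = s^2. This family is closed under both derivatives, under
  multiplication by z and, for the exponents that occur, under Abel integration, so the equation
  becomes a comparison of coefficients. The origin is excluded from the equation because there the
  integrand of q behaves like 1 / s near 0 and the integral diverges; the law does not see this
  point. No Laplace transform is inverted: e^(-H(s)) lies in [0, 1], so its moments, which are the
  values of the transform at integers, determine the law of H(s). Uniqueness of planar
  characteristic functions is reduced to one dimension by inverting one coordinate at a
  time.\<close>

abbreviation has_integral_on :: "(real \<Rightarrow> real) \<Rightarrow> real \<Rightarrow> real set \<Rightarrow> bool" where
  "has_integral_on f v S \<equiv> has_bochner_integral lborel (\<lambda>x. indicator S x *\<^sub>R f x) v"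

lemma has_integral_on_iff:
  "has_integral_on f v S \<longleftrightarrow> set_integrable lborel S f \<and> (LBINT x:S. f x) = v"
  unfolding has_bochner_integral_iff set_integrable_def set_lebesgue_integral_def by simp

text \<open>A Borel function has the same integral for \<open>lborel\<close> and for its completion,
  and on the completion integrability is absolute integrability, the form in which the change of
  variables is stated.\<close>

lemma has_integral_on_lebesgue_iff:
  assumes "f \<in> borel_measurable borel" "S \<in> sets borel"
  shows "has_integral_on f v S \<longleftrightarrow> f absolutely_integrable_on S \<and> integral S f = v"
proof -
  have m: "(\<lambda>x. indicator S x *\<^sub>R f x) \<in> borel_measurable lborel"
    using assms by measurable
  have "set_integrable lborel S f \<longleftrightarrow> f absolutely_integrable_on S"
    unfolding set_integrable_def using integrable_completion[OF m] by simp
  moreover have "(LBINT x:S. f x) = (LINT x:S|lebesgue. f x)"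
    unfolding set_lebesgue_integral_def using integral_completion[OF m] by simp
  ultimately show ?thesis
    unfolding has_integral_on_iff using set_lebesgue_integral_eq_integral(2)[of S f] by auto
qed

text \<open>Being an equivalence, it carries integrability along with the value in both directions:
  a known integral on one side proves integrability on the other. The absolute value admits
  decreasing substitutions such as \<open>1 / r\<^sup>2\<close>.\<close>

lemma has_integral_on_substitution:
  fixes f g g' :: "real \<Rightarrow> real"
  assumes bij: "bij_betw g S T"
    and deriv: "\<And>x. x \<in> S \<Longrightarrow> (g has_real_derivative g' x) (at x)"
    and S: "S \<in> sets borel" and T: "T \<in> sets borel"
    and f: "f \<in> borel_measurable borel"
    and fg: "(\<lambda>x. \<bar>g' x\<bar> * f (g x)) \<in> borel_measurable borel"
  shows "has_integral_on (\<lambda>x. \<bar>g' x\<bar> * f (g x)) v S \<longleftrightarrow> has_integral_on f v T"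
proof -
  have "has_integral_on (\<lambda>x. \<bar>g' x\<bar> * f (g x)) v S \<longleftrightarrow>
    (\<lambda>x. \<bar>g' x\<bar> * f(g x)) absolutely_integrable_on S \<and> integral S (\<lambda>x. \<bar>g' x\<bar> * f (g x)) = v"
    by (rule has_integral_on_lebesgue_iff[OF fg S])
  also have "\<dots> \<longleftrightarrow> f absolutely_integrable_on (g ` S) \<and> integral (g ` S) f = v"
    using S deriv bij_betw_imp_inj_on[OF bij]
    by (intro has_absolute_integral_change_of_variables_1')
       (auto intro: has_field_derivative_at_within)
  also have "\<dots> \<longleftrightarrow> has_integral_on f v T"
    using has_integral_on_lebesgue_iff[OF f T] bij_betw_imp_surj_on[OF bij] by simp
  finally show ?thesis .
qed

lemma has_integral_on_cong:
  assumes "\<And>x. x \<in> S \<Longrightarrow> f x = g x" "v = w"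
  shows "has_integral_on f v S \<longleftrightarrow> has_integral_on g w S"
proof -
  have "(\<lambda>x. indicator S x *\<^sub>R f x) = (\<lambda>x. indicator S x *\<^sub>R g x)"
    using assms by (auto simp: fun_eq_iff indicator_def)
  then show ?thesis using assms by simp
qed

lemma has_integral_on_eq:
  "has_integral_on g v S \<Longrightarrow> (\<And>x. x \<in> S \<Longrightarrow> f x = g x) \<Longrightarrow> v = w \<Longrightarrow> has_integral_on f w S"
  using has_integral_on_cong[of S f g w v] by simp

lemma has_integral_on_cmult:
  "has_integral_on f v S \<Longrightarrow> has_integral_on (\<lambda>x. k * f x) (k * v) S"
  using has_bochner_integral_mult_right[of k lborel "\<lambda>x. indicator S x *\<^sub>R f x" v]
  by (simp add: mult_ac)

lemma has_integral_on_add: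
  "has_integral_on f v S \<Longrightarrow> has_integral_on g w S \<Longrightarrow> has_integral_on (\<lambda>x. f x + g x) (v + w) S"
  using has_bochner_integral_add[of lborel "\<lambda>x. indicator S x *\<^sub>R f x" v "\<lambda>x. indicator S x *\<^sub>R g x" w]
  by (simp add: algebra_simps)

text \<open>On the convex set \<open>S\<close> the bound on the derivative makes \<open>g\<close> a
  Lipschitz constant in x, so \<open>g\<close> dominates all difference quotients and dominated
  convergence applies along sequences.\<close>

lemma has_real_derivative_integral:
  fixes f f' :: "real \<Rightarrow> 'a \<Rightarrow> real"
  assumes S: "open S" "convex S" "x0 \<in> S"
    and int: "\<And>x. x \<in> S \<Longrightarrow> integrable M (f x)"
    and deriv: "\<And>x w. x \<in> S \<Longrightarrow> w \<in> space M \<Longrightarrow> ((\<lambda>x. f x w) has_real_derivative f' x w) (at x)"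
    and bound: "\<And>x w. x \<in> S \<Longrightarrow> w \<in> space M \<Longrightarrow> \<bar>f' x w\<bar> \<le> g w"
    and g: "integrable M g"
    and meas: "f' x0 \<in> borel_measurable M"
  shows "((\<lambda>x. \<integral>w. f x w \<partial>M) has_real_derivative (\<integral>w. f' x0 w \<partial>M)) (at x0)"
proof -
  have lip: "\<bar>f y w - f x0 w\<bar> \<le> g w * \<bar>y - x0\<bar>" if y: "y \<in> S" and w: "w \<in> space M" for y w
  proof -
    have "norm (f y w - f x0 w) \<le> g w * norm (y - x0)"
      using S y w deriv bound
      by (intro field_differentiable_bound[of S "\<lambda>x. f x w" "\<lambda>x. f' x w"])
         (auto intro: has_field_derivative_at_within)
    then show ?thesis by simp
  qed
  have "((\<lambda>y. (\<integral>w. (f y w - f x0 w) / (y - x0) \<partial>M)) \<longlongrightarrow> (\<integral>w. f' x0 w \<partial>M)) (at x0)"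
    unfolding tendsto_at_iff_sequentially comp_def
  proof (intro allI impI)
    fix X :: "nat \<Rightarrow> real"
    assume X: "\<forall>i. X i \<in> UNIV - {x0}" "X \<longlonglongrightarrow> x0"
    \<comment> \<open>Only finitely many terms of the sequence can lie outside \<open>S\<close>; the
      shift of the index by \<open>N\<close> discards them.\<close>
    obtain N where N: "\<And>n. n \<ge> N \<Longrightarrow> X n \<in> S"
      using topological_tendstoD[OF X(2) S(1) S(3)] unfolding eventually_sequentially by auto
    have "(\<lambda>n. \<integral>w. (f (X (n + N)) w - f x0 w) / (X (n + N) - x0) \<partial>M) \<longlonglongrightarrow> (\<integral>w. f' x0 w \<partial>M)"
    proof (rule integral_dominated_convergence[OF meas _ g])
      show "(\<lambda>w. (f (X (n + N)) w - f x0 w) / (X (n + N) - x0)) \<in> borel_measurable M" for n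
        using borel_measurable_integrable[OF int[OF N[of "n + N"]]] borel_measurable_integrable[OF int[OF S(3)]]
        by simp
      show "AE w in M. (\<lambda>n. (f (X (n + N)) w - f x0 w) / (X (n + N) - x0)) \<longlonglongrightarrow> f' x0 w"
      proof (rule AE_I2)
        fix w assume "w \<in> space M"
        from deriv[OF S(3) this]
        have "((\<lambda>y. (f y w - f x0 w) / (y - x0)) \<longlongrightarrow> f' x0 w) (at x0)"
          by (simp add: has_field_derivative_iff)
        moreover have "(\<lambda>n. X (n + N)) \<longlonglongrightarrow> x0"
          using X(2) by (rule LIMSEQ_ignore_initial_segment)
        ultimately show "(\<lambda>n. (f (X (n + N)) w - f x0 w) / (X (n + N) - x0)) \<longlonglongrightarrow> f' x0 w"
          using X(1) by (auto simp: tendsto_at_iff_sequentially comp_def dest!: spec[of _ "\<lambda>n. X (n + N)"])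
      qed
      show "AE w in M. norm ((f (X (n + N)) w - f x0 w) / (X (n + N) - x0)) \<le> g w" for n
      proof (rule AE_I2)
        fix w assume "w \<in> space M"
        from lip[OF N[of "n + N"] this]
        have "\<bar>f (X (n + N)) w - f x0 w\<bar> \<le> g w * \<bar>X (n + N) - x0\<bar>" by simp
        moreover have "\<bar>X (n + N) - x0\<bar> > 0" using X(1) by auto
        ultimately show "norm ((f (X (n + N)) w - f x0 w) / (X (n + N) - x0)) \<le> g w"
          by (simp add: abs_divide divide_le_eq)
      qed
    qed
    then show "(\<lambda>n. \<integral>w. (f (X n) w - f x0 w) / (X n - x0) \<partial>M) \<longlonglongrightarrow> (\<integral>w. f' x0 w \<partial>M)"
      by (rule LIMSEQ_offset)
  qed
  then show ?thesis
    unfolding has_field_derivative_iff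
  proof (rule Lim_transform_eventually)
    show "\<forall>\<^sub>F y in at x0. (\<integral>w. (f y w - f x0 w) / (y - x0) \<partial>M)
       = ((\<integral>w. f y w \<partial>M) - (\<integral>w. f x0 w \<partial>M)) / (y - x0)"
      using eventually_at_in_open'[OF S(1) S(3)]
      by eventually_elim (simp add: int[OF S(3)] int)
  qed
qed

section \<open>Gaussian integrals\<close>

lemma has_integral_on_gaussian_even:
  "has_integral_on (\<lambda>x. exp (- x\<^sup>2) * x ^ (2 * k)) (sqrt pi / 2 * (fact (2 * k) / (2 ^ (2 * k) * fact k))) {0<..}"
proof -
  have "has_integral_on (\<lambda>x. exp (- x\<^sup>2) * x ^ (2 * k)) (sqrt pi / 2 * (fact (2 * k) / (2 ^ (2 * k) * fact k))) {0..}"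
    using gaussian_moment_even_pos[of k] by simp
  moreover have "AE x in lborel. indicator {0..} x *\<^sub>R (exp (- x\<^sup>2) * x ^ (2 * k))
      = indicator {0<..} x *\<^sub>R (exp (- x\<^sup>2) * x ^ (2 * k) :: real)"
    using AE_lborel_singleton[of "0::real"] by eventually_elim (auto simp: indicator_def)
  ultimately show ?thesis
    by (subst (asm) has_bochner_integral_cong_AE) auto
qed

lemma has_integral_on_gaussian:
  "has_integral_on (\<lambda>x. exp (- x\<^sup>2)) (sqrt pi / 2) {0<..}"
  using has_integral_on_gaussian_even[of 0] by simp

lemma has_integral_on_gaussian_UNIV:
  "has_integral_on (\<lambda>x. exp (- x\<^sup>2)) (sqrt pi) UNIV"
proof -
  have "has_bochner_integral lborel (\<lambda>x::real. exp (- x\<^sup>2)) (2 *\<^sub>R (sqrt pi / 2))"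
    using gaussian_moment_0 by (intro has_bochner_integral_even_function) auto
  then show ?thesis by simp
qed

text \<open>Cauchy--Schloemilch: the substitutions \<open>r \<mapsto> p r - q / r\<close> and \<open>r \<mapsto> q / (p r)\<close>.\<close>

lemma cauchy_schloemilch:
  assumes a: "a > 0" and b: "b \<ge> 0"
  shows "has_integral_on (\<lambda>r. exp (- (a * r\<^sup>2 + b / r\<^sup>2))) (sqrt (pi / a) / 2 * exp (- 2 * sqrt (a * b))) {0<..}"
proof -
  define p q where "p = sqrt a" and "q = sqrt b"
  have p: "p > 0" "a = p\<^sup>2" and q: "q \<ge> 0" "b = q\<^sup>2" using a b by (auto simp: p_def q_def)
  define f where "f = (\<lambda>r. exp (- (a * r\<^sup>2 + b / r\<^sup>2)) :: real)"
  have fm[measurable]: "f \<in> borel_measurable borel" unfolding f_def by measurable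
  \<comment> \<open>The inverse is the positive root of p r^2 - y r - q = 0. For q = 0 the map
    degenerates to r \<mapsto> p r and reaches only positive values; hence the case distinction in
    the image.\<close>
  have bij: "bij_betw (\<lambda>r. p * r - q / r) {0<..} (if q = 0 then {0<..} else UNIV)"
  proof (rule bij_betwI[where g = "\<lambda>y. (y + sqrt (y\<^sup>2 + 4 * p * q)) / (2 * p)"])
    fix r :: real assume r: "r \<in> {0<..}"
    have "(p * r - q / r)\<^sup>2 + 4 * p * q = (p * r + q / r)\<^sup>2"
      using r by (simp add: power2_eq_square field_simps)
    moreover have "p * r + q / r \<ge> 0" using r p q by simp
    ultimately have "sqrt ((p * r - q / r)\<^sup>2 + 4 * p * q) = p * r + q / r" by simp
    then show "(p * r - q / r + sqrt ((p * r - q / r)\<^sup>2 + 4 * p * q)) / (2 * p) = r" using p by simp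
  next
    fix y :: real assume y: "y \<in> (if q = 0 then {0<..} else UNIV)"
    define D where "D = sqrt (y\<^sup>2 + 4 * p * q)"
    have D2: "D\<^sup>2 = y\<^sup>2 + 4 * p * q" using p q by (simp add: D_def)
    have pos: "y + D > 0"
    proof (cases "q = 0")
      case True then show ?thesis using y by (simp add: D_def)
    next
      case False
      then have "sqrt (y\<^sup>2) < D" unfolding D_def using p q by (intro real_sqrt_less_mono) simp
      then show ?thesis by simp
    qed
    have *: "2 * p * q / (y + D) = (D - y) / 2"
      using D2 pos by (simp add: divide_eq_eq) (simp add: algebra_simps power2_eq_square)
    then show "p * ((y + sqrt (y\<^sup>2 + 4 * p * q)) / (2 * p)) - q / ((y + sqrt (y\<^sup>2 + 4 * p * q)) / (2 * p)) = y"
    proof -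
      have "q / ((y + D) / (2 * p)) = (D - y) / 2" unfolding *[symmetric] by (simp add: mult_ac)
      moreover have "p * ((y + D) / (2 * p)) = (y + D) / 2" using p by simp
      ultimately show ?thesis unfolding D_def[symmetric] by simp
    qed
  next
    show "(\<lambda>y. (y + sqrt (y\<^sup>2 + 4 * p * q)) / (2 * p)) \<in> (if q = 0 then {0<..} else UNIV) \<rightarrow> {0<..}"
    proof
      fix y :: real assume y: "y \<in> (if q = 0 then {0<..} else UNIV)"
      show "(y + sqrt (y\<^sup>2 + 4 * p * q)) / (2 * p) \<in> {0<..}"
      proof (cases "q = 0")
        case True then show ?thesis using y p by simp
      next
        case False
        then have "sqrt (y\<^sup>2) < sqrt (y\<^sup>2 + 4 * p * q)" using p q by (intro real_sqrt_less_mono) simp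
        then show ?thesis using p by simp
      qed
    qed
  qed (use p in auto)
  show ?thesis
  proof (cases "q = 0")
    case True
    have "bij_betw (\<lambda>r. p * r) {0<..} {0<..}" using bij True by simp
    then have "has_integral_on (\<lambda>r. \<bar>p\<bar> * exp (- (p * r)\<^sup>2)) (sqrt pi / 2) {0<..}"
      using has_integral_on_gaussian
      by (subst has_integral_on_substitution[where T = "{0<..}"]) (auto intro!: derivative_eq_intros)
    from has_integral_on_cmult[OF this, of "1 / p"] show ?thesis
      using p True q by (simp add: power_mult_distrib real_sqrt_divide)
  next
    case False
    then have q0: "q > 0" using q by simp
    \<comment> \<open>Completing the square: (p r - q / r)^2 = a r^2 + b / r^2 - 2 p q. As p + q /
      r^2 is the derivative of the inner function, the Gaussian integral over the line evaluates
      \<open>f\<close> with this weight.\<close>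
    have e: "\<bar>p + q / r\<^sup>2\<bar> * exp (- (p * r - q / r)\<^sup>2) = exp (2 * p * q) * ((p + q / r\<^sup>2) * f r)" if "r \<in> {0<..}" for r
    proof -
      have "p + q / r\<^sup>2 > 0" using p q0 that by (simp add: add_pos_pos)
      moreover have "- (p * r - q / r)\<^sup>2 = 2 * p * q + - (a * r\<^sup>2 + b / r\<^sup>2)"
        using that p q by (simp add: power2_eq_square field_simps)
      ultimately show ?thesis by (simp add: f_def exp_add)
    qed
    have 0: "has_integral_on (\<lambda>r. \<bar>p + q / r\<^sup>2\<bar> * exp (- (p * r - q / r)\<^sup>2)) (sqrt pi) {0<..}"
      using bij False has_integral_on_gaussian_UNIV
      by (subst has_integral_on_substitution[where T = UNIV])
         (auto intro!: derivative_eq_intros simp: power2_eq_square)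
    have 1: "has_integral_on (\<lambda>r. (p + q / r\<^sup>2) * f r) (exp (- (2 * p * q)) * sqrt pi) {0<..}"
    proof (rule has_integral_on_eq[OF has_integral_on_cmult[OF 0, of "exp (- (2 * p * q))"]])
      fix r :: real assume "r \<in> {0<..}"
      show "(p + q / r\<^sup>2) * f r = exp (- (2 * p * q)) * (\<bar>p + q / r\<^sup>2\<bar> * exp (- (p * r - q / r)\<^sup>2))"
        unfolding e[OF \<open>r \<in> {0<..}\<close>] by (simp add: exp_minus)
    qed simp
    \<comment> \<open>The weight p + q / r^2 is at least p, so \<open>f\<close> is dominated by the
      weighted integrand just evaluated.\<close>
    have "set_integrable lborel {0<..} f"
    proof (rule set_integrable_bound[where g = f and f = "\<lambda>r. 1 / p * ((p + q / r\<^sup>2) * f r)"])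
      show "set_integrable lborel {0<..} (\<lambda>r. 1 / p * ((p + q / r\<^sup>2) * f r))"
        using 1 unfolding has_integral_on_iff by (intro set_integrable_mult_right) auto
      show "AE x in lborel. x \<in> {0<..} \<longrightarrow> norm (f x) \<le> norm (1 / p * ((p + q / x\<^sup>2) * f x))"
        using p q0 by (intro AE_I2 impI) (auto simp: f_def abs_mult field_simps)
    qed (simp add: set_borel_measurable_def)
    then obtain v where v: "has_integral_on f v {0<..}" by (simp only: has_integral_on_iff)
    \<comment> \<open>This map exchanges the terms a r^2 and b / r^2, hence fixes \<open>f\<close>,
      and its derivative produces the weight q / (p r^2). So both summands of the weight p + q / r^2
      contribute the same amount p v.\<close>
    have h: "bij_betw (\<lambda>r. q / (p * r)) {0<..} {0<..}"
      using p q0 by (intro bij_betwI[where g = "\<lambda>r. q / (p * r)"]) auto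
    have "has_integral_on (\<lambda>r. \<bar>- (q * p) / (p * r)\<^sup>2\<bar> * f (q / (p * r))) v {0<..}"
      using h v p by (subst has_integral_on_substitution[where T = "{0<..}"])
        (auto intro!: derivative_eq_intros simp: power2_eq_square)
    then have "has_integral_on (\<lambda>r. 1 / p * (q / r\<^sup>2 * f r)) v {0<..}"
      using p q q0 by (subst (asm) has_integral_on_cong[of _ _ "\<lambda>r. 1 / p * (q / r\<^sup>2 * f r)"])
        (auto simp: f_def abs_mult power2_eq_square field_simps)
    from has_integral_on_add[OF has_integral_on_cmult[OF v, of p] has_integral_on_cmult[OF this, of p]]
    have "has_integral_on (\<lambda>r. (p + q / r\<^sup>2) * f r) (p * v + p * v) {0<..}"
      using p by (simp add: distrib_right distrib_left)
    from has_bochner_integral_eq[OF 1 this] have "v = sqrt pi / p / 2 * exp (- (2 * p * q))"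
      using p by (simp add: field_simps)
    then show ?thesis using v p q unfolding f_def by (simp add: real_sqrt_divide real_sqrt_mult mult.assoc)
  qed
qed

lemma has_integral_on_powr_exp_half:
  assumes a: "a > 0" and b: "b \<ge> 0"
  shows "has_integral_on (\<lambda>w. w powr (-1/2) * exp (- (a * w + b / w))) (sqrt (pi / a) * exp (- 2 * sqrt (a * b))) {0<..}"
proof -
  have bij: "bij_betw (\<lambda>r::real. r\<^sup>2) {0<..} {0<..}"
    by (rule bij_betwI[where g = sqrt]) auto
  have e: "\<bar>2 * r\<bar> * ((r\<^sup>2) powr (-1/2) * exp (- (a * r\<^sup>2 + b / r\<^sup>2))) = 2 * exp (- (a * r\<^sup>2 + b / r\<^sup>2))"
    if "r \<in> {0<..}" for r :: real
    using that by (simp add: powr_minus powr_half_sqrt field_simps)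
  have "has_integral_on (\<lambda>r. \<bar>2 * r\<bar> * ((r\<^sup>2) powr (-1/2) * exp (- (a * r\<^sup>2 + b / r\<^sup>2)))) (sqrt (pi / a) * exp (- 2 * sqrt (a * b))) {0<..}"
    by (rule has_integral_on_eq[OF has_integral_on_cmult[OF cauchy_schloemilch[OF a b], of 2] e]) simp_all
  then show ?thesis
    by (subst (asm) has_integral_on_substitution[OF bij]) (auto intro!: derivative_eq_intros)
qed

text \<open>Compared with the exponent -1/2, the substitution w = 1 / r^2 exchanges the roles of
  \<open>a\<close> and \<open>b\<close>; here it is \<open>b\<close> that must be positive while
  \<open>a\<close> may vanish.\<close>

lemma has_integral_on_powr_exp_three_half:
  assumes a: "a \<ge> 0" and b: "b > 0"
  shows "has_integral_on (\<lambda>w. w powr (-3/2) * exp (- (a * w + b / w))) (sqrt (pi / b) * exp (- 2 * sqrt (a * b))) {0<..}"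
proof -
  have bij: "bij_betw (\<lambda>r::real. 1 / r\<^sup>2) {0<..} {0<..}"
    by (rule bij_betwI[where g = "\<lambda>w. 1 / sqrt w"]) (auto simp: real_sqrt_divide power_divide)
  have e: "\<bar>- (2 * r) / (r\<^sup>2)\<^sup>2\<bar> * ((1 / r\<^sup>2) powr (-3/2) * exp (- (a * (1 / r\<^sup>2) + b / (1 / r\<^sup>2))))
      = 2 * exp (- (b * r\<^sup>2 + a / r\<^sup>2))"
    if "r \<in> {0<..}" for r :: real
  proof -
    have "(1 / r\<^sup>2) powr (-3/2) = r ^ 3"
    proof -
      have "(1 / r\<^sup>2) powr (-3/2) = (r powr (-2)) powr (-3/2)"
        using that by (simp add: powr_minus_divide powr_numeral)
      also have "\<dots> = r ^ 3" using that by (simp add: powr_powr powr_numeral)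
      finally show ?thesis .
    qed
    then show ?thesis using that by (simp add: power_def field_simps eval_nat_numeral abs_mult)
  qed
  have "has_integral_on (\<lambda>r. \<bar>- (2 * r) / (r\<^sup>2)\<^sup>2\<bar> * ((1 / r\<^sup>2) powr (-3/2) * exp (- (a * (1 / r\<^sup>2) + b / (1 / r\<^sup>2)))))
      (sqrt (pi / b) * exp (- 2 * sqrt (a * b))) {0<..}"
    by (rule has_integral_on_eq[OF has_integral_on_cmult[OF cauchy_schloemilch[OF b a], of 2] e]) (simp add: mult.commute)+
  then show ?thesis
    by (subst (asm) has_integral_on_substitution[OF bij]) (auto intro!: derivative_eq_intros simp: power2_eq_square)
qed

text \<open>The factor sqrt pi (2k)! / (4^k k!) is Gamma(k + 1/2), obtained as an even Gaussian
  moment through w = r^2 / a.\<close>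

lemma has_integral_on_powr_exp:
  assumes a: "a > 0"
  shows "has_integral_on (\<lambda>w. w powr (real k - 1/2) * exp (- (a * w)))
    (sqrt pi * (fact (2 * k) / (4 ^ k * fact k)) * a powr (- real k - 1/2)) {0<..}"
proof -
  have bij: "bij_betw (\<lambda>r::real. r\<^sup>2 / a) {0<..} {0<..}"
    using a by (intro bij_betwI[where g = "\<lambda>w. sqrt (a * w)"]) (auto simp: real_sqrt_mult power_mult_distrib)
  have e: "\<bar>2 * r / a\<bar> * ((r\<^sup>2 / a) powr (real k - 1/2) * exp (- (a * (r\<^sup>2 / a))))
      = 2 * a powr (- real k - 1/2) * (exp (- r\<^sup>2) * r ^ (2 * k))"
    if "r \<in> {0<..}" for r :: real
  proof -
    have "(r\<^sup>2 / a) powr (real k - 1/2) = (r powr 2) powr (real k - 1/2) / a powr (real k - 1/2)"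
      using that a by (simp add: powr_divide)
    also have "(r powr 2) powr (real k - 1/2) = r powr (real (2 * k)) / r"
      using that by (simp only: powr_powr) (simp add: algebra_simps powr_diff)
    also have "\<dots> = r ^ (2 * k) / r" using that by (subst powr_realpow) auto
    also have "a powr (real k - 1/2) = 1 / (a powr (- real k - 1/2) * a)"
    proof -
      have "a powr (real k - 1/2) * (a powr (- real k - 1/2) * a powr 1) = 1"
        using a by (simp only: powr_add[symmetric]) simp
      then show ?thesis using a by (simp add: field_simps)
    qed
    finally show ?thesis using that a by (simp add: field_simps)
  qed
  have four: "(2::real) ^ (2 * k) = 4 ^ k" by (simp add: power_mult)
  have "has_integral_on (\<lambda>r. \<bar>2 * r / a\<bar> * ((r\<^sup>2 / a) powr (real k - 1/2) * exp (- (a * (r\<^sup>2 / a)))))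
    (sqrt pi * (fact (2 * k) / (4 ^ k * fact k)) * a powr (- real k - 1/2)) {0<..}"
    by (rule has_integral_on_eq[OF has_integral_on_cmult[OF has_integral_on_gaussian_even[of k], of "2 * a powr (- real k - 1/2)"] e])
      (simp_all add: four)
  then show ?thesis
    using a by (subst (asm) has_integral_on_substitution[OF bij]) (auto intro!: derivative_eq_intros)
qed

section \<open>Radial kernels and their superpositions\<close>

text \<open>Here \<open>z\<close> is the squared radius s^2. With p = \<open>p_absB\<close>, up to
  constants e^(-lam s) p / s has the exponents (-1/2, -1/2) and e^(-lam s) (-dp/ds) / s the
  exponents (0, -3/2); all later kernels arise from these two by shifts.\<close>

definition kern :: "real \<Rightarrow> real \<Rightarrow> real \<Rightarrow> real \<Rightarrow> real \<Rightarrow> real" where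
  "kern lam m n z t = z powr m * t powr n * exp (- (lam * sqrt z) - z / (4 * t))"

text \<open>\<open>Dt\<close> and \<open>Dz\<close> express the partial derivatives of \<open>kern\<close> through shifts of the exponents
  \<open>(m, n)\<close>. In this form they commute with every linear functional of \<open>kern\<close>, in particular
  with integration over \<open>\<tau>\<close>.\<close>

definition Dt :: "(real \<Rightarrow> real \<Rightarrow> real) \<Rightarrow> real \<Rightarrow> real \<Rightarrow> real" where
  "Dt F m n = n * F m (n - 1) + 1/4 * F (m + 1) (n - 2)"

definition Dz :: "real \<Rightarrow> (real \<Rightarrow> real \<Rightarrow> real) \<Rightarrow> real \<Rightarrow> real \<Rightarrow> real" where
  "Dz lam F m n = m * F (m - 1) n - lam / 2 * F (m - 1/2) n - 1/4 * F m (n - 1)"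

lemma kern_nonneg: "kern lam m n z t \<ge> 0"
  by (simp add: kern_def)

lemma kern_shift: "z > 0 \<Longrightarrow> z * kern lam m n z t = kern lam (m + 1) n z t"
  by (simp add: kern_def powr_add)

lemma kern_measurable [measurable (raw)]:
  assumes "f \<in> borel_measurable M" "g \<in> borel_measurable M"
  shows "(\<lambda>x. kern lam m n (f x) (g x)) \<in> borel_measurable M"
  unfolding kern_def using assms by measurable

lemma kern_deriv_t:
  assumes "z > 0" "t > 0"
  shows "((\<lambda>t. kern lam m n z t) has_real_derivative Dt (\<lambda>m n. kern lam m n z t) m n) (at t)"
proof -
  have "t powr (n - 2) = t powr n / t\<^sup>2" "t powr (n - 1) = t powr n / t" "z powr (m + 1) = z powr m * z"
    using assms by (simp_all add: powr_diff powr_add powr_numeral)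
  then show ?thesis unfolding kern_def Dt_def using assms
    by (auto intro!: derivative_eq_intros simp: field_simps power2_eq_square)
qed

lemma kern_deriv_z:
  assumes "z > 0" "t > 0"
  shows "((\<lambda>z. kern lam m n z t) has_real_derivative Dz lam (\<lambda>m n. kern lam m n z t) m n) (at z)"
proof -
  have eqs: "t powr (n - 1) = t powr n / t" "z powr (m - 1) = z powr m / z" "z powr (m - 1/2) = z powr m / sqrt z"
    using assms by (simp_all add: powr_diff powr_half_sqrt)
  have "((\<lambda>z. kern lam m n z t) has_real_derivative
      (m * z powr (m - 1) * t powr n + z powr m * t powr n * (- (lam * (inverse (sqrt z) / 2)) - 1 / (4 * t)))
       * exp (- (lam * sqrt z) - z / (4 * t))) (at z)"
    unfolding kern_def using assms by (auto intro!: derivative_eq_intros simp: algebra_simps)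
  also have "(m * z powr (m - 1) * t powr n + z powr m * t powr n * (- (lam * (inverse (sqrt z) / 2)) - 1 / (4 * t)))
       * exp (- (lam * sqrt z) - z / (4 * t)) = Dz lam (\<lambda>m n. kern lam m n z t) m n"
    unfolding kern_def Dz_def eqs by (simp add: algebra_simps inverse_eq_divide)
  finally show ?thesis .
qed

lemma powr_exp_bounded:
  assumes "d > 0" "x0 > (0::real)"
  shows "\<exists>C. \<forall>x\<ge>x0. x powr k * exp (- (d * x)) \<le> C"
proof (cases "k \<le> 0")
  case True
  have "x powr k * exp (- (d * x)) \<le> x0 powr k * 1" if "x \<ge> x0" for x
    using assms that True by (intro mult_mono powr_mono2') auto
  then show ?thesis by blast
next
  case False
  have "x powr k * exp (- (d * x)) \<le> (k / d) powr k" if "x \<ge> x0" for x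
  proof -
    \<comment> \<open>The argument d x / k is chosen so that the k-th power of this inequality reads
      x^k <= (k / d)^k e^(d x).\<close>
    have "d * x / k \<le> exp (d * x / k)"
      using exp_ge_add_one_self[of "d * x / k"] by linarith
    then have "x \<le> (k / d) * exp (d * x / k)"
      using assms False by (simp add: field_simps)
    then have "x powr k \<le> ((k / d) * exp (d * x / k)) powr k"
      using assms that False by (intro powr_mono2) auto
    also have "\<dots> = (k / d) powr k * exp (d * x)"
      using assms False by (subst powr_mult) (auto simp: exp_powr_real)
    finally show ?thesis by (simp add: exp_minus field_simps)
  qed
  then show ?thesis by blast
qed

text \<open>The bound is uniform down to t = 0, where t^n may blow up. With v = z / t the exponent v
  / 4 is split: v / 16 absorbs v^(-n), and v >= z / T turns the remaining 3 v / 16 into z / (16 T),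
  which absorbs z^(m + n), and z / (8 T), which is kept.\<close>

lemma kern_bound:
  assumes "z0 > 0" "T > 0"
  shows "\<exists>C. \<forall>z\<ge>z0. \<forall>t. 0 < t \<and> t \<le> T \<longrightarrow>
    kern lam m n z t \<le> C * exp (- (lam * sqrt z) - z / (8 * T))"
proof -
  obtain C1 where C1: "\<And>x. x \<ge> z0 / T \<Longrightarrow> x powr (- n) * exp (- (1/16 * x)) \<le> C1"
    using powr_exp_bounded[of "1/16" "z0 / T" "- n"] assms by auto
  obtain C2 where C2: "\<And>x. x \<ge> z0 \<Longrightarrow> x powr (m + n) * exp (- (1 / (16 * T) * x)) \<le> C2"
    using powr_exp_bounded[of "1 / (16 * T)" z0 "m + n"] assms by auto
  have "kern lam m n z t \<le> (C2 * C1) * exp (- (lam * sqrt z) - z / (8 * T))"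
    if z: "z \<ge> z0" and t: "0 < t" "t \<le> T" for z t
  proof -
    have zp: "z > 0" using z assms by simp
    have v: "z / t \<ge> z0 / T" using z t assms by (intro frac_le) auto
    have "z / (4 * t) = 1/16 * (z / t) + 3/16 * (z / t)" using t by (simp add: field_simps)
    moreover have "z / t \<ge> z / T" using t zp by (intro divide_left_mono) auto
    ultimately have e: "- (z / (4 * t)) \<le> - (1 / (16 * T) * z) - (1/16 * (z / t)) - z / (8 * T)"
    proof -
      have "1 / (16 * T) * z + z / (8 * T) = 3/16 * (z / T)" using assms by (simp add: field_simps)
      then show ?thesis using \<open>z / t \<ge> z / T\<close> \<open>z / (4 * t) = _\<close> by linarith
    qed
    have "z powr m * t powr n = z powr (m + n) * (z / t) powr (- n)"
      using zp t by (simp add: powr_add powr_divide powr_minus field_simps)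
    moreover have "exp (- (lam * sqrt z) - z / (4 * t)) \<le>
      exp (- (1 / (16 * T) * z)) * exp (- (1/16 * (z / t))) * exp (- (lam * sqrt z) - z / (8 * T))"
      unfolding exp_add[symmetric] using e by simp
    ultimately have "kern lam m n z t \<le> z powr (m + n) * (z / t) powr (- n) *
      (exp (- (1 / (16 * T) * z)) * exp (- (1/16 * (z / t))) * exp (- (lam * sqrt z) - z / (8 * T)))"
      unfolding kern_def by (simp only:) (intro mult_left_mono, auto)
    also have "\<dots> = (z powr (m + n) * exp (- (1 / (16 * T) * z))) * ((z / t) powr (- n) * exp (- (1/16 * (z / t))))
       * exp (- (lam * sqrt z) - z / (8 * T))" by (simp add: mult_ac)
    also have "\<dots> \<le> (C2 * C1) * exp (- (lam * sqrt z) - z / (8 * T))"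
      using C2[OF z] C1[OF v] order_trans[OF _ C2[OF z], of 0]
      by (intro mult_right_mono mult_mono) auto
    finally show ?thesis .
  qed
  then show ?thesis by blast
qed

section \<open>Superpositions of the kernels over tau with the weight e^(lam tau)\<close>

definition wkern :: "real \<Rightarrow> real \<Rightarrow> real \<Rightarrow> real \<Rightarrow> real \<Rightarrow> real \<Rightarrow> real" where
  "wkern lam m n R t \<tau> = exp (lam * \<tau>) * kern lam m n (R + \<tau>\<^sup>2) t"

definition line_kern :: "real \<Rightarrow> real \<Rightarrow> real \<Rightarrow> real \<Rightarrow> real \<Rightarrow> real" where
  "line_kern lam m n R t = (\<integral>\<tau>. wkern lam m n R t \<tau> \<partial>lborel)"

lemma wkern_nonneg: "wkern lam m n R t \<tau> \<ge> 0"
  by (simp add: wkern_def kern_nonneg)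

lemma wkern_measurable [measurable (raw)]:
  assumes "f \<in> borel_measurable M" "g \<in> borel_measurable M" "h \<in> borel_measurable M"
  shows "(\<lambda>x. wkern lam m n (f x) (g x) (h x)) \<in> borel_measurable M"
  unfolding wkern_def using assms by measurable

text \<open>Since tau <= sqrt (R + tau^2), the weight e^(lam tau) is compensated by the factor
  e^(-lam sqrt z) of the kernel. Uniformity in R >= R0 and t <= T provides the dominating function
  for differentiation in either variable; R0 > 0 keeps z^m away from its singularity.\<close>

lemma wkern_bound:
  assumes "R0 > 0" "T > 0" "lam \<ge> 0"
  shows "\<exists>C. \<forall>R\<ge>R0. \<forall>t \<tau>. 0 < t \<and> t \<le> T \<longrightarrow> \<bar>wkern lam m n R t \<tau>\<bar> \<le> C * exp (- (\<tau>\<^sup>2 / (8 * T)))"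
proof -
  obtain C where C: "\<And>z t. z \<ge> R0 \<Longrightarrow> 0 < t \<Longrightarrow> t \<le> T \<Longrightarrow>
      kern lam m n z t \<le> C * exp (- (lam * sqrt z) - z / (8 * T))"
    using kern_bound[OF assms(1,2)] by blast
  have "\<bar>wkern lam m n R t \<tau>\<bar> \<le> C * exp (- (\<tau>\<^sup>2 / (8 * T)))" if R: "R \<ge> R0" and t: "0 < t" "t \<le> T" for R t \<tau>
  proof -
    have z: "R + \<tau>\<^sup>2 \<ge> R0" using R by (simp add: add_increasing2)
    have "0 \<le> C * exp (- (lam * sqrt (R + \<tau>\<^sup>2)) - (R + \<tau>\<^sup>2) / (8 * T))"
      using C[OF z t] kern_nonneg[of lam m n "R + \<tau>\<^sup>2" t] by linarith
    then have C0: "C \<ge> 0" by (simp add: zero_le_mult_iff)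
    have "sqrt (\<tau>\<^sup>2) \<le> sqrt (R + \<tau>\<^sup>2)" using R assms by (intro real_sqrt_le_mono) simp
    then have "lam * \<tau> \<le> lam * sqrt (R + \<tau>\<^sup>2)" using assms by (intro mult_left_mono) auto
    moreover have "\<tau>\<^sup>2 / (8 * T) \<le> (R + \<tau>\<^sup>2) / (8 * T)" using R assms by (intro divide_right_mono) auto
    ultimately have "lam * \<tau> + (- (lam * sqrt (R + \<tau>\<^sup>2)) - (R + \<tau>\<^sup>2) / (8 * T)) \<le> - (\<tau>\<^sup>2 / (8 * T))" by linarith
    then have "exp (lam * \<tau>) * exp (- (lam * sqrt (R + \<tau>\<^sup>2)) - (R + \<tau>\<^sup>2) / (8 * T)) \<le> exp (- (\<tau>\<^sup>2 / (8 * T)))"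
      unfolding exp_add[symmetric] by simp
    from mult_left_mono[OF this C0]
    have *: "exp (lam * \<tau>) * (C * exp (- (lam * sqrt (R + \<tau>\<^sup>2)) - (R + \<tau>\<^sup>2) / (8 * T))) \<le> C * exp (- (\<tau>\<^sup>2 / (8 * T)))"
      by (simp only: mult.left_commute)
    have "wkern lam m n R t \<tau> \<le> C * exp (- (\<tau>\<^sup>2 / (8 * T)))"
      unfolding wkern_def by (rule order_trans[OF mult_left_mono[OF C[OF z t]] *]) simp
    then show ?thesis using wkern_nonneg[of lam m n R t \<tau>] by simp
  qed
  then show ?thesis by blast
qed

lemma integrable_gaussian_scaled:
  assumes "T > (0::real)"
  shows "integrable lborel (\<lambda>\<tau>. exp (- (\<tau>\<^sup>2 / (8 * T))))"
proof -
  have "integrable lborel (\<lambda>\<tau>. sqrt (2 * pi * (2 * sqrt T)\<^sup>2) * normal_density 0 (2 * sqrt T) \<tau>)"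
    using assms by (intro integrable_mult_right integrable_normal_density) auto
  also have "(\<lambda>\<tau>. sqrt (2 * pi * (2 * sqrt T)\<^sup>2) * normal_density 0 (2 * sqrt T) \<tau>) = (\<lambda>\<tau>. exp (- (\<tau>\<^sup>2 / (8 * T))))"
    using assms by (auto simp: normal_density_def fun_eq_iff power_mult_distrib)
  finally show ?thesis .
qed

lemma wkern_integrable:
  assumes "R > 0" "t > 0" "lam \<ge> 0"
  shows "integrable lborel (wkern lam m n R t)"
proof -
  obtain C where C: "\<And>\<tau>. \<bar>wkern lam m n R t \<tau>\<bar> \<le> C * exp (- (\<tau>\<^sup>2 / (8 * t)))"
    using wkern_bound[OF assms] assms by blast
  show ?thesis
  proof (rule Bochner_Integration.integrable_bound)
    show "integrable lborel (\<lambda>\<tau>. C * exp (- (\<tau>\<^sup>2 / (8 * t))))"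
      using integrable_gaussian_scaled[OF assms(2)] by (rule integrable_mult_right)
    show "AE \<tau> in lborel. norm (wkern lam m n R t \<tau>) \<le> norm (C * exp (- (\<tau>\<^sup>2 / (8 * t))))"
      using C by (auto intro: order_trans[OF _ abs_ge_self])
  qed measurable
qed

lemma wkern_Dt: "exp (lam * \<tau>) * Dt (\<lambda>m n. kern lam m n (R + \<tau>\<^sup>2) t) m n = Dt (\<lambda>m n. wkern lam m n R t \<tau>) m n"
  by (simp add: Dt_def wkern_def algebra_simps)

lemma wkern_Dz: "exp (lam * \<tau>) * Dz lam (\<lambda>m n. kern lam m n (R + \<tau>\<^sup>2) t) m n = Dz lam (\<lambda>m n. wkern lam m n R t \<tau>) m n"
  by (simp add: Dz_def wkern_def algebra_simps)

lemma line_kern_deriv_t: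
  assumes "R > 0" "t > 0" "lam \<ge> 0"
  shows "((\<lambda>t. line_kern lam m n R t) has_real_derivative Dt (\<lambda>m n. line_kern lam m n R t) m n) (at t)"
proof -
  obtain C1 where C1: "\<And>t' \<tau>. 0 < t' \<Longrightarrow> t' \<le> 2 * t \<Longrightarrow> \<bar>wkern lam m (n - 1) R t' \<tau>\<bar> \<le> C1 * exp (- (\<tau>\<^sup>2 / (8 * (2 * t))))"
    using wkern_bound[of R "2 * t" lam m "n - 1"] assms by auto
  obtain C2 where C2: "\<And>t' \<tau>. 0 < t' \<Longrightarrow> t' \<le> 2 * t \<Longrightarrow> \<bar>wkern lam (m + 1) (n - 2) R t' \<tau>\<bar> \<le> C2 * exp (- (\<tau>\<^sup>2 / (8 * (2 * t))))"
    using wkern_bound[of R "2 * t" lam "m + 1" "n - 2"] assms by auto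
  have "((\<lambda>t. line_kern lam m n R t) has_real_derivative (\<integral>\<tau>. Dt (\<lambda>m n. wkern lam m n R t \<tau>) m n \<partial>lborel)) (at t)"
    unfolding line_kern_def
  proof (rule has_real_derivative_integral[where S = "{0<..<2 * t}"
        and g = "\<lambda>\<tau>. (\<bar>n\<bar> * C1 + 1/4 * C2) * exp (- (\<tau>\<^sup>2 / (8 * (2 * t))))"])
    fix t' \<tau> assume t': "t' \<in> {0<..<2 * t}"
    show "((\<lambda>t. wkern lam m n R t \<tau>) has_real_derivative Dt (\<lambda>m n. wkern lam m n R t' \<tau>) m n) (at t')"
      unfolding wkern_Dt[symmetric] unfolding wkern_def
      using assms t' by (intro DERIV_cmult kern_deriv_t) (auto simp: add_pos_nonneg)
    have "\<bar>Dt (\<lambda>m n. wkern lam m n R t' \<tau>) m n\<bar> \<le> \<bar>n\<bar> * \<bar>wkern lam m (n - 1) R t' \<tau>\<bar> + 1/4 * \<bar>wkern lam (m + 1) (n - 2) R t' \<tau>\<bar>"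
      unfolding Dt_def by (rule order_trans[OF abs_triangle_ineq]) (simp add: abs_mult)
    also have "\<dots> \<le> \<bar>n\<bar> * (C1 * exp (- (\<tau>\<^sup>2 / (8 * (2 * t))))) + 1/4 * (C2 * exp (- (\<tau>\<^sup>2 / (8 * (2 * t)))))"
      using C1[of t' \<tau>] C2[of t' \<tau>] t' by (intro add_mono mult_left_mono) auto
    finally show "\<bar>Dt (\<lambda>m n. wkern lam m n R t' \<tau>) m n\<bar> \<le> (\<bar>n\<bar> * C1 + 1/4 * C2) * exp (- (\<tau>\<^sup>2 / (8 * (2 * t))))"
      by (simp add: algebra_simps)
  next
    show "integrable lborel (\<lambda>\<tau>. (\<bar>n\<bar> * C1 + 1/4 * C2) * exp (- (\<tau>\<^sup>2 / (8 * (2 * t)))))"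
      using assms by (intro integrable_mult_right integrable_gaussian_scaled) auto
    show "(\<lambda>\<tau>. Dt (\<lambda>m n. wkern lam m n R t \<tau>) m n) \<in> borel_measurable lborel"
      unfolding Dt_def by measurable
  qed (use assms in \<open>auto intro!: wkern_integrable\<close>)
  also have "(\<integral>\<tau>. Dt (\<lambda>m n. wkern lam m n R t \<tau>) m n \<partial>lborel) = Dt (\<lambda>m n. line_kern lam m n R t) m n"
    unfolding Dt_def line_kern_def using assms by (simp add: wkern_integrable)
  finally show ?thesis .
qed

lemma line_kern_Dz:
  assumes "R > 0" "t > 0" "lam \<ge> 0"
  shows "(\<integral>\<tau>. Dz lam (\<lambda>m n. wkern lam m n R t \<tau>) m n \<partial>lborel) = Dz lam (\<lambda>m n. line_kern lam m n R t) m n"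
    "integrable lborel (\<lambda>\<tau>. Dz lam (\<lambda>m n. wkern lam m n R t \<tau>) m n)"
  unfolding Dz_def line_kern_def using assms by (simp_all add: wkern_integrable)

lemma line_kern_deriv_R:
  assumes "R > 0" "t > 0" "lam \<ge> 0"
  shows "((\<lambda>R. line_kern lam m n R t) has_real_derivative Dz lam (\<lambda>m n. line_kern lam m n R t) m n) (at R)"
proof -
  obtain C1 where C1: "\<And>R' \<tau>. R / 2 \<le> R' \<Longrightarrow> \<bar>wkern lam (m - 1) n R' t \<tau>\<bar> \<le> C1 * exp (- (\<tau>\<^sup>2 / (8 * t)))"
    using wkern_bound[of "R / 2" t lam "m - 1" n] assms by auto
  obtain C2 where C2: "\<And>R' \<tau>. R / 2 \<le> R' \<Longrightarrow> \<bar>wkern lam (m - 1/2) n R' t \<tau>\<bar> \<le> C2 * exp (- (\<tau>\<^sup>2 / (8 * t)))"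
    using wkern_bound[of "R / 2" t lam "m - 1/2" n] assms by auto
  obtain C3 where C3: "\<And>R' \<tau>. R / 2 \<le> R' \<Longrightarrow> \<bar>wkern lam m (n - 1) R' t \<tau>\<bar> \<le> C3 * exp (- (\<tau>\<^sup>2 / (8 * t)))"
    using wkern_bound[of "R / 2" t lam m "n - 1"] assms by auto
  have "((\<lambda>R. line_kern lam m n R t) has_real_derivative (\<integral>\<tau>. Dz lam (\<lambda>m n. wkern lam m n R t \<tau>) m n \<partial>lborel)) (at R)"
    unfolding line_kern_def
  proof (rule has_real_derivative_integral[where S = "{R / 2<..}"
        and g = "\<lambda>\<tau>. (\<bar>m\<bar> * C1 + lam / 2 * C2 + 1/4 * C3) * exp (- (\<tau>\<^sup>2 / (8 * t)))"])
    fix R' \<tau> assume R': "R' \<in> {R / 2<..}"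
    have z: "R' + \<tau>\<^sup>2 > 0" using R' assms by (intro add_pos_nonneg) auto
    have "((\<lambda>R. kern lam m n (R + \<tau>\<^sup>2) t) has_real_derivative Dz lam (\<lambda>m n. kern lam m n (R' + \<tau>\<^sup>2) t) m n * 1) (at R')"
      by (rule DERIV_chain2[of "\<lambda>z. kern lam m n z t"], rule kern_deriv_z[OF z assms(2)]) (auto intro!: derivative_eq_intros)
    then show "((\<lambda>R. wkern lam m n R t \<tau>) has_real_derivative Dz lam (\<lambda>m n. wkern lam m n R' t \<tau>) m n) (at R')"
      unfolding wkern_Dz[symmetric] unfolding wkern_def by (intro DERIV_cmult) simp
    have "\<bar>Dz lam (\<lambda>m n. wkern lam m n R' t \<tau>) m n\<bar> \<le> \<bar>m\<bar> * \<bar>wkern lam (m - 1) n R' t \<tau>\<bar>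
        + lam / 2 * \<bar>wkern lam (m - 1/2) n R' t \<tau>\<bar> + 1/4 * \<bar>wkern lam m (n - 1) R' t \<tau>\<bar>"
      unfolding Dz_def using assms
      by (intro order_trans[OF abs_triangle_ineq4] add_mono) (simp_all add: abs_mult)
    also have "\<dots> \<le> \<bar>m\<bar> * (C1 * exp (- (\<tau>\<^sup>2 / (8 * t)))) + lam / 2 * (C2 * exp (- (\<tau>\<^sup>2 / (8 * t))))
        + 1/4 * (C3 * exp (- (\<tau>\<^sup>2 / (8 * t))))"
      using C1[of R' \<tau>] C2[of R' \<tau>] C3[of R' \<tau>] R' assms by (intro add_mono mult_left_mono) auto
    finally show "\<bar>Dz lam (\<lambda>m n. wkern lam m n R' t \<tau>) m n\<bar>
        \<le> (\<bar>m\<bar> * C1 + lam / 2 * C2 + 1/4 * C3) * exp (- (\<tau>\<^sup>2 / (8 * t)))"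
      by (simp add: algebra_simps)
  next
    show "integrable lborel (\<lambda>\<tau>. (\<bar>m\<bar> * C1 + lam / 2 * C2 + 1/4 * C3) * exp (- (\<tau>\<^sup>2 / (8 * t))))"
      using assms by (intro integrable_mult_right integrable_gaussian_scaled) auto
    show "(\<lambda>\<tau>. Dz lam (\<lambda>m n. wkern lam m n R t \<tau>) m n) \<in> borel_measurable lborel"
      unfolding Dz_def by measurable
  qed (use assms in \<open>auto intro!: wkern_integrable\<close>)
  then show ?thesis unfolding line_kern_Dz[OF assms] .
qed

lemma wkern_deriv_tau:
  assumes "R > 0" "t > 0"
  shows "((\<lambda>\<tau>. wkern lam m n R t \<tau>) has_real_derivative
    lam * wkern lam m n R t \<tau> + 2 * \<tau> * Dz lam (\<lambda>m n. wkern lam m n R t \<tau>) m n) (at \<tau>)"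
proof -
  have z: "R + \<tau>\<^sup>2 > 0" using assms by (intro add_pos_nonneg) auto
  have "((\<lambda>\<tau>. kern lam m n (R + \<tau>\<^sup>2) t) has_real_derivative Dz lam (\<lambda>m n. kern lam m n (R + \<tau>\<^sup>2) t) m n * (2 * \<tau>)) (at \<tau>)"
    by (rule DERIV_chain2[of "\<lambda>z. kern lam m n z t"], rule kern_deriv_z[OF z assms(2)]) (auto intro!: derivative_eq_intros)
  then have "((\<lambda>\<tau>. wkern lam m n R t \<tau>) has_real_derivative
     lam * exp (lam * \<tau>) * kern lam m n (R + \<tau>\<^sup>2) t
     + Dz lam (\<lambda>m n. kern lam m n (R + \<tau>\<^sup>2) t) m n * (2 * \<tau>) * exp (lam * \<tau>)) (at \<tau>)"
    unfolding wkern_def by (intro DERIV_mult) (auto intro!: derivative_eq_intros)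
  then show ?thesis
    unfolding wkern_Dz[symmetric] by (simp add: wkern_def mult_ac)
qed

lemma gaussian_linear_tendsto_0:
  assumes "T > (0::real)"
  shows "((\<lambda>\<tau>. (a * \<bar>\<tau>\<bar> + b) * exp (- (\<tau>\<^sup>2 / (8 * T)))) \<longlongrightarrow> 0) at_infinity"
proof (rule Lim_null_comparison)
  have "((\<lambda>y::real. \<bar>a\<bar> * (y ^ 1 / exp y) + \<bar>b\<bar> * (y ^ 0 / exp y)) \<longlongrightarrow> \<bar>a\<bar> * 0 + \<bar>b\<bar> * 0) at_top"
    by (intro tendsto_intros tendsto_power_div_exp_0)
  from filterlim_compose[OF this filterlim_norm_at_top[where 'a = real]]
  show "((\<lambda>\<tau>::real. \<bar>a\<bar> * (norm \<tau> ^ 1 / exp (norm \<tau>)) + \<bar>b\<bar> * (norm \<tau> ^ 0 / exp (norm \<tau>))) \<longlongrightarrow> 0) at_infinity"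
    by simp
  \<comment> \<open>From this point on tau^2 / (8 T) >= |tau|, so the Gaussian can be compared with
    e^(-|tau|).\<close>
  have "\<forall>\<^sub>F \<tau>::real in at_infinity. norm \<tau> \<ge> 8 * T"
    using filterlim_norm_at_top[unfolded filterlim_at_top] by blast
  then show "\<forall>\<^sub>F \<tau> in at_infinity. norm ((a * \<bar>\<tau>\<bar> + b) * exp (- (\<tau>\<^sup>2 / (8 * T))))
    \<le> \<bar>a\<bar> * (norm \<tau> ^ 1 / exp (norm \<tau>)) + \<bar>b\<bar> * (norm \<tau> ^ 0 / exp (norm \<tau>))"
  proof eventually_elim
    case (elim \<tau>)
    have "\<bar>\<tau>\<bar> * (8 * T) \<le> \<bar>\<tau>\<bar> * \<bar>\<tau>\<bar>" using elim by (intro mult_left_mono) auto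
    then have "\<bar>\<tau>\<bar> \<le> \<tau>\<^sup>2 / (8 * T)" using assms by (simp add: field_simps power2_eq_square)
    then have "exp (- (\<tau>\<^sup>2 / (8 * T))) \<le> exp (- \<bar>\<tau>\<bar>)" by simp
    moreover have "\<bar>a * \<bar>\<tau>\<bar> + b\<bar> \<le> \<bar>a\<bar> * \<bar>\<tau>\<bar> + \<bar>b\<bar>"
      by (rule order_trans[OF abs_triangle_ineq]) (simp add: abs_mult)
    ultimately have "\<bar>a * \<bar>\<tau>\<bar> + b\<bar> * exp (- (\<tau>\<^sup>2 / (8 * T))) \<le> (\<bar>a\<bar> * \<bar>\<tau>\<bar> + \<bar>b\<bar>) * exp (- \<bar>\<tau>\<bar>)"
      by (intro mult_mono) auto
    then show ?case by (simp add: abs_mult exp_minus field_simps)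
  qed
qed

text \<open>Let k be the kernel at z = R + tau^2. Its second tau derivative is 2 k_z + 4 tau^2 k_zz
  with tau^2 = z - R, so the left side is the integral of e^(lam tau) k_tautau. The identity trades
  the explicit coefficient R for shifts of exponents.\<close>

lemma line_kern_ibp:
  assumes R: "R > 0" and t: "t > 0" and lam: "lam \<ge> 0"
  defines "F \<equiv> \<lambda>m n. line_kern lam m n R t"
  shows "2 * Dz lam F m n + 4 * Dz lam (Dz lam (\<lambda>m. F (m + 1))) m n - 4 * R * Dz lam (Dz lam F) m n
    = lam\<^sup>2 * F m n"
proof -
  define w where "w = (\<lambda>\<tau> m n. wkern lam m n R t \<tau>)"
  have w_int: "integrable lborel (\<lambda>\<tau>. w \<tau> m n)" for m n
    unfolding w_def by (rule wkern_integrable[OF R t lam])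
  have w_int_eq: "(\<integral>\<tau>. w \<tau> m n \<partial>lborel) = F m n" for m n
    by (simp add: w_def F_def line_kern_def)
  have dw: "((\<lambda>\<tau>. w \<tau> m n) has_real_derivative lam * w \<tau> m n + 2 * \<tau> * Dz lam (w \<tau>) m n) (at \<tau>)" for m n \<tau>
    unfolding w_def by (rule wkern_deriv_tau[OF R t])
  have dDw: "((\<lambda>\<tau>. Dz lam (w \<tau>) m n) has_real_derivative
      lam * Dz lam (w \<tau>) m n + 2 * \<tau> * Dz lam (Dz lam (w \<tau>)) m n) (at \<tau>)" for m n \<tau>
  proof -
    have "((\<lambda>\<tau>. Dz lam (w \<tau>) m n) has_real_derivative
      m * (lam * w \<tau> (m - 1) n + 2 * \<tau> * Dz lam (w \<tau>) (m - 1) n)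
      - lam / 2 * (lam * w \<tau> (m - 1/2) n + 2 * \<tau> * Dz lam (w \<tau>) (m - 1/2) n)
      - 1/4 * (lam * w \<tau> m (n - 1) + 2 * \<tau> * Dz lam (w \<tau>) m (n - 1))) (at \<tau>)"
      unfolding Dz_def[of lam "w _" m n] by (intro DERIV_diff DERIV_cmult dw)
    also have "m * (lam * w \<tau> (m - 1) n + 2 * \<tau> * Dz lam (w \<tau>) (m - 1) n)
      - lam / 2 * (lam * w \<tau> (m - 1/2) n + 2 * \<tau> * Dz lam (w \<tau>) (m - 1/2) n)
      - 1/4 * (lam * w \<tau> m (n - 1) + 2 * \<tau> * Dz lam (w \<tau>) m (n - 1))
      = lam * Dz lam (w \<tau>) m n + 2 * \<tau> * Dz lam (Dz lam (w \<tau>)) m n"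
      unfolding Dz_def[of lam "w _" m n] Dz_def[of lam "Dz lam (w _)" m n] by (simp add: algebra_simps)
    finally show ?thesis .
  qed
  define f where "f = (\<lambda>\<tau>. 2 * Dz lam (w \<tau>) m n + 4 * \<tau>\<^sup>2 * Dz lam (Dz lam (w \<tau>)) m n - lam\<^sup>2 * w \<tau> m n)"
  \<comment> \<open>\<open>G\<close> is e^(lam tau) (k_tau - lam k), and its derivative is e^(lam
    tau) (k_tautau - lam^2 k): one primitive does both integrations by parts.\<close>
  define G where "G = (\<lambda>\<tau>. 2 * \<tau> * Dz lam (w \<tau>) m n - lam * w \<tau> m n)"
  have dG: "(G has_real_derivative f \<tau>) (at \<tau>)" for \<tau>
    unfolding G_def f_def
    by (auto intro!: derivative_eq_intros dw dDw simp: algebra_simps power2_eq_square)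
  \<comment> \<open>The factor tau^2 acts on the values of \<open>w\<close> and not on the
    coefficients in \<open>Dz\<close>. Hence the shift m + 1 sits inside \<open>Dz\<close> and
    represents z k_zz, not (z k)_zz.\<close>
  have tau2: "\<tau>\<^sup>2 * w \<tau> m n = w \<tau> (m + 1) n - R * w \<tau> m n" for \<tau> m n
  proof -
    have "R + \<tau>\<^sup>2 > 0" using R by (intro add_pos_nonneg) auto
    from arg_cong[OF kern_shift[OF this, of lam m n t], of "\<lambda>k. exp (lam * \<tau>) * k"] show ?thesis
      by (simp add: w_def wkern_def algebra_simps)
  qed
  have f_eq: "f = (\<lambda>\<tau>. 2 * Dz lam (w \<tau>) m n + 4 * Dz lam (Dz lam (\<lambda>m. w \<tau> (m + 1))) m n
      - 4 * R * Dz lam (Dz lam (w \<tau>)) m n - lam\<^sup>2 * w \<tau> m n)"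
  proof
    fix \<tau>
    have "\<tau>\<^sup>2 * Dz lam (Dz lam (w \<tau>)) m n = Dz lam (Dz lam (\<lambda>m n. \<tau>\<^sup>2 * w \<tau> m n)) m n"
      by (simp add: Dz_def algebra_simps)
    also have "\<dots> = Dz lam (Dz lam (\<lambda>m. w \<tau> (m + 1))) m n - R * Dz lam (Dz lam (w \<tau>)) m n"
      unfolding tau2 by (simp add: Dz_def algebra_simps)
    finally show "f \<tau> = 2 * Dz lam (w \<tau>) m n + 4 * Dz lam (Dz lam (\<lambda>m. w \<tau> (m + 1))) m n
      - 4 * R * Dz lam (Dz lam (w \<tau>)) m n - lam\<^sup>2 * w \<tau> m n" unfolding f_def by simp
  qed
  have f_int: "integrable lborel f" unfolding f_eq Dz_def
    by (intro Bochner_Integration.integrable_diff Bochner_Integration.integrable_add integrable_mult_right w_int)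
  have f_integral: "(\<integral>\<tau>. f \<tau> \<partial>lborel) = 2 * Dz lam F m n + 4 * Dz lam (Dz lam (\<lambda>m. F (m + 1))) m n
      - 4 * R * Dz lam (Dz lam F) m n - lam\<^sup>2 * F m n"
    unfolding f_eq Dz_def by (simp add: w_int w_int_eq)
  have f_cont: "isCont f \<tau>" for \<tau>
    unfolding f_eq Dz_def by (intro continuous_intros DERIV_isCont[OF dw])
  have lim: "(G \<longlongrightarrow> 0) at_infinity"
  proof -
    obtain C where C: "\<And>m n \<tau>. \<bar>w \<tau> m n\<bar> \<le> C m n * exp (- (\<tau>\<^sup>2 / (8 * t)))"
    proof -
      have "\<exists>C. \<forall>\<tau>. \<bar>w \<tau> m n\<bar> \<le> C * exp (- (\<tau>\<^sup>2 / (8 * t)))" for m n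
        using wkern_bound[OF R t lam, of m n] t unfolding w_def by blast
      then show thesis using that by metis
    qed
    define a where "a = 2 * (\<bar>m\<bar> * C (m - 1) n + lam / 2 * C (m - 1/2) n + 1/4 * C m (n - 1))"
    show ?thesis
    proof (rule Lim_null_comparison[OF _ gaussian_linear_tendsto_0[OF t, of a "lam * C m n"]], rule always_eventually, rule allI)
      fix \<tau>
      have "\<bar>Dz lam (w \<tau>) m n\<bar> \<le> \<bar>m\<bar> * \<bar>w \<tau> (m - 1) n\<bar> + lam / 2 * \<bar>w \<tau> (m - 1/2) n\<bar> + 1/4 * \<bar>w \<tau> m (n - 1)\<bar>"
        unfolding Dz_def using lam
        by (intro order_trans[OF abs_triangle_ineq4] add_mono) (simp_all add: abs_mult)
      also have "\<dots> \<le> \<bar>m\<bar> * (C (m - 1) n * exp (- (\<tau>\<^sup>2 / (8 * t)))) + lam / 2 * (C (m - 1/2) n * exp (- (\<tau>\<^sup>2 / (8 * t))))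
          + 1/4 * (C m (n - 1) * exp (- (\<tau>\<^sup>2 / (8 * t))))"
        using lam by (intro add_mono mult_left_mono C) auto
      finally have 1: "2 * \<bar>\<tau>\<bar> * \<bar>Dz lam (w \<tau>) m n\<bar> \<le> 2 * \<bar>\<tau>\<bar> * (\<bar>m\<bar> * (C (m - 1) n * exp (- (\<tau>\<^sup>2 / (8 * t)))) + lam / 2 * (C (m - 1/2) n * exp (- (\<tau>\<^sup>2 / (8 * t))))
          + 1/4 * (C m (n - 1) * exp (- (\<tau>\<^sup>2 / (8 * t)))))" by (intro mult_left_mono) auto
      have 2: "lam * \<bar>w \<tau> m n\<bar> \<le> lam * (C m n * exp (- (\<tau>\<^sup>2 / (8 * t))))"
        using lam by (intro mult_left_mono C) auto
      have "norm (G \<tau>) \<le> 2 * \<bar>\<tau>\<bar> * \<bar>Dz lam (w \<tau>) m n\<bar> + lam * \<bar>w \<tau> m n\<bar>"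
        unfolding G_def real_norm_def using lam by (intro order_trans[OF abs_triangle_ineq4]) (simp add: abs_mult)
      also have "\<dots> \<le> (a * \<bar>\<tau>\<bar> + lam * C m n) * exp (- (\<tau>\<^sup>2 / (8 * t)))"
        using add_mono[OF 1 2] by (simp add: a_def algebra_simps)
      finally show "norm (G \<tau>) \<le> (a * \<bar>\<tau>\<bar> + lam * C m n) * exp (- (\<tau>\<^sup>2 / (8 * t)))" .
    qed
  qed
  have "(LBINT x=-\<infinity>..\<infinity>. f x) = 0 - 0"
  proof (rule interval_integral_FTC_integrable[where F = G])
    show "((G \<circ> real_of_ereal) \<longlongrightarrow> 0) (at_right (- \<infinity>))" "((G \<circ> real_of_ereal) \<longlongrightarrow> 0) (at_left \<infinity>)"
      using lim tendsto_mono[OF at_bot_le_at_infinity] tendsto_mono[OF at_top_le_at_infinity]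
      by (auto simp: ereal_tendsto_simps)
    show "set_integrable lborel (einterval (- \<infinity>) \<infinity>) f"
      using f_int by (simp add: set_integrable_def)
  qed (use dG f_cont in \<open>auto simp: has_real_derivative_iff_has_vector_derivative\<close>)
  then show ?thesis using f_integral by (simp add: interval_lebesgue_integral_def set_lebesgue_integral_def)
qed

section \<open>Abel integrals of the kernels\<close>

text \<open>The substitution \<open>w = (t - u) / u\<close> turns the Abel kernel into a Gamma integral.\<close>

lemma abel_substitution:
  assumes t: "t > 0"
    and v: "has_integral_on (\<lambda>w. (1 + w) powr j * w powr (-1/2) * exp (- (z / (4 * t) * (1 + w)))) v {0<..}"
  shows "has_integral_on (\<lambda>u. u powr (-3/2 - j) * exp (- (z / (4 * u))) / (t - u) powr (1/2))
    (t powr (-1 - j) * v) {0<..<t}"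
proof -
  define f where "f = (\<lambda>w. t powr (-1 - j) * ((1 + w) powr j * w powr (-1/2) * exp (- (z / (4 * t) * (1 + w)))))"
  have bij: "bij_betw (\<lambda>u. (t - u) / u) {0<..<t} {0<..}"
  proof (rule bij_betwI[where g = "\<lambda>w. t / (1 + w)"])
    fix w :: real assume "w \<in> {0<..}"
    then have "t / (1 + w) > 0" "t = t / (1 + w) * (1 + w)" using t by simp_all
    then show "(t - t / (1 + w)) / (t / (1 + w)) = w" using t by (simp add: field_simps)
  qed (use t in \<open>auto simp: field_simps\<close>)
  have f: "has_integral_on f (t powr (-1 - j) * v) {0<..}"
    unfolding f_def by (rule has_integral_on_cmult[OF v])
  have "has_integral_on (\<lambda>u. \<bar>- t / u\<^sup>2\<bar> * f ((t - u) / u)) (t powr (-1 - j) * v) {0<..<t}"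
    using f by (subst has_integral_on_substitution[OF bij])
      (auto intro!: derivative_eq_intros simp: f_def power2_eq_square field_simps)
  then show ?thesis
  proof (rule has_integral_on_eq)
    fix u assume u: "u \<in> {0<..<t}"
    have w: "1 + (t - u) / u = t / u" using u by (simp add: field_simps)
    have "z / (4 * t) * (t / u) = z / (4 * u)" using u t by simp
    moreover have "(t / u) powr j = t powr j / u powr j" "((t - u) / u) powr (-1/2) = (t - u) powr (-1/2) / u powr (-1/2)"
      using u t by (simp_all add: powr_divide)
    moreover have "t powr (-1 - j) * t powr j * t = 1"
      using t by (simp add: powr_add[symmetric] powr_minus)
    moreover have "u powr (-3/2 - j) = 1 / (u\<^sup>2 * u powr j * u powr (-1/2))"
    proof -
      have "u powr (-3/2 - j) * (u powr 2 * u powr j * u powr (-1/2)) = 1"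
        by (simp only: powr_add[symmetric]) (use u in simp)
      moreover have "u powr 2 = u\<^sup>2" using u by (simp add: powr_numeral)
      ultimately show ?thesis using u by (simp add: field_simps)
    qed
    moreover have "(t - u) powr (-1/2) = 1 / (t - u) powr (1/2)"
      by (simp add: powr_minus_divide)
    moreover have "\<bar>- t / u\<^sup>2\<bar> = t / u\<^sup>2" using t by simp
    ultimately show "u powr (-3/2 - j) * exp (- (z / (4 * u))) / (t - u) powr (1/2) = \<bar>- t / u\<^sup>2\<bar> * f ((t - u) / u)"
      using t u unfolding f_def w by (simp add: mult_ac)
  qed simp
qed

lemma gamma_half_integrals:
  assumes "a > 0"
  shows "has_integral_on (\<lambda>w. w powr (-1/2) * exp (- (a * w))) (sqrt pi * a powr (-1/2)) {0<..}"
    "has_integral_on (\<lambda>w. w * (w powr (-1/2) * exp (- (a * w)))) (sqrt pi * a powr (-1/2) / (2 * a)) {0<..}"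
    "has_integral_on (\<lambda>w. w\<^sup>2 * (w powr (-1/2) * exp (- (a * w)))) (sqrt pi * a powr (-1/2) * 3 / (4 * a\<^sup>2)) {0<..}"
proof -
  have w: "w powr (1 - 1/2) = w * w powr (-1/2)" "w powr (2 - 1/2) = w\<^sup>2 * w powr (-1/2)" if "w > 0" for w :: real
    using that powr_add[of w 1 "-1/2"] powr_add[of w 2 "-1/2"] by simp_all
  have a': "a powr (-1 - 1/2) = a powr (-1/2) / a" "a powr (-2 - 1/2) = a powr (-1/2) / a\<^sup>2"
    using assms powr_diff[of a "-1/2" 1] powr_diff[of a "-1/2" 2] by simp_all
  show "has_integral_on (\<lambda>w. w powr (-1/2) * exp (- (a * w))) (sqrt pi * a powr (-1/2)) {0<..}"
    using has_integral_on_powr_exp[OF assms, of 0] by simp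
  show "has_integral_on (\<lambda>w. w * (w powr (-1/2) * exp (- (a * w)))) (sqrt pi * a powr (-1/2) / (2 * a)) {0<..}"
    by (rule has_integral_on_eq[OF has_integral_on_powr_exp[OF assms, of 1]]) (use w(1) a'(1) in auto)
  show "has_integral_on (\<lambda>w. w\<^sup>2 * (w powr (-1/2) * exp (- (a * w)))) (sqrt pi * a powr (-1/2) * 3 / (4 * a\<^sup>2)) {0<..}"
    by (rule has_integral_on_eq[OF has_integral_on_powr_exp[OF assms, of 2]])
      (use w(2) a'(2) in \<open>auto simp: fact_numeral field_simps\<close>)
qed

lemma abel_kern_general:
  assumes t: "t > 0" and z: "z > 0"
    and v: "has_integral_on (\<lambda>w. (1 + w) powr j * (w powr (-1/2) * exp (- (z / (4 * t) * w)))) v {0<..}"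
  shows "has_integral_on (\<lambda>u. kern lam m (-3/2 - j) z u / (t - u) powr (1/2))
    (z powr m * t powr (-1 - j) * exp (- (lam * sqrt z) - z / (4 * t)) * v) {0<..<t}"
proof -
  have "has_integral_on (\<lambda>w. (1 + w) powr j * w powr (-1/2) * exp (- (z / (4 * t) * (1 + w)))) (exp (- (z / (4 * t))) * v) {0<..}"
    by (rule has_integral_on_eq[OF has_integral_on_cmult[OF v, of "exp (- (z / (4 * t)))"]])
      (simp_all add: ring_distribs exp_add[symmetric] mult_ac add_divide_distrib)
  from has_integral_on_cmult[OF abel_substitution[OF t this], of "z powr m * exp (- (lam * sqrt z))"]
  show ?thesis
  proof (rule has_integral_on_eq)
    have e: "exp (- a - b) = exp (- a) * exp (- b)" for a b :: real
      by (simp add: exp_add[symmetric])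
    show "kern lam m (-3/2 - j) z u / (t - u) powr (1/2) = z powr m * exp (- (lam * sqrt z)) *
        (u powr (-3/2 - j) * exp (- (z / (4 * u))) / (t - u) powr (1/2))" for u
      unfolding kern_def e by (simp add: mult_ac)
    show "z powr m * exp (- (lam * sqrt z)) * (t powr (-1 - j) * (exp (- (z / (4 * t))) * v)) =
      z powr m * t powr (-1 - j) * exp (- (lam * sqrt z) - z / (4 * t)) * v"
      unfolding e by (simp add: mult_ac)
  qed
qed

text \<open>These are the exponents of t that occur in the time derivative of q. They correspond to
  the weights (1 + w)^j with j = 0, 1, 2, which are expanded; with a = z / (4 t) the results 1 + 1 /
  (2 a) and 1 + 1 / a + 3 / (4 a^2) become 1 + 2 t / z and 1 + 4 t / z + 12 t^2 / z^2.\<close>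

lemma abel_kern:
  assumes t: "t > 0" and z: "z > 0"
  shows "has_integral_on (\<lambda>u. kern lam m (-3/2) z u / (t - u) powr (1/2))
      (2 * sqrt pi * kern lam (m - 1/2) (-1/2) z t) {0<..<t}" (is ?A)
    "has_integral_on (\<lambda>u. kern lam m (-5/2) z u / (t - u) powr (1/2))
      (2 * sqrt pi * (kern lam (m - 1/2) (-3/2) z t + 2 * kern lam (m - 3/2) (-1/2) z t)) {0<..<t}" (is ?B)
    "has_integral_on (\<lambda>u. kern lam m (-7/2) z u / (t - u) powr (1/2))
      (2 * sqrt pi * (kern lam (m - 1/2) (-5/2) z t + 4 * kern lam (m - 3/2) (-3/2) z t
        + 12 * kern lam (m - 5/2) (-1/2) z t)) {0<..<t}" (is ?C)
proof -
  define a where "a = z / (4 * t)"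
  have a: "a > 0" using t z by (simp add: a_def)
  note g = gamma_half_integrals[OF a]
  have E0: "has_integral_on (\<lambda>w. (1 + w) powr 0 * (w powr (-1/2) * exp (- (z / (4 * t) * w)))) (sqrt pi * a powr (-1/2)) {0<..}"
    by (rule has_integral_on_eq[OF g(1)]) (auto simp: a_def)
  have E1: "has_integral_on (\<lambda>w. (1 + w) powr 1 * (w powr (-1/2) * exp (- (z / (4 * t) * w))))
      (sqrt pi * a powr (-1/2) * (1 + 1 / (2 * a))) {0<..}"
    by (rule has_integral_on_eq[OF has_integral_on_add[OF g(1,2)]]) (auto simp: a_def algebra_simps)
  have E2: "has_integral_on (\<lambda>w. (1 + w) powr 2 * (w powr (-1/2) * exp (- (z / (4 * t) * w))))
      (sqrt pi * a powr (-1/2) * (1 + 1 / a + 3 / (4 * a\<^sup>2))) {0<..}"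
    by (rule has_integral_on_eq[OF has_integral_on_add[OF has_integral_on_add[OF g(1) has_integral_on_cmult[OF g(2), of 2]] g(3)]])
      (simp_all add: a_def powr_numeral power2_eq_square algebra_simps)
  have sq: "a powr (-1/2) = 2 * sqrt t / sqrt z"
    using t z by (simp add: a_def powr_minus_divide powr_half_sqrt real_sqrt_divide real_sqrt_mult)
  have zp: "z powr (m - 1/2) = z powr m / sqrt z" "z powr (m - 3/2) = z powr m / (sqrt z * z)"
    "z powr (m - 5/2) = z powr m / (sqrt z * z\<^sup>2)"
    using z powr_diff[of z m "1/2"] powr_diff[of z m "3/2"] powr_diff[of z m "5/2"]
      powr_add[of z "1/2" 1] powr_add[of z "1/2" 2] by (simp_all add: powr_half_sqrt)
  have tp: "t powr (-1/2) = 1 / sqrt t" "t powr (-3/2) = 1 / (sqrt t * t)" "t powr (-5/2) = 1 / (sqrt t * t\<^sup>2)"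
    using t powr_minus_divide[of t "1/2"] powr_minus_divide[of t "3/2"] powr_minus_divide[of t "5/2"]
      powr_add[of t "1/2" 1] powr_add[of t "1/2" 2] by (simp_all add: powr_half_sqrt)
  have tj: "t powr (-1 - 0) = 1 / t" "t powr (-1 - 1) = 1 / t\<^sup>2" "t powr (-1 - 2) = 1 / (t\<^sup>2 * t)"
    using t powr_minus_divide[of t 1] powr_minus_divide[of t 2] powr_minus_divide[of t 3]
    by (simp_all add: powr_numeral power2_eq_square power3_eq_cube)
  \<comment> \<open>With the square roots of t and z as variables and the common factors
    \<open>P\<close> and \<open>E\<close> kept opaque, the remaining claims are rational
    identities.\<close>
  obtain s where s: "t = s\<^sup>2" "s > 0" using t that[of "sqrt t"] by simp
  obtain r where r: "z = r\<^sup>2" "r > 0" using z that[of "sqrt z"] by simp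
  define P E where "P = z powr m" and "E = exp (- (lam * sqrt z) - z / (4 * t))"
  note PE = P_def[symmetric] E_def[symmetric]
  show ?A
    by (rule has_integral_on_eq[OF abel_kern_general[OF t z E0, of lam m]], simp)
      (unfold kern_def zp tp tj sq PE, use s r in \<open>simp add: field_simps power2_eq_square\<close>)
  show ?B
    by (rule has_integral_on_eq[OF abel_kern_general[OF t z E1, of lam m]], simp)
      (unfold kern_def zp tp tj sq PE, unfold a_def, use s r in \<open>simp add: field_simps power2_eq_square\<close>)
  show ?C
    by (rule has_integral_on_eq[OF abel_kern_general[OF t z E2, of lam m]], simp)
      (unfold kern_def zp tp tj sq PE, unfold a_def, use s r in \<open>simp add: field_simps power2_eq_square\<close>)
qed

text \<open>The double integrand is nonnegative, so integrability of the iterated integral over u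
  first, which is \<open>int\<close>, gives joint integrability, and the order can be
  exchanged.\<close>

lemma abel_line_kern:
  assumes R: "R > 0" and t: "t > 0" and lam: "lam \<ge> 0"
    and V: "\<And>z. z > 0 \<Longrightarrow> has_integral_on (\<lambda>u. kern lam m n z u / (t - u) powr (1/2)) (V z) {0<..<t}"
    and int: "integrable lborel (\<lambda>\<tau>. exp (lam * \<tau>) * V (R + \<tau>\<^sup>2))"
  shows "has_integral_on (\<lambda>u. line_kern lam m n R u / (t - u) powr (1/2))
    (\<integral>\<tau>. exp (lam * \<tau>) * V (R + \<tau>\<^sup>2) \<partial>lborel) {0<..<t}"
proof -
  define k where "k = (\<lambda>\<tau> u. indicator {0<..<t} u * (wkern lam m n R u \<tau> / (t - u) powr (1/2)))"
  have km[measurable]: "(\<lambda>(\<tau>, u). k \<tau> u) \<in> borel_measurable (lborel \<Otimes>\<^sub>M lborel)"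
    unfolding k_def by measurable
  have inner: "has_bochner_integral lborel (k \<tau>) (exp (lam * \<tau>) * V (R + \<tau>\<^sup>2))" for \<tau>
  proof -
    have "R + \<tau>\<^sup>2 > 0" using R by (intro add_pos_nonneg) auto
    from has_integral_on_cmult[OF V[OF this], of "exp (lam * \<tau>)"] show ?thesis
      by (simp add: k_def[abs_def] wkern_def)
  qed
  have kpos: "k \<tau> u \<ge> 0" for \<tau> u by (simp add: k_def wkern_nonneg)
  have kint: "integrable (lborel \<Otimes>\<^sub>M lborel) (\<lambda>(\<tau>, u). k \<tau> u)"
  proof (rule lborel_pair.Fubini_integrable)
    show "integrable lborel (\<lambda>x. LBINT y. norm (case (x, y) of (\<tau>, u) \<Rightarrow> k \<tau> u))"
      using int inner kpos by (simp add: has_bochner_integral_integral_eq[OF inner])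
    show "AE x in lborel. integrable lborel (\<lambda>y. case (x, y) of (\<tau>, u) \<Rightarrow> k \<tau> u)"
      using inner by (auto simp: has_bochner_integral_iff)
  qed fact
  have "(\<lambda>u. LBINT \<tau>. k \<tau> u) = (\<lambda>u. indicator {0<..<t} u *\<^sub>R (line_kern lam m n R u / (t - u) powr (1/2)))"
    unfolding k_def line_kern_def by simp
  then show ?thesis
    using lborel_pair.integrable_snd[OF kint] lborel_pair.Fubini_integral[OF kint]
    by (simp add: has_bochner_integral_iff has_bochner_integral_integral_eq[OF inner])
qed

lemma abel_line_kern_values:
  assumes R: "R > 0" and t: "t > 0" and lam: "lam \<ge> 0"
  shows "has_integral_on (\<lambda>u. line_kern lam m (-3/2) R u / (t - u) powr (1/2))
      (2 * sqrt pi * line_kern lam (m - 1/2) (-1/2) R t) {0<..<t}" (is ?A)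
    "has_integral_on (\<lambda>u. line_kern lam m (-5/2) R u / (t - u) powr (1/2))
      (2 * sqrt pi * (line_kern lam (m - 1/2) (-3/2) R t + 2 * line_kern lam (m - 3/2) (-1/2) R t)) {0<..<t}" (is ?B)
    "has_integral_on (\<lambda>u. line_kern lam m (-7/2) R u / (t - u) powr (1/2))
      (2 * sqrt pi * (line_kern lam (m - 1/2) (-5/2) R t + 4 * line_kern lam (m - 3/2) (-3/2) R t
        + 12 * line_kern lam (m - 5/2) (-1/2) R t)) {0<..<t}" (is ?C)
proof -
  have d: "exp (lam * \<tau>) * (2 * sqrt pi * kern lam m n (R + \<tau>\<^sup>2) t) = 2 * sqrt pi * wkern lam m n R t \<tau>"
    "exp (lam * \<tau>) * (2 * sqrt pi * (kern lam m n (R + \<tau>\<^sup>2) t + 2 * kern lam m' n' (R + \<tau>\<^sup>2) t))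
      = 2 * sqrt pi * (wkern lam m n R t \<tau> + 2 * wkern lam m' n' R t \<tau>)"
    "exp (lam * \<tau>) * (2 * sqrt pi * (kern lam m n (R + \<tau>\<^sup>2) t + 4 * kern lam m' n' (R + \<tau>\<^sup>2) t + 12 * kern lam m'' n'' (R + \<tau>\<^sup>2) t))
      = 2 * sqrt pi * (wkern lam m n R t \<tau> + 4 * wkern lam m' n' R t \<tau> + 12 * wkern lam m'' n'' R t \<tau>)" for m n m' n' m'' n'' \<tau>
    by (simp_all add: wkern_def algebra_simps)
  note w = wkern_integrable[OF R t lam]
  show ?A
    by (rule has_integral_on_eq[OF abel_line_kern[OF R t lam abel_kern(1)[OF t]]])
      (simp_all add: d w line_kern_def)
  show ?B
    by (rule has_integral_on_eq[OF abel_line_kern[OF R t lam abel_kern(2)[OF t]]])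
      (simp_all add: d w line_kern_def)
  show ?C
    by (rule has_integral_on_eq[OF abel_line_kern[OF R t lam abel_kern(3)[OF t]]])
      (simp_all add: d w line_kern_def)
qed

section \<open>The density q in radial form\<close>

definition abel_J :: "real \<Rightarrow> real" where
  "abel_J a = (\<integral>w. indicator {0<..} w * ((1 + w) powr -1 * w powr (-1/2) * exp (- (a * (1 + w)))) \<partial>lborel)"

lemma abel_J_integrable:
  assumes "a > (0::real)"
  shows "integrable lborel (\<lambda>w::real. indicator {0<..} w * ((1 + w) powr -1 * w powr (-1/2) * exp (- (a * (1 + w)))))"
proof (rule Bochner_Integration.integrable_bound)
  show "integrable lborel (\<lambda>w. indicator {0<..} w *\<^sub>R (w powr (-1/2) * exp (- (a * w))))"
    using gamma_half_integrals(1)[OF assms] by (simp only: has_bochner_integral_iff)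
  show "AE w in lborel. norm (indicator {0<..} w * ((1 + w) powr -1 * w powr (-1/2) * exp (- (a * (1 + w)))))
      \<le> norm (indicator {0<..} w *\<^sub>R (w powr (-1/2) * exp (- (a * w))))"
  proof (rule AE_I2)
    fix w :: real
    have "(1 + w) powr -1 * w powr (-1/2) * exp (- (a * (1 + w))) \<le> 1 * w powr (-1/2) * exp (- (a * w))" if "w > 0"
      using that assms by (intro mult_mono) (auto simp: powr_minus_divide divide_le_eq)
    then show "norm (indicator {0<..} w * ((1 + w) powr -1 * w powr (-1/2) * exp (- (a * (1 + w)))))
      \<le> norm (indicator {0<..} w *\<^sub>R (w powr (-1/2) * exp (- (a * w))))"
      by (auto simp: indicator_def)
  qed
qed measurable

text \<open>Differentiation brings down 1 + w, which cancels the negative power and leaves a Gamma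
  integral. The function itself is not elementary: for a > 0 it equals pi erfc (sqrt a).\<close>

lemma abel_J_deriv:
  assumes a: "a > 0"
  shows "(abel_J has_real_derivative - (sqrt pi * a powr (-1/2) * exp (- a))) (at a)"
proof -
  have "(abel_J has_real_derivative
      (\<integral>w. indicator {0<..} w * (- (w powr (-1/2) * exp (- (a * (1 + w))))) \<partial>lborel)) (at a)"
    unfolding abel_J_def
  proof (rule has_real_derivative_integral[where S = "{a / 2<..}"
        and g = "\<lambda>w. indicator {0<..} w *\<^sub>R (w powr (-1/2) * exp (- (a / 2 * w)))"])
    fix b w :: real assume b: "b \<in> {a / 2<..}"
    show "((\<lambda>a. indicator {0<..} w * ((1 + w) powr -1 * w powr (-1/2) * exp (- (a * (1 + w)))))
        has_real_derivative indicator {0<..} w * (- (w powr (-1/2) * exp (- (b * (1 + w)))))) (at b)"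
    proof -
      have "((\<lambda>a. indicator {0<..} w * ((1 + w) powr -1 * w powr (-1/2) * exp (- (a * (1 + w)))))
        has_real_derivative indicator {0<..} w * ((1 + w) powr -1 * w powr (-1/2) * (exp (- (b * (1 + w))) * - (1 + w)))) (at b)"
        by (intro DERIV_cmult) (auto intro!: derivative_eq_intros)
      moreover have "indicator {0<..} w * ((1 + w) powr -1 * w powr (-1/2) * (exp (- (b * (1 + w))) * - (1 + w)))
        = indicator {0<..} w * (- (w powr (-1/2) * exp (- (b * (1 + w)))))"
      proof (cases "w > 0")
        case True
        then have "1 + w > 0" by simp
        then have "(1 + w) powr -1 * (1 + w) = 1" by (simp add: powr_minus_divide)
        then have "(1 + w) powr -1 * (1 + w) * (- (w powr (-1/2) * exp (- (b * (1 + w))))) = - (w powr (-1/2) * exp (- (b * (1 + w))))"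
          by (simp only: mult_1_left)
        then show ?thesis using True by (simp only: indicator_def) (simp only: mult_ac minus_mult_left[symmetric] minus_mult_right[symmetric])
      qed simp
      ultimately show ?thesis by simp
    qed
    have "a / 2 * w \<le> b * (1 + w)" if "w > 0"
      using that a b by (intro mult_mono) auto
    then show "\<bar>indicator {0<..} w * (- (w powr (-1/2) * exp (- (b * (1 + w)))))\<bar>
        \<le> indicator {0<..} w *\<^sub>R (w powr (-1/2) * exp (- (a / 2 * w)))"
      by (auto simp: indicator_def abs_mult intro!: mult_left_mono)
  next
    show "integrable lborel (\<lambda>w. indicator {0<..} w *\<^sub>R (w powr (-1/2) * exp (- (a / 2 * w))))"
      using gamma_half_integrals(1)[of "a / 2"] a by (simp only: has_bochner_integral_iff)
  next
    fix b :: real assume "b \<in> {a / 2<..}"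
    then show "integrable lborel (\<lambda>w. indicator {0<..} w * ((1 + w) powr -1 * w powr (-1/2) * exp (- (b * (1 + w)))))"
      using a by (intro abel_J_integrable) auto
  qed (use a in auto)
  also have "(\<integral>w. indicator {0<..} w * (- (w powr (-1/2) * exp (- (a * (1 + w))))) \<partial>lborel)
      = (\<integral>w. (- exp (- a)) * (indicator {0<..} w *\<^sub>R (w powr (-1/2) * exp (- (a * w)))) \<partial>lborel)"
    by (intro Bochner_Integration.integral_cong) (auto simp: distrib_left exp_add[symmetric])
  also have "\<dots> = - (sqrt pi * a powr (-1/2) * exp (- a))"
    using has_bochner_integral_integral_eq[OF gamma_half_integrals(1)[OF a]] by simp
  finally show ?thesis .
qed

text \<open>The factor t^(-1/2) of the heat kernel is the case j = -1 of the Abel substitution.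
  There the power of t in front becomes 1, so t enters only through s^2 / (4 t).\<close>

lemma RL_half_integral_p_absB:
  assumes "s > 0" "t > 0"
  shows "RL_half_integral (\<lambda>u. p_absB s u) t = abel_J (s\<^sup>2 / (4 * t)) / sqrt pi"
proof -
  have a: "s\<^sup>2 / (4 * t) > 0" using assms by simp
  have "has_integral_on (\<lambda>w. (1 + w) powr -1 * w powr (-1/2) * exp (- (s\<^sup>2 / (4 * t) * (1 + w)))) (abel_J (s\<^sup>2 / (4 * t))) {0<..}"
    using abel_J_integrable[OF a] unfolding abel_J_def by (simp add: has_bochner_integral_iff)
  from has_integral_on_cmult[OF abel_substitution[OF assms(2) this], of "1 / sqrt pi"]
  have "has_integral_on (\<lambda>u. p_absB s u / (t - u) powr (1/2)) (abel_J (s\<^sup>2 / (4 * t)) / sqrt pi) {0<..<t}"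
    by (rule has_integral_on_eq)
      (use assms in \<open>auto simp: p_absB_def real_sqrt_mult powr_minus_divide powr_half_sqrt\<close>)
  then show ?thesis
    unfolding RL_half_integral_def by (simp only: has_integral_on_iff)
qed

lemma RL_half_deriv_p_absB:
  assumes s: "s > 0" and t: "t > 0"
  shows "RL_half_deriv (\<lambda>u. p_absB s u) t = s * exp (- (s\<^sup>2 / (4 * t))) / (2 * sqrt pi) * t powr (-3/2)"
proof -
  have a: "s\<^sup>2 / (4 * t) > 0" using assms by simp
  have "((\<lambda>t. abel_J (s\<^sup>2 / (4 * t)) / sqrt pi) has_real_derivative
      (- (sqrt pi * (s\<^sup>2 / (4 * t)) powr (-1/2) * exp (- (s\<^sup>2 / (4 * t)))) * (- (s\<^sup>2 / (4 * t\<^sup>2)))) / sqrt pi) (at t)"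
    using t by (intro DERIV_cdivide DERIV_chain2[of abel_J] abel_J_deriv[OF a])
      (auto intro!: derivative_eq_intros simp: power2_eq_square field_simps)
  moreover have "(s\<^sup>2 / (4 * t)) powr (-1/2) = 2 * sqrt t / s"
    using assms by (simp add: powr_minus_divide powr_half_sqrt real_sqrt_divide real_sqrt_mult)
  ultimately have "((\<lambda>t. abel_J (s\<^sup>2 / (4 * t)) / sqrt pi) has_real_derivative
      s * exp (- (s\<^sup>2 / (4 * t))) / 2 * (sqrt t / t\<^sup>2)) (at t)"
    using s by (simp add: power2_eq_square mult_ac)
  then have "(RL_half_integral (\<lambda>u. p_absB s u) has_real_derivative s * exp (- (s\<^sup>2 / (4 * t))) / 2 * (sqrt t / t\<^sup>2)) (at t)"
    by (rule has_field_derivative_transform_within_open[where S = "{0<..}"])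
      (use t s in \<open>auto simp: RL_half_integral_p_absB\<close>)
  from DERIV_imp_deriv[OF this]
  have "RL_half_deriv (\<lambda>u. p_absB s u) t = s * exp (- (s\<^sup>2 / (4 * t))) / (2 * sqrt pi) * (sqrt t / t\<^sup>2)"
    unfolding RL_half_deriv_def by (simp add: Gamma_one_half_real)
  also have "sqrt t / t\<^sup>2 = t powr (-3/2)"
    using powr_diff[of t "1/2" 2] t by (simp add: powr_half_sqrt)
  finally show ?thesis .
qed

text \<open>\<open>r_density\<close> contributes e^(lam tau) + e^(-lam tau) on the half line.
  Unfolded, this is a single exponential on the whole line, where integration by parts meets no
  boundary at 0.\<close>

lemma has_integral_on_fold:
  fixes h :: "real \<Rightarrow> real"
  assumes h: "integrable lborel h"
  shows "has_integral_on (\<lambda>x. h x + h (- x)) (\<integral>x. h x \<partial>lborel) {0<..}"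
proof -
  have hm[measurable]: "h \<in> borel_measurable borel" using h by auto
  have si: "set_integrable lborel {0<..} h" "set_integrable lborel {..<0} h"
    unfolding set_integrable_def by (rule integrable_mult_indicator[OF _ h], simp)+
  define p q where "p = (LBINT x:{0<..}. h x)" and "q = (LBINT x:{..<0}. h x)"
  have 1: "has_integral_on h p {0<..}" and 2: "has_integral_on h q {..<0}"
    using si by (simp_all only: has_integral_on_iff p_def q_def simp_thms)
  have "bij_betw uminus {0::real<..} {..<0}"
    by (rule bij_betwI[where g = uminus]) auto
  from has_integral_on_substitution[OF this, of "\<lambda>_. -1" h q] 2
  have "has_integral_on (\<lambda>x. h (- x)) q {0<..}"
    by (simp add: DERIV_minus[OF DERIV_ident])
  from has_integral_on_add[OF 1 this]
  have 3: "has_integral_on (\<lambda>x. h x + h (- x)) (p + q) {0<..}" .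
  have "AE x in lborel. h x = indicator {0<..} x *\<^sub>R h x + indicator {..<0} x *\<^sub>R h x"
    using AE_lborel_singleton[of "0::real"] by eventually_elim (auto simp: indicator_def)
  then have "(\<integral>x. h x \<partial>lborel) = (\<integral>x. indicator {0<..} x *\<^sub>R h x + indicator {..<0} x *\<^sub>R h x \<partial>lborel)"
    by (intro integral_cong_AE) auto
  also have "\<dots> = p + q"
    using has_bochner_integral_integral_eq[OF has_bochner_integral_add[OF 1 2]] .
  finally show ?thesis using 3 by simp
qed

text \<open>The factors are lam / (2 pi c) from \<open>r_density\<close>, 1 / c from sqrt (c^2 s^2 -
  x^2 - y^2) = c sqrt (s^2 - R), and 1 / sqrt pi from \<open>p_absB\<close>.\<close>

definition q_const :: "real \<Rightarrow> real \<Rightarrow> real" where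
  "q_const c lam = lam / (2 * pi * c\<^sup>2 * sqrt pi)"

text \<open>\<open>R\<close> stands for (x^2 + y^2) / c^2. Since ds / sqrt (s^2 - R) = dtau / s, the
  heat kernel acquires 1 / s, while in its half derivative this cancels the factor s; 1 / (4 lam) is
  1 / (2 lam) times the 1/2 of that derivative.\<close>

definition q_rad :: "real \<Rightarrow> real \<Rightarrow> real \<Rightarrow> real \<Rightarrow> real" where
  "q_rad c lam R t = q_const c lam * (line_kern lam (-1/2) (-1/2) R t + line_kern lam 0 (-3/2) R t / (4 * lam))"

text \<open>Substituting \<open>s = sqrt (R + \<tau>\<^sup>2)\<close> removes the singularity of \<open>r_density\<close> at the wave front and
  turns \<open>q_density\<close> into a superposition over \<open>\<tau>\<close> of radial functions of three variables.\<close>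

lemma q_integrand_has_integral:
  assumes c: "c > 0" and lam: "lam > 0" and t: "t > 0" and xy: "(x, y) \<noteq> (0, 0)"
  shows "has_integral_on (q_integrand c lam x y t) (q_rad c lam ((x\<^sup>2 + y\<^sup>2) / c\<^sup>2) t) {0<..}"
proof -
  define R where "R = (x\<^sup>2 + y\<^sup>2) / c\<^sup>2"
  have R: "R > 0" using c xy by (auto simp: R_def sum_power2_gt_zero_iff)
  have cR: "x\<^sup>2 + y\<^sup>2 = c\<^sup>2 * R" using c by (simp add: R_def)
  define k where "k = (\<lambda>z. kern lam (-1/2) (-1/2) z t + kern lam 0 (-3/2) z t / (4 * lam))"
  define h where "h = (\<lambda>\<tau>. q_const c lam * (wkern lam (-1/2) (-1/2) R t \<tau> + wkern lam 0 (-3/2) R t \<tau> / (4 * lam)))"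
  define F where "F = (\<lambda>s. q_const c lam * ((exp (lam * sqrt (s\<^sup>2 - R)) + exp (- lam * sqrt (s\<^sup>2 - R))) / sqrt (s\<^sup>2 - R)) * s * k (s\<^sup>2))"
  have km[measurable]: "k \<in> borel_measurable borel" unfolding k_def by measurable
  have Fm[measurable]: "F \<in> borel_measurable borel" unfolding F_def by measurable
  have w: "integrable lborel (wkern lam m n R t)" for m n
    using wkern_integrable[OF R t] lam by simp
  have h_int: "integrable lborel h" unfolding h_def using w by simp
  have h_val: "(\<integral>\<tau>. h \<tau> \<partial>lborel) = q_rad c lam R t"
    unfolding h_def q_rad_def line_kern_def using w by simp
  have lt_iff: "sqrt R < s \<longleftrightarrow> R < s\<^sup>2" if "s > 0" for s
    using real_sqrt_less_iff[of R "s\<^sup>2"] that by simp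
  have bij: "bij_betw (\<lambda>\<tau>. sqrt (R + \<tau>\<^sup>2)) {0<..} {sqrt R<..}"
  proof (rule bij_betwI[where g = "\<lambda>s. sqrt (s\<^sup>2 - R)"])
    fix s assume s: "s \<in> {sqrt R<..}"
    then have "s > 0" using less_trans[OF real_sqrt_gt_zero[OF R], of s] by simp
    then have "R < s\<^sup>2" using s lt_iff by simp
    then show "sqrt (R + (sqrt (s\<^sup>2 - R))\<^sup>2) = s" using \<open>s > 0\<close> by simp
  next
    show "(\<lambda>s. sqrt (s\<^sup>2 - R)) \<in> {sqrt R<..} \<rightarrow> {0<..}"
    proof
      fix s assume s: "s \<in> {sqrt R<..}"
      then have "s > 0" using less_trans[OF real_sqrt_gt_zero[OF R], of s] by simp
      then show "sqrt (s\<^sup>2 - R) \<in> {0<..}" using s lt_iff by simp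
    qed
  qed (use R in auto)
  have "has_integral_on (\<lambda>\<tau>. \<bar>\<tau> / sqrt (R + \<tau>\<^sup>2)\<bar> * F (sqrt (R + \<tau>\<^sup>2))) (q_rad c lam R t) {0<..}"
  proof (rule has_integral_on_eq[OF has_integral_on_fold[OF h_int]])
    fix \<tau> :: real assume \<tau>: "\<tau> \<in> {0<..}"
    define D where "D = sqrt (R + \<tau>\<^sup>2)"
    have "R + \<tau>\<^sup>2 > 0" using R by (intro add_pos_nonneg) auto
    then have D: "D > 0" "D\<^sup>2 = R + \<tau>\<^sup>2" by (simp_all add: D_def)
    then have "\<bar>\<tau> / D\<bar> = \<tau> / D" "sqrt (D\<^sup>2 - R) = \<tau>" using \<tau> by simp_all
    then have "\<bar>\<tau> / D\<bar> * F D = q_const c lam * (exp (lam * \<tau>) + exp (- lam * \<tau>)) * k (R + \<tau>\<^sup>2)"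
      using \<tau> D(1) unfolding F_def by (simp add: D(2))
    also have "\<dots> = h \<tau> + h (- \<tau>)"
      unfolding h_def wkern_def k_def by (simp add: algebra_simps add_divide_distrib)
    finally show "\<bar>\<tau> / sqrt (R + \<tau>\<^sup>2)\<bar> * F (sqrt (R + \<tau>\<^sup>2)) = h \<tau> + h (- \<tau>)"
      unfolding D_def .
  qed (rule h_val)
  moreover have "((\<lambda>\<tau>. sqrt (R + \<tau>\<^sup>2)) has_real_derivative \<tau> / sqrt (R + \<tau>\<^sup>2)) (at \<tau>)" for \<tau>
  proof -
    have "R + \<tau>\<^sup>2 > 0" using R by (intro add_pos_nonneg) auto
    then show ?thesis by (auto intro!: derivative_eq_intros simp: field_simps)
  qed
  ultimately have "has_integral_on F (q_rad c lam R t) {sqrt R<..}"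
    by (subst (asm) has_integral_on_substitution[OF bij]) auto
  moreover have "indicator {sqrt R<..} s *\<^sub>R F s = indicator {0<..} s *\<^sub>R q_integrand c lam x y t s" for s
  proof (cases "s > sqrt R")
    case True
    then have s: "s > 0" using less_trans[OF real_sqrt_gt_zero[OF R], of s] by simp
    have sR: "R < s\<^sup>2" using True lt_iff[OF s] by simp
    have sq: "sqrt (c\<^sup>2 * s\<^sup>2 - (x\<^sup>2 + y\<^sup>2)) = c * sqrt (s\<^sup>2 - R)"
      unfolding cR right_diff_distrib[symmetric] using c by (simp add: real_sqrt_mult)
    have lt: "x\<^sup>2 + y\<^sup>2 < c\<^sup>2 * s\<^sup>2" unfolding cR using sR c by simp
    have s2: "(s\<^sup>2) powr (-1/2) = 1 / s" using s by (simp add: powr_minus_divide powr_half_sqrt)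
    have e: "exp (- (lam * s) - s\<^sup>2 / (4 * t)) = exp (- (lam * s)) * exp (- (s\<^sup>2 / (4 * t)))"
      by (simp add: exp_add[symmetric])
    have pb: "p_absB s t = exp (- (s\<^sup>2 / (4 * t))) * t powr (-1/2) / sqrt pi"
      using t by (simp add: p_absB_def real_sqrt_mult powr_minus_divide powr_half_sqrt)
    define D where "D = sqrt (s\<^sup>2 - R)"
    have D: "D > 0" using sR by (simp add: D_def)
    have kk: "k (s\<^sup>2) = exp (- (lam * s)) * exp (- (s\<^sup>2 / (4 * t))) * (t powr (-1/2) / s + t powr (-3/2) / (4 * lam))"
    proof -
      have "sqrt (s\<^sup>2) = s" using s by simp
      then show ?thesis unfolding k_def kern_def s2 by (simp only: e) (use s in \<open>simp add: algebra_simps\<close>)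
    qed
    show ?thesis
      unfolding F_def q_integrand_def r_density_def sq RL_half_deriv_p_absB[OF s t] pb kk q_const_def D_def[symmetric]
      using True s lt c lam D by (simp add: field_simps power2_eq_square)
  next
    \<comment> \<open>On the wave front s^2 = R the value 0 of \<open>r_density\<close> matches the
      open set \<open>{sqrt R<..}\<close>, so the two integrands agree everywhere.\<close>
    case False
    have "r_density c lam x y s = 0" if "s > 0"
    proof -
      have "s\<^sup>2 \<le> R" using False lt_iff[OF that] by simp
      then have "c\<^sup>2 * s\<^sup>2 \<le> x\<^sup>2 + y\<^sup>2" unfolding cR by (intro mult_left_mono) auto
      then show ?thesis by (simp add: r_density_def)
    qed
    then show ?thesis using False by (auto simp: q_integrand_def indicator_def)
  qed
  ultimately show ?thesis by (simp only: R_def)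
qed

section \<open>The fractional equation\<close>

lemma q_density_eq:
  assumes "c > 0" "lam > 0" "t > 0" "(x, y) \<noteq> (0, 0)"
  shows "q_density c lam x y t = q_rad c lam ((x\<^sup>2 + y\<^sup>2) / c\<^sup>2) t"
    "set_integrable lborel {0<..} (q_integrand c lam x y t)"
  using q_integrand_has_integral[OF assms] unfolding q_density_def
  by (simp_all only: has_integral_on_iff)

lemma q_rad_nonneg:
  assumes "c > 0" "lam > 0"
  shows "q_rad c lam R t \<ge> 0"
proof -
  have "line_kern lam m n R t \<ge> 0" for m n
    unfolding line_kern_def by (simp add: wkern_nonneg)
  then show ?thesis using assms by (simp add: q_rad_def q_const_def)
qed

definition q_rad_t :: "real \<Rightarrow> real \<Rightarrow> real \<Rightarrow> real \<Rightarrow> real" where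
  "q_rad_t c lam R t = q_const c lam * (Dt (\<lambda>m n. line_kern lam m n R t) (-1/2) (-1/2)
     + Dt (\<lambda>m n. line_kern lam m n R t) 0 (-3/2) / (4 * lam))"

definition q_rad_R :: "real \<Rightarrow> real \<Rightarrow> real \<Rightarrow> real \<Rightarrow> real" where
  "q_rad_R c lam R t = q_const c lam * (Dz lam (\<lambda>m n. line_kern lam m n R t) (-1/2) (-1/2)
     + Dz lam (\<lambda>m n. line_kern lam m n R t) 0 (-3/2) / (4 * lam))"

definition q_rad_RR :: "real \<Rightarrow> real \<Rightarrow> real \<Rightarrow> real \<Rightarrow> real" where
  "q_rad_RR c lam R t = q_const c lam * (Dz lam (Dz lam (\<lambda>m n. line_kern lam m n R t)) (-1/2) (-1/2)
     + Dz lam (Dz lam (\<lambda>m n. line_kern lam m n R t)) 0 (-3/2) / (4 * lam))"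

lemma q_rad_deriv_t:
  assumes "R > 0" "t > 0" "lam > 0"
  shows "((\<lambda>t. q_rad c lam R t) has_real_derivative q_rad_t c lam R t) (at t)"
  unfolding q_rad_def q_rad_t_def
  using assms by (intro DERIV_cmult DERIV_add DERIV_cdivide line_kern_deriv_t) auto

lemma Dz_line_kern_deriv_R:
  assumes "R > 0" "t > 0" "lam \<ge> 0"
  shows "((\<lambda>R. Dz lam (\<lambda>m n. line_kern lam m n R t) m n) has_real_derivative
    Dz lam (Dz lam (\<lambda>m n. line_kern lam m n R t)) m n) (at R)"
  unfolding Dz_def[of lam _ m n]
  by (intro DERIV_diff DERIV_cmult line_kern_deriv_R assms)

lemma q_rad_deriv_R:
  assumes "R > 0" "t > 0" "lam > 0"
  shows "((\<lambda>R. q_rad c lam R t) has_real_derivative q_rad_R c lam R t) (at R)"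
    "((\<lambda>R. q_rad_R c lam R t) has_real_derivative q_rad_RR c lam R t) (at R)"
  unfolding q_rad_def q_rad_R_def q_rad_RR_def
  using assms by (intro DERIV_cmult DERIV_add DERIV_cdivide line_kern_deriv_R Dz_line_kern_deriv_R; simp)+

text \<open>The factor sqrt pi is Gamma(1/2), and the bracket is the superposition of -dK/ds for K =
  p - (dp/ds) / (2 lam): its first term comes from -dp/ds, the other two from the second derivative
  of p divided by 2 lam. The contributions with t^(-1/2) produced by the Abel integrals
  cancel.\<close>

lemma q_rad_caputo:
  assumes R: "R > 0" and t: "t > 0" and lam: "lam > 0"
  defines "F \<equiv> \<lambda>m n. line_kern lam m n R t"
  shows "has_integral_on (\<lambda>u. q_rad_t c lam R u / (t - u) powr (1/2))
    (sqrt pi * q_const c lam * (1/2 * F 0 (-3/2) - 1 / (4 * lam) * F (-1/2) (-3/2) + 1 / (8 * lam) * F (1/2) (-5/2))) {0<..<t}"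
proof -
  have l: "lam \<ge> 0" using lam by simp
  note A = abel_line_kern_values[OF R t l]
  have "has_integral_on (\<lambda>u. q_const c lam * (- 1/2 * (line_kern lam (-1/2) (-3/2) R u / (t - u) powr (1/2))
      + 1/4 * (line_kern lam (1/2) (-5/2) R u / (t - u) powr (1/2))
      + (- 3 / (8 * lam)) * (line_kern lam 0 (-5/2) R u / (t - u) powr (1/2))
      + 1 / (16 * lam) * (line_kern lam 1 (-7/2) R u / (t - u) powr (1/2))))
    (q_const c lam * (- 1/2 * (2 * sqrt pi * line_kern lam (-1/2 - 1/2) (-1/2) R t)
      + 1/4 * (2 * sqrt pi * (line_kern lam (1/2 - 1/2) (-3/2) R t + 2 * line_kern lam (1/2 - 3/2) (-1/2) R t))
      + (- 3 / (8 * lam)) * (2 * sqrt pi * (line_kern lam (0 - 1/2) (-3/2) R t + 2 * line_kern lam (0 - 3/2) (-1/2) R t))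
      + 1 / (16 * lam) * (2 * sqrt pi * (line_kern lam (1 - 1/2) (-5/2) R t + 4 * line_kern lam (1 - 3/2) (-3/2) R t
        + 12 * line_kern lam (1 - 5/2) (-1/2) R t)))) {0<..<t}"
    by (intro has_integral_on_cmult has_integral_on_add A)
  then show ?thesis
    by (rule has_integral_on_eq) (use lam in \<open>simp_all add: q_rad_t_def Dt_def F_def field_simps\<close>)
qed

text \<open>On functions of R = (x^2 + y^2) / c^2 the right-hand operator of the equation is 4 R
  d^2/dR^2 + 4 d/dR. Once \<open>line_kern_ibp\<close> has replaced the term with R, it acts on the
  kernels as 4 z d^2/dz^2 + 6 d/dz - lam^2, which is the radial Laplacian in three variables minus
  lam^2, and only constant coefficients are left to compare.\<close>

lemma q_rad_pde:
  assumes R: "R > 0" and t: "t > 0" and lam: "lam > 0"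
  defines "F \<equiv> \<lambda>m n. line_kern lam m n R t"
  shows "q_rad_t c lam R t + 2 * lam * (q_const c lam * (1/2 * F 0 (-3/2) - 1 / (4 * lam) * F (-1/2) (-3/2) + 1 / (8 * lam) * F (1/2) (-5/2)))
    = 4 * R * q_rad_RR c lam R t + 4 * q_rad_R c lam R t"
proof -
  have l: "lam \<ge> 0" using lam by simp
  have I: "4 * R * Dz lam (Dz lam F) m n = 2 * Dz lam F m n + 4 * Dz lam (Dz lam (\<lambda>m. F (m + 1))) m n - lam\<^sup>2 * F m n" for m n
    using line_kern_ibp[OF R t l, of m n] unfolding F_def by linarith
  have "4 * R * q_rad_RR c lam R t + 4 * q_rad_R c lam R t = q_const c lam *
    ((4 * R * Dz lam (Dz lam F) (-1/2) (-1/2) + 4 * Dz lam F (-1/2) (-1/2))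
      + (4 * R * Dz lam (Dz lam F) 0 (-3/2) + 4 * Dz lam F 0 (-3/2)) / (4 * lam))"
    unfolding q_rad_RR_def q_rad_R_def F_def[symmetric] by (simp add: algebra_simps add_divide_distrib)
  also have "4 * R * Dz lam (Dz lam F) (-1/2) (-1/2) = 2 * Dz lam F (-1/2) (-1/2)
      + 4 * Dz lam (Dz lam (\<lambda>m. F (m + 1))) (-1/2) (-1/2) - lam\<^sup>2 * F (-1/2) (-1/2)"
    by (rule I)
  also have "4 * R * Dz lam (Dz lam F) 0 (-3/2) = 2 * Dz lam F 0 (-3/2)
      + 4 * Dz lam (Dz lam (\<lambda>m. F (m + 1))) 0 (-3/2) - lam\<^sup>2 * F 0 (-3/2)"
    by (rule I)
  also note E = calculation
  show ?thesis
    unfolding E unfolding q_rad_t_def F_def[symmetric] Dz_def Dt_def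
    using lam by (simp add: field_simps power2_eq_square)
qed

lemma q_density_pde:
  assumes c: "c > 0" and lam: "lam > 0" and t: "t > 0" and xy: "(x, y) \<noteq> (0, 0)"
  shows "set_integrable lborel {0<..} (q_integrand c lam x y t) \<and>
        q_density c lam x y t \<ge> 0 \<and>
        (\<lambda>u. q_density c lam x y u) differentiable (at t) \<and>
        caputo_half_differentiable (\<lambda>u. q_density c lam x y u) t \<and>
        twice_differentiable_at (\<lambda>u. q_density c lam u y t) x \<and>
        twice_differentiable_at (\<lambda>u. q_density c lam x u t) y \<and>
        deriv (\<lambda>u. q_density c lam x y u) t
            + 2 * lam * caputo_half_deriv (\<lambda>u. q_density c lam x y u) t
          = c\<^sup>2 * (deriv (deriv (\<lambda>u. q_density c lam u y t)) x
                 + deriv (deriv (\<lambda>u. q_density c lam x u t)) y)"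
proof -
  define R where "R = (\<lambda>x y. (x\<^sup>2 + y\<^sup>2) / c\<^sup>2)"
  have Rpos: "R x y > 0" if "(x, y) \<noteq> (0, 0)" for x y
    using c that by (auto simp: R_def sum_power2_gt_zero_iff)
  have q: "q_density c lam x y t = q_rad c lam (R x y) t" if "t > 0" "(x, y) \<noteq> (0, 0)" for x y t
    using q_density_eq(1)[OF c lam that] by (simp add: R_def)
  have Rxy: "R x y > 0" by (rule Rpos[OF xy])
  have dt: "((\<lambda>u. q_density c lam x y u) has_real_derivative q_rad_t c lam (R x y) s) (at s)" if "s > 0" for s
    using q_rad_deriv_t[OF Rxy that lam]
    by (rule has_field_derivative_transform_within_open[where S = "{0<..}"]) (use that q[OF _ xy] in auto)
  define cap where "cap = sqrt pi * q_const c lam * (1/2 * line_kern lam 0 (-3/2) (R x y) t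
     - 1 / (4 * lam) * line_kern lam (-1/2) (-3/2) (R x y) t + 1 / (8 * lam) * line_kern lam (1/2) (-5/2) (R x y) t)"
  have "has_integral_on (\<lambda>s. deriv (\<lambda>u. q_density c lam x y u) s / (t - s) powr (1/2)) cap {0<..<t}"
    by (rule has_integral_on_eq[OF q_rad_caputo[OF Rxy t lam, of c]]) (simp_all add: DERIV_imp_deriv[OF dt] cap_def)
  then have cap: "set_integrable lborel {0<..<t} (\<lambda>s. deriv (\<lambda>u. q_density c lam x y u) s / (t - s) powr (1/2))"
    "(LBINT s:{0<..<t}. deriv (\<lambda>u. q_density c lam x y u) s / (t - s) powr (1/2)) = cap"
    by (simp_all only: has_integral_on_iff)
  \<comment> \<open>One argument serves both coordinates: along either axis q is
    \<open>q_rad\<close> composed with a quadratic \<open>r\<close>, and the chain rule gives both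
    derivatives.\<close>
  have twice: "twice_differentiable_at f a \<and> deriv (deriv f) a = q_rad_RR c lam (r a) t * (2 * a / c\<^sup>2)\<^sup>2 + q_rad_R c lam (r a) t * (2 / c\<^sup>2)"
    if S: "open S" "a \<in> S" and f: "\<And>u. u \<in> S \<Longrightarrow> f u = q_rad c lam (r u) t" and r: "\<And>u. u \<in> S \<Longrightarrow> r u > 0"
      and dr: "\<And>u. (r has_real_derivative 2 * u / c\<^sup>2) (at u)" for f r :: "real \<Rightarrow> real" and S a
  proof -
    have d1: "(f has_real_derivative q_rad_R c lam (r u) t * (2 * u / c\<^sup>2)) (at u)" if u: "u \<in> S" for u
      using DERIV_chain2[OF q_rad_deriv_R(1)[OF r[OF u] t lam] dr]
      by (rule has_field_derivative_transform_within_open[OF _ S(1) u]) (simp add: f)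
    have "((\<lambda>u. q_rad_R c lam (r u) t * (2 * u / c\<^sup>2)) has_real_derivative
        q_rad_RR c lam (r a) t * (2 * a / c\<^sup>2) * (2 * a / c\<^sup>2) + 2 / c\<^sup>2 * q_rad_R c lam (r a) t) (at a)"
      by (intro DERIV_mult DERIV_chain2[OF q_rad_deriv_R(2)[OF r[OF S(2)] t lam] dr])
        (use c in \<open>auto intro!: derivative_eq_intros simp: field_simps\<close>)
    then have "((\<lambda>u. q_rad_R c lam (r u) t * (2 * u / c\<^sup>2)) has_real_derivative
        q_rad_RR c lam (r a) t * (2 * a / c\<^sup>2)\<^sup>2 + q_rad_R c lam (r a) t * (2 / c\<^sup>2)) (at a)"
      by (simp only: power2_eq_square mult_ac)
    then have d2: "(deriv f has_real_derivative
        q_rad_RR c lam (r a) t * (2 * a / c\<^sup>2)\<^sup>2 + q_rad_R c lam (r a) t * (2 / c\<^sup>2)) (at a)"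
      by (rule has_field_derivative_transform_within_open[OF _ S]) (simp add: DERIV_imp_deriv[OF d1])
    have "\<forall>\<^sub>F u in nhds a. f differentiable (at u)"
      using eventually_nhds_in_open[OF S] by eventually_elim (use d1 in \<open>auto simp: real_differentiable_def\<close>)
    then show ?thesis
      using d2 DERIV_imp_deriv[OF d2] by (auto simp: twice_differentiable_at_def real_differentiable_def)
  qed
  have dR: "((\<lambda>u. R u y) has_real_derivative 2 * u / c\<^sup>2) (at u)" "((\<lambda>u. R x u) has_real_derivative 2 * u / c\<^sup>2) (at u)" for u
    unfolding R_def by (intro DERIV_cdivide; auto intro!: derivative_eq_intros)+
  have tx: "twice_differentiable_at (\<lambda>u. q_density c lam u y t) x \<and> deriv (deriv (\<lambda>u. q_density c lam u y t)) x
     = q_rad_RR c lam (R x y) t * (2 * x / c\<^sup>2)\<^sup>2 + q_rad_R c lam (R x y) t * (2 / c\<^sup>2)"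
    by (rule twice[where S = "if y = 0 then - {0} else UNIV" and r = "\<lambda>u. R u y"])
      (use xy t in \<open>auto simp: q Rpos dR split: if_splits\<close>)
  have ty: "twice_differentiable_at (\<lambda>u. q_density c lam x u t) y \<and> deriv (deriv (\<lambda>u. q_density c lam x u t)) y
     = q_rad_RR c lam (R x y) t * (2 * y / c\<^sup>2)\<^sup>2 + q_rad_R c lam (R x y) t * (2 / c\<^sup>2)"
    by (rule twice[where S = "if x = 0 then - {0} else UNIV" and r = "\<lambda>u. R x u"])
      (use xy t in \<open>auto simp: q Rpos dR split: if_splits\<close>)
  have lap: "c\<^sup>2 * (deriv (deriv (\<lambda>u. q_density c lam u y t)) x + deriv (deriv (\<lambda>u. q_density c lam x u t)) y)
      = 4 * R x y * q_rad_RR c lam (R x y) t + 4 * q_rad_R c lam (R x y) t"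
  proof -
    have 1: "c\<^sup>2 * ((2 * x / c\<^sup>2)\<^sup>2 + (2 * y / c\<^sup>2)\<^sup>2) = 4 * R x y"
      using c by (simp add: R_def power_divide power2_eq_square field_simps)
    have 2: "c\<^sup>2 * (2 / c\<^sup>2) = 2" using c by simp
    have 3: "c\<^sup>2 * (q * a + p * b + (q * d + p * b)) = (c\<^sup>2 * (a + d)) * q + 2 * ((c\<^sup>2 * b) * p)" for a b d p q
      by (simp add: algebra_simps)
    show ?thesis unfolding tx[THEN conjunct2] ty[THEN conjunct2] 3 1 2 by simp
  qed
  have capv: "caputo_half_deriv (\<lambda>u. q_density c lam x y u) t = 1 / sqrt pi * cap"
    unfolding caputo_half_deriv_def cap(2) by (simp add: Gamma_one_half_real)
  have pde: "deriv (\<lambda>u. q_density c lam x y u) t + 2 * lam * caputo_half_deriv (\<lambda>u. q_density c lam x y u) t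
      = 4 * R x y * q_rad_RR c lam (R x y) t + 4 * q_rad_R c lam (R x y) t"
    unfolding capv DERIV_imp_deriv[OF dt[OF t]] q_rad_pde[OF Rxy t lam, symmetric] cap_def by simp
  show ?thesis
  proof (intro conjI)
    show "set_integrable lborel {0<..} (q_integrand c lam x y t)"
      by (rule q_density_eq(2)[OF c lam t xy])
    show "q_density c lam x y t \<ge> 0"
      unfolding q[OF t xy] by (rule q_rad_nonneg[OF c lam])
    show "(\<lambda>u. q_density c lam x y u) differentiable (at t)"
      using dt[OF t] by (auto simp: real_differentiable_def)
    show "caputo_half_differentiable (\<lambda>u. q_density c lam x y u) t"
      unfolding caputo_half_differentiable_def real_differentiable_def
    proof (intro conjI ballI cap(1))
      fix s assume "s \<in> {0<..<t}"
      then show "\<exists>D. ((\<lambda>u. q_density c lam x y u) has_real_derivative D) (at s)"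
        using dt[of s] by (simp add: exI[of _ "q_rad_t c lam (R x y) s"])
    qed
  qed (use tx ty pde lap in simp_all)
qed

section \<open>Uniqueness of planar characteristic functions\<close>

text \<open>Frequency 0 gives the total mass, which is therefore common to both measures. If it is
  positive, division by it reduces the claim to probability measures.\<close>

lemma finite_measure_char_unique:
  fixes M N :: "real measure"
  assumes "finite_measure M" "finite_measure N"
    and M[measurable_cong]: "sets M = sets borel" and N[measurable_cong]: "sets N = sets borel"
    and eq: "\<And>t. (CLINT x|M. iexp (t * x)) = (CLINT x|N. iexp (t * x))"
  shows "M = N"
proof -
  interpret M: finite_measure M by fact
  interpret N: finite_measure N by fact
  have sp: "space M = UNIV" "space N = UNIV" using sets_eq_imp_space_eq[OF M] sets_eq_imp_space_eq[OF N] by simp_all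
  define m where "m = measure M UNIV"
  have mN: "measure N UNIV = m" using eq[of 0] sp by (simp add: m_def)
  have eM: "emeasure M UNIV = ennreal m" "emeasure N UNIV = ennreal m"
    using mN sp by (simp_all add: m_def M.emeasure_eq_measure N.emeasure_eq_measure)
  show ?thesis
  proof (cases "m = 0")
    case True
    show ?thesis
    proof (rule measure_eqI)
      fix A assume "A \<in> sets M"
      have "emeasure M A \<le> emeasure M UNIV" "emeasure N A \<le> emeasure N UNIV"
        using sp sets.top[of M] sets.top[of N] by (auto intro!: emeasure_mono)
      then show "emeasure M A = emeasure N A" using eM True by simp
    qed (simp add: M N)
  next
    case False
    then have m: "m > 0" by (simp add: m_def less_le)
    have *: "real_distribution (density K (\<lambda>_. ennreal (1 / m)))
       \<and> char (density K (\<lambda>_. ennreal (1 / m))) = (\<lambda>t. (1 / m) *\<^sub>R (CLINT x|K. iexp (t * x)))"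
      if K: "sets K = sets borel" "emeasure K UNIV = ennreal m" for K :: "real measure"
    proof
      have [measurable_cong]: "sets K = sets borel" by fact
      have spK: "space K = UNIV" using sets_eq_imp_space_eq[OF K(1)] by simp
      have "prob_space (density K (\<lambda>_. ennreal (1 / m)))"
        using m K(2) spK sets.top[of K]
        by (intro prob_spaceI) (simp add: emeasure_density_const ennreal_mult[symmetric])
      then show "real_distribution (density K (\<lambda>_. ennreal (1 / m)))"
        by (intro real_distribution.intro real_distribution_axioms.intro) (simp_all add: K spK)
      show "char (density K (\<lambda>_. ennreal (1 / m))) = (\<lambda>t. (1 / m) *\<^sub>R (CLINT x|K. iexp (t * x)))"
        using m unfolding char_def by (subst integral_density) (auto simp del: ennreal_1)
    qed
    have "density M (\<lambda>_. ennreal (1 / m)) = density N (\<lambda>_. ennreal (1 / m))"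
      using *[OF M eM(1)] *[OF N eM(2)] eq by (intro Levy_uniqueness) auto
    then have "density (density M (\<lambda>_. ennreal (1 / m))) (\<lambda>_. ennreal m)
        = density (density N (\<lambda>_. ennreal (1 / m))) (\<lambda>_. ennreal m)" by simp
    then show ?thesis
      using m by (simp add: density_density_eq ennreal_mult[symmetric] density_1)
  qed
qed

text \<open>One-dimensional uniqueness is applied to the first marginals of the positive measures
  with densities \<open>k + c * h (snd v)\<close>.\<close>

lemma weighted_char_unique:
  fixes P Q :: "(real \<times> real) measure" and h :: "real \<Rightarrow> real"
  assumes "prob_space P" "prob_space Q"
    and P[measurable_cong]: "sets P = sets borel" and Q[measurable_cong]: "sets Q = sets borel"
    and h[measurable]: "h \<in> borel_measurable borel" and h1: "\<And>y. \<bar>h y\<bar> \<le> 1"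
    and eq0: "\<And>a. (CLINT v|P. iexp (a * fst v)) = (CLINT v|Q. iexp (a * fst v))"
    and eqh: "\<And>a. (CLINT v|P. h (snd v) *\<^sub>R iexp (a * fst v)) = (CLINT v|Q. h (snd v) *\<^sub>R iexp (a * fst v))"
    and A: "A \<in> sets borel"
  shows "(LINT v|P. indicator A (fst v) * h (snd v)) = (LINT v|Q. indicator A (fst v) * h (snd v))"
proof -
  have [measurable]: "fst \<in> borel_measurable (borel :: (real \<times> real) measure)"
    "snd \<in> borel_measurable (borel :: (real \<times> real) measure)"
    by (auto intro!: borel_measurable_continuous_onI continuous_intros)
  have main: "distr (density P (\<lambda>v. ennreal (k + c * h (snd v)))) borel fst
      = distr (density Q (\<lambda>v. ennreal (k + c * h (snd v)))) borel fst"
    if kc: "k \<ge> \<bar>c\<bar>" for k c :: real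
  proof -
    have pos: "k + c * h y \<ge> 0" for y
    proof -
      have "\<bar>c * h y\<bar> \<le> \<bar>c\<bar> * 1" unfolding abs_mult by (intro mult_left_mono h1) auto
      then show ?thesis using kc by linarith
    qed
    have fin: "finite_measure (distr (density K (\<lambda>v. ennreal (k + c * h (snd v)))) borel fst)"
      and ch: "(CLINT x|distr (density K (\<lambda>v. ennreal (k + c * h (snd v)))) borel fst. iexp (t * x))
        = k *\<^sub>R (CLINT v|K. iexp (t * fst v)) + c *\<^sub>R (CLINT v|K. h (snd v) *\<^sub>R iexp (t * fst v))"
      if K: "prob_space K" "sets K = sets borel" for K t
    proof -
      interpret K: prob_space K by fact
      have [measurable_cong]: "sets K = sets borel" by fact
      have ih: "integrable K (\<lambda>v. h (snd v))"
        by (rule K.integrable_const_bound[where B = 1]) (auto simp: h1)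
      have i1: "integrable K (\<lambda>v. iexp (t * fst v))"
        by (rule K.integrable_const_bound[where B = 1]) auto
      have i2: "integrable K (\<lambda>v. h (snd v) *\<^sub>R iexp (t * fst v))"
        by (rule K.integrable_const_bound[where B = 1]) (auto simp: h1)
      have "emeasure (density K (\<lambda>v. ennreal (k + c * h (snd v)))) (space K)
          = (\<integral>\<^sup>+v. ennreal (k + c * h (snd v)) \<partial>K)"
        by (subst emeasure_density) (auto intro!: nn_integral_cong)
      also have "\<dots> = ennreal (LINT v|K. k + c * h (snd v))"
        using ih pos by (subst nn_integral_eq_integral) auto
      finally have "finite_measure (density K (\<lambda>v. ennreal (k + c * h (snd v))))"
        by (intro finite_measureI) simp
      then show "finite_measure (distr (density K (\<lambda>v. ennreal (k + c * h (snd v)))) borel fst)"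
        by (rule finite_measure.finite_measure_distr) simp
      have "(CLINT x|distr (density K (\<lambda>v. ennreal (k + c * h (snd v)))) borel fst. iexp (t * x))
        = (CLINT v|K. (k + c * h (snd v)) *\<^sub>R iexp (t * fst v))"
        using pos by (subst integral_distr) (simp_all add: integral_density)
      also have "\<dots> = (CLINT v|K. k *\<^sub>R iexp (t * fst v) + c *\<^sub>R (h (snd v) *\<^sub>R iexp (t * fst v)))"
        by (simp add: scaleR_add_left)
      also have "\<dots> = k *\<^sub>R (CLINT v|K. iexp (t * fst v)) + c *\<^sub>R (CLINT v|K. h (snd v) *\<^sub>R iexp (t * fst v))"
        using i1 i2 by (simp only: Bochner_Integration.integral_add integrable_scaleR_right integral_scaleR_right)
      finally show "(CLINT x|distr (density K (\<lambda>v. ennreal (k + c * h (snd v)))) borel fst. iexp (t * x))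
        = k *\<^sub>R (CLINT v|K. iexp (t * fst v)) + c *\<^sub>R (CLINT v|K. h (snd v) *\<^sub>R iexp (t * fst v))" .
    qed
    show ?thesis
      using fin[OF assms(1) P] fin[OF assms(2) Q] ch[OF assms(1) P] ch[OF assms(2) Q] eq0 eqh
      by (intro finite_measure_char_unique) auto
  qed
  have val: "measure (distr (density K (\<lambda>v. ennreal (k + c * h (snd v)))) borel fst) A
     = k * measure K (A \<times> UNIV) + c * (LINT v|K. indicator A (fst v) * h (snd v))"
    if K: "prob_space K" "sets K = sets borel" and kc: "k \<ge> \<bar>c\<bar>" for K k c
  proof -
    interpret K: prob_space K by fact
    have [measurable_cong]: "sets K = sets borel" by fact
    have spK: "space K = UNIV" using sets_eq_imp_space_eq[OF K(2)] by simp
    have AU: "A \<times> UNIV = fst -` A \<inter> space K" by (auto simp: spK)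
    have AUs: "A \<times> UNIV \<in> sets K" unfolding AU using A by measurable
    have pos: "k + c * h y \<ge> 0" for y
    proof -
      have "\<bar>c * h y\<bar> \<le> \<bar>c\<bar> * 1" unfolding abs_mult by (intro mult_left_mono h1) auto
      then show ?thesis using kc by linarith
    qed
    have i1: "integrable K (\<lambda>v. indicator A (fst v) :: real)"
      using A by (intro K.integrable_const_bound[where B = 1]) (auto simp: indicator_def)
    have i2: "integrable K (\<lambda>v. indicator A (fst v) * h (snd v))"
      using A by (intro K.integrable_const_bound[where B = 1]) (auto simp: indicator_def h1)
    have "measure (distr (density K (\<lambda>v. ennreal (k + c * h (snd v)))) borel fst) A
      = (LINT v|density K (\<lambda>v. ennreal (k + c * h (snd v))). indicator (A \<times> UNIV) v)"
      using A AUs by (subst measure_distr) (auto simp: spK AU)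
    also have "\<dots> = (LINT v|K. (k + c * h (snd v)) * indicator A (fst v))"
      using pos AUs by (subst integral_density) (auto intro!: Bochner_Integration.integral_cong simp: indicator_def)
    also have "\<dots> = (LINT v|K. k * indicator A (fst v) + c * (indicator A (fst v) * h (snd v)))"
      by (simp add: algebra_simps)
    also have "\<dots> = k * (LINT v|K. indicator A (fst v)) + c * (LINT v|K. indicator A (fst v) * h (snd v))"
      using i1 i2 by simp
    also have "(LINT v|K. indicator A (fst v)) = (LINT v|K. indicator (A \<times> UNIV) v)"
      by (intro Bochner_Integration.integral_cong) (auto simp: indicator_def)
    also have "\<dots> = measure K (A \<times> UNIV)" using AUs spK by simp
    finally show ?thesis .
  qed
  \<comment> \<open>The constant weight 1 (c = 0, k = 1) identifies the first marginals. The weight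
    1 + h (c = k = 1) is nonnegative, and subtracting the first identity isolates the part with
    h.\<close>
  have 1: "measure P (A \<times> UNIV) = measure Q (A \<times> UNIV)"
    using val[OF assms(1) P, of 0 1] val[OF assms(2) Q, of 0 1] main[of 0 1] by simp
  show "(LINT v|P. indicator A (fst v) * h (snd v)) = (LINT v|Q. indicator A (fst v) * h (snd v))"
    using val[OF assms(1) P, of 1 1] val[OF assms(2) Q, of 1 1] main[of 1 1] 1 by simp
qed

lemma measure_eq_on_rectangles:
  fixes P Q :: "(real \<times> real) measure"
  assumes "prob_space P" "sets P = sets borel" "sets Q = sets borel"
    and eq: "\<And>A B. A \<in> sets borel \<Longrightarrow> B \<in> sets borel \<Longrightarrow> emeasure P (A \<times> B) = emeasure Q (A \<times> B)"
  shows "P = Q"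
proof (rule measure_eqI_generator_eq[where E = "{A \<times> B | A B. A \<in> sets (borel :: real measure) \<and> B \<in> sets (borel :: real measure)}"
      and \<Omega> = UNIV and A = "\<lambda>_. UNIV"])
  have *: "sets (borel :: (real \<times> real) measure) = sigma_sets UNIV {A \<times> B | A B. A \<in> sets (borel :: real measure) \<and> B \<in> sets (borel :: real measure)}"
    unfolding borel_prod[symmetric] sets_pair_measure by simp
  show "sets P = sigma_sets UNIV {A \<times> B | A B. A \<in> sets (borel :: real measure) \<and> B \<in> sets (borel :: real measure)}"
    "sets Q = sigma_sets UNIV {A \<times> B | A B. A \<in> sets (borel :: real measure) \<and> B \<in> sets (borel :: real measure)}"
    using assms(2,3) * by simp_all
  show "Int_stable {A \<times> B | A B. A \<in> sets (borel :: real measure) \<and> B \<in> sets (borel :: real measure)}"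
    by (rule Int_stable_pair_measure_generator)
  interpret prob_space P by fact
  show "emeasure P UNIV \<noteq> \<infinity>" by simp
  show "range (\<lambda>_. UNIV) \<subseteq> {A \<times> B | A B. A \<in> sets (borel :: real measure) \<and> B \<in> sets (borel :: real measure)}"
    by (auto intro!: exI[of _ UNIV])
qed (auto simp: eq)

text \<open>For a fixed frequency b the weights cos (b y) and sin (b y) allow an inversion in the
  first coordinate, which replaces e^(i a x) by the indicator of A. For fixed A the resulting
  integrals are the real and imaginary parts of the characteristic function of a finite measure in
  the second coordinate, which is inverted in turn.\<close>

lemma char_prod_unique:
  fixes P Q :: "(real \<times> real) measure"
  assumes P: "prob_space P" "sets P = sets borel" and Q: "prob_space Q" "sets Q = sets borel"
    and eq: "\<And>\<xi>. (CLINT v|P. iexp (\<xi> \<bullet> v)) = (CLINT v|Q. iexp (\<xi> \<bullet> v))"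
  shows "P = Q"
proof (rule measure_eq_on_rectangles[OF P Q(2)])
  fix A B :: "real set" assume A: "A \<in> sets borel" and B: "B \<in> sets borel"
  have [measurable]: "fst \<in> borel_measurable (borel :: (real \<times> real) measure)"
    "snd \<in> borel_measurable (borel :: (real \<times> real) measure)"
    by (auto intro!: borel_measurable_continuous_onI continuous_intros)
  have int: "integrable K (\<lambda>v. iexp (\<xi> \<bullet> v))" if "prob_space K" "sets K = sets borel"
    for K :: "(real \<times> real) measure" and \<xi>
  proof -
    have [measurable_cong]: "sets K = sets borel" by fact
    show ?thesis
      by (rule prob_space.integrable_iexp[OF that(1)]) simp_all
  qed
  have fst_eq: "(CLINT v|P. iexp (a * fst v)) = (CLINT v|Q. iexp (a * fst v))" for a
    using eq[of "(a, 0)"] by (simp add: inner_prod_def)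
  have cos_eq: "(CLINT v|P. cos (b * snd v) *\<^sub>R iexp (a * fst v)) = (CLINT v|Q. cos (b * snd v) *\<^sub>R iexp (a * fst v))" for a b
  proof -
    \<comment> \<open>The weighted character is the mean of the planar characters at (a, b) and (a,
      -b), so the hypothesis covers it.\<close>
    have e: "cos (b * snd v) *\<^sub>R iexp (a * fst v) = (1/2) * (iexp ((a, b) \<bullet> v) + iexp ((a, - b) \<bullet> v))" for v :: "real \<times> real"
      by (simp add: inner_prod_def scaleR_conv_of_real cos_of_real[symmetric] cos_exp_eq algebra_simps exp_add exp_minus exp_diff field_simps)
    show ?thesis unfolding e using int[OF P] int[OF Q] eq by simp
  qed
  have sin_eq: "(CLINT v|P. sin (b * snd v) *\<^sub>R iexp (a * fst v)) = (CLINT v|Q. sin (b * snd v) *\<^sub>R iexp (a * fst v))" for a b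
  proof -
    have e: "sin (b * snd v) *\<^sub>R iexp (a * fst v) = (1 / (2 * \<i>)) * (iexp ((a, b) \<bullet> v) - iexp ((a, - b) \<bullet> v))" for v :: "real \<times> real"
      by (simp add: inner_prod_def scaleR_conv_of_real sin_of_real[symmetric] sin_exp_eq algebra_simps exp_add exp_minus exp_diff field_simps)
    show ?thesis unfolding e using int[OF P] int[OF Q] eq by simp
  qed
  have cosA: "(LINT v|P. indicator A (fst v) * cos (b * snd v)) = (LINT v|Q. indicator A (fst v) * cos (b * snd v))" for b
    using weighted_char_unique[OF P(1) Q(1) P(2) Q(2), of "\<lambda>y. cos (b * y)" A] fst_eq cos_eq A by simp
  have sinA: "(LINT v|P. indicator A (fst v) * sin (b * snd v)) = (LINT v|Q. indicator A (fst v) * sin (b * snd v))" for b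
    using weighted_char_unique[OF P(1) Q(1) P(2) Q(2), of "\<lambda>y. sin (b * y)" A] fst_eq sin_eq A by simp
  have *: "finite_measure (distr (density K (\<lambda>v. indicator A (fst v))) borel snd)
      \<and> (CLINT x|distr (density K (\<lambda>v. indicator A (fst v))) borel snd. iexp (t * x))
        = of_real (LINT v|K. indicator A (fst v) * cos (t * snd v)) + \<i> * of_real (LINT v|K. indicator A (fst v) * sin (t * snd v))
      \<and> emeasure (distr (density K (\<lambda>v. indicator A (fst v))) borel snd) B = emeasure K (A \<times> B)"
    if K: "prob_space K" "sets K = sets borel" for K :: "(real \<times> real) measure" and t
  proof (intro conjI)
    interpret K: prob_space K by fact
    have [measurable_cong]: "sets K = sets borel" by fact
    have spK: "space K = UNIV" using sets_eq_imp_space_eq[OF K(2)] by simp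
    note A[measurable] B[measurable]
    have em: "emeasure (density K (\<lambda>v. indicator A (fst v))) (UNIV \<times> C) = emeasure K (A \<times> C)" if C: "C \<in> sets borel" for C
    proof -
      have m: "D \<times> C \<in> sets K" if "D \<in> sets borel" for D
        unfolding K(2) borel_prod[symmetric] using C that by simp
      have "emeasure (density K (\<lambda>v. indicator A (fst v))) (UNIV \<times> C) = (\<integral>\<^sup>+v. indicator (A \<times> C) v \<partial>K)"
        using m[of UNIV] by (subst emeasure_density) (auto intro!: nn_integral_cong split: split_indicator)
      then show ?thesis using m by simp
    qed
    have "finite_measure (density K (\<lambda>v. indicator A (fst v)))"
      using em[of UNIV] by (intro finite_measureI) (simp add: spK)
    then show "finite_measure (distr (density K (\<lambda>v. indicator A (fst v))) borel snd)"
      by (rule finite_measure.finite_measure_distr) simp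
    have "snd -` B \<inter> UNIV = (UNIV :: real set) \<times> B" by auto
    then show "emeasure (distr (density K (\<lambda>v. indicator A (fst v))) borel snd) B = emeasure K (A \<times> B)"
      using em[OF B] by (subst emeasure_distr) (auto simp: spK)
    have i1: "integrable K (\<lambda>v. indicator A (fst v) * cos (t * snd v))"
      by (rule K.integrable_const_bound[where B = 1]) (auto simp: indicator_def)
    have i2: "integrable K (\<lambda>v. indicator A (fst v) * sin (t * snd v))"
      by (rule K.integrable_const_bound[where B = 1]) (auto simp: indicator_def)
    have "(CLINT x|distr (density K (\<lambda>v. indicator A (fst v))) borel snd. iexp (t * x))
      = (CLINT x|distr (density K (\<lambda>v. ennreal (indicator A (fst v)))) borel snd. iexp (t * x))"
      by (simp add: ennreal_indicator)
    also have "\<dots> = (CLINT v|K. indicator A (fst v) *\<^sub>R iexp (t * snd v))"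
      by (subst integral_distr) (simp_all add: integral_density)
    also have "\<dots> = (CLINT v|K. of_real (indicator A (fst v) * cos (t * snd v)) + \<i> * of_real (indicator A (fst v) * sin (t * snd v)))"
      by (intro Bochner_Integration.integral_cong)
        (auto simp: scaleR_conv_of_real exp_Euler cos_of_real[symmetric] sin_of_real[symmetric] algebra_simps)
    also have "\<dots> = of_real (LINT v|K. indicator A (fst v) * cos (t * snd v)) + \<i> * of_real (LINT v|K. indicator A (fst v) * sin (t * snd v))"
      using i1 i2 by (subst Bochner_Integration.integral_add) (auto simp del: of_real_mult)
    finally show "(CLINT x|distr (density K (\<lambda>v. indicator A (fst v))) borel snd. iexp (t * x))
        = of_real (LINT v|K. indicator A (fst v) * cos (t * snd v)) + \<i> * of_real (LINT v|K. indicator A (fst v) * sin (t * snd v))" .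
  qed
  have "distr (density P (\<lambda>v. indicator A (fst v))) borel snd = distr (density Q (\<lambda>v. indicator A (fst v))) borel snd"
    using *[OF P] *[OF Q] cosA sinA by (intro finite_measure_char_unique) auto
  with *[OF P] *[OF Q] show "emeasure P (A \<times> B) = emeasure Q (A \<times> B)" by simp
qed

section \<open>The law of the inverse subordinator\<close>

text \<open>Both measures are concentrated on [0, 1], where polynomials approximate \<open>f\<close>
  uniformly, and polynomials have equal expectations.\<close>

lemma expectation_eq_of_moments:
  fixes f :: "real \<Rightarrow> real"
  assumes M: "real_distribution M" and N: "real_distribution N"
    and M01: "AE x in M. x \<in> {0..1}" and N01: "AE x in N. x \<in> {0..1}"
    and mom: "\<And>n. (LINT x|M. x ^ n) = (LINT x|N. x ^ n)"
    and f: "continuous_on {0..1} f" and [measurable]: "f \<in> borel_measurable borel"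
  shows "(LINT x|M. f x) = (LINT x|N. f x)"
proof (rule ccontr)
  assume neq: "(LINT x|M. f x) \<noteq> (LINT x|N. f x)"
  \<comment> \<open>A third of the gap: the approximation costs at most e under each measure, and 2
    e < 3 e.\<close>
  define e where "e = \<bar>(LINT x|M. f x) - (LINT x|N. f x)\<bar> / 3"
  have e: "e > 0" using neq by (simp add: e_def)
  obtain g where g: "real_polynomial_function g" "\<And>x. x \<in> {0..1} \<Longrightarrow> \<bar>f x - g x\<bar> < e"
    using Stone_Weierstrass_real_polynomial_function[OF compact_Icc f e] by blast
  obtain a n where gs: "g = (\<lambda>x. \<Sum>i\<le>n. a i * x ^ i)"
    using g(1) real_polynomial_function_iff_sum by blast
  have gm[measurable]: "g \<in> borel_measurable borel" unfolding gs by measurable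
  have *: "\<bar>(LINT x|K. f x) - (LINT x|K. g x)\<bar> \<le> e \<and> (LINT x|K. g x) = (\<Sum>i\<le>n. a i * (LINT x|K. x ^ i))"
    if K: "real_distribution K" and K01: "AE x in K. x \<in> {0..1}" for K
  proof
    interpret K: real_distribution K by fact
    have bounded_int: "integrable K h" if "\<forall>x\<in>{0..1}. \<bar>h x\<bar> \<le> B" "h \<in> borel_measurable borel" for h :: "real \<Rightarrow> real" and B
    proof (rule K.integrable_const_bound[where B = B])
      show "AE x in K. norm (h x) \<le> B" using K01 by eventually_elim (auto simp: that)
    qed (use that in measurable)
    have p: "integrable K (\<lambda>x. x ^ i)" for i
      by (rule bounded_int[of _ 1]) (auto simp: power_le_one)
    obtain B where B: "\<forall>x\<in>{0..1}. \<bar>f x\<bar> \<le> B"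
      using compact_continuous_image[OF f compact_Icc, THEN compact_imp_bounded] unfolding bounded_iff by auto
    have fi: "integrable K f" by (rule bounded_int[OF B]) auto
    have gi: "integrable K g" unfolding gs using p by simp
    show "(LINT x|K. g x) = (\<Sum>i\<le>n. a i * (LINT x|K. x ^ i))"
      unfolding gs using p by simp
    have "\<bar>(LINT x|K. f x) - (LINT x|K. g x)\<bar> = \<bar>LINT x|K. f x - g x\<bar>"
      using fi gi by simp
    also have "\<dots> \<le> (LINT x|K. \<bar>f x - g x\<bar>)" by (rule integral_abs_bound)
    also have "\<dots> \<le> (LINT x|K. e)"
    proof (rule integral_mono_AE)
      show "AE x in K. \<bar>f x - g x\<bar> \<le> e" using K01 by eventually_elim (auto intro!: less_imp_le[OF g(2)])
    qed (use fi gi in auto)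
    also have "\<dots> = e" using K.prob_space by simp
    finally show "\<bar>(LINT x|K. f x) - (LINT x|K. g x)\<bar> \<le> e" .
  qed
  have "\<bar>(LINT x|M. f x) - (LINT x|N. f x)\<bar> \<le> e + e"
    using *[OF M M01] *[OF N N01] unfolding mom by linarith
  also have "\<bar>(LINT x|M. f x) - (LINT x|N. f x)\<bar> = 3 * e" by (simp add: e_def)
  finally show False using e by simp
qed

text \<open>Cosine and sine of t x are continuous on [0, 1], so the moments fix the characteristic
  function.\<close>

lemma real_distribution_eq_of_moments:
  assumes M: "real_distribution M" and N: "real_distribution N"
    and M01: "AE x in M. x \<in> {0..1}" and N01: "AE x in N. x \<in> {0..1}"
    and mom: "\<And>n. (LINT x|M. x ^ n) = (LINT x|N. x ^ n)"
  shows "M = N"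
proof (rule Levy_uniqueness[OF M N], rule ext)
  have *: "char K t = of_real (LINT x|K. cos (t * x)) + \<i> * of_real (LINT x|K. sin (t * x))"
    if "real_distribution K" for K t
  proof -
    interpret K: real_distribution K by fact
    have i: "integrable K (\<lambda>x. cos (t * x))" "integrable K (\<lambda>x. sin (t * x))"
      by (auto intro!: K.integrable_const_bound[where B = 1])
    have "char K t = (CLINT x|K. of_real (cos (t * x)) + \<i> * of_real (sin (t * x)))"
      unfolding char_def by (intro Bochner_Integration.integral_cong)
        (auto simp: exp_Euler cos_of_real[symmetric] sin_of_real[symmetric])
    also have "\<dots> = of_real (LINT x|K. cos (t * x)) + \<i> * of_real (LINT x|K. sin (t * x))"
      using i by simp
    finally show ?thesis .
  qed
  have "(LINT x|M. cos (t * x)) = (LINT x|N. cos (t * x))" "(LINT x|M. sin (t * x)) = (LINT x|N. sin (t * x))" for t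
    by (rule expectation_eq_of_moments[OF assms]; auto intro!: continuous_intros)+
  then show "char M t = char N t" for t
    using *[OF M] *[OF N] by simp
qed

section \<open>The one-sided stable law of index 1/2 through a half-Gaussian variable\<close>

definition half_gauss_density :: "real \<Rightarrow> real" where
  "half_gauss_density r = indicator {0<..} r * (2 / sqrt pi * exp (- r\<^sup>2))"

text \<open>The law of the absolute value of a centered Gaussian variable with variance 1/2.\<close>

definition half_gauss :: "real measure" where
  "half_gauss = density lborel half_gauss_density"

lemma half_gauss_density_measurable [measurable]: "half_gauss_density \<in> borel_measurable borel"
  unfolding half_gauss_density_def by measurable

lemma half_gauss_density_nonneg: "half_gauss_density r \<ge> 0"
  by (simp add: half_gauss_density_def)

lemma half_gauss_density_integral: "has_bochner_integral lborel half_gauss_density 1"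
  using has_integral_on_cmult[OF has_integral_on_gaussian, of "2 / sqrt pi"]
  by (simp add: half_gauss_density_def[abs_def])

lemma sets_half_gauss [simp, measurable_cong]: "sets half_gauss = sets borel"
  by (simp add: half_gauss_def)

lemma space_half_gauss [simp]: "space half_gauss = UNIV"
  by (simp add: half_gauss_def)

lemma prob_space_half_gauss: "prob_space half_gauss"
proof
  have "emeasure half_gauss (space half_gauss) = (\<integral>\<^sup>+r. ennreal (half_gauss_density r) \<partial>lborel)"
    by (simp add: half_gauss_def emeasure_density)
  also have "\<dots> = ennreal 1"
    using half_gauss_density_integral half_gauss_density_nonneg
    by (subst nn_integral_eq_integral) (auto simp: has_bochner_integral_iff)
  finally show "emeasure half_gauss (space half_gauss) = 1" by simp
qed

lemma AE_half_gauss_pos: "AE r in half_gauss. r > 0"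
  unfolding half_gauss_def by (subst AE_density) (auto simp: half_gauss_density_def indicator_def)

text \<open>Only integer arguments of the Laplace transform enter: its value at n is the n-th moment
  of exp (- H s), a variable in [0, 1], and such moments determine the law.\<close>

lemma stable_half_law:
  assumes M: "prob_space M" and H: "stable_half_subordinator M H" and s: "s > 0" and b: "b > 0"
  shows "measure M {\<omega> \<in> space M. H s \<omega> \<ge> b} = measure half_gauss {..s / (2 * sqrt b)}"
proof -
  interpret M: prob_space M by fact
  interpret G: prob_space half_gauss by (rule prob_space_half_gauss)
  have Hm[measurable]: "H s \<in> borel_measurable M"
    and H0: "\<And>\<omega>. \<omega> \<in> space M \<Longrightarrow> H 0 \<omega> = 0"
    using H s by (auto simp: stable_half_subordinator_def stationary_indep_increments_def)
  have Hpos: "H s \<omega> \<ge> 0" if "\<omega> \<in> space M" for \<omega>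
  proof -
    have "mono_on {0..} (\<lambda>t. H t \<omega>)" using H that by (auto simp: stable_half_subordinator_def)
    from mono_onD[OF this, of 0 s] s H0[OF that] show ?thesis by simp
  qed
  define Y where "Y = (\<lambda>r. exp (- (s\<^sup>2 / (4 * r\<^sup>2))) :: real)"
  have Ym[measurable]: "Y \<in> borel_measurable borel" unfolding Y_def by measurable
  have momH: "(LINT \<omega>|M. exp (- H s \<omega>) ^ n) = exp (- s * sqrt n)" for n :: nat
  proof -
    have "(LINT \<omega>|M. exp (- real n * H s \<omega>)) = exp (- s * sqrt (real n))"
      using H s by (auto simp: stable_half_subordinator_def)
    then show ?thesis by (simp add: exp_of_nat_mult[symmetric])
  qed
  \<comment> \<open>The Cauchy-Schloemilch integral with a = 1 and b = n s^2 / 4; the moment n = 0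
    is its degenerate case b = 0.\<close>
  have momY: "(LINT r|half_gauss. Y r ^ n) = exp (- s * sqrt n)" for n :: nat
  proof -
    have "(LINT r|half_gauss. Y r ^ n) = (\<integral>r. half_gauss_density r * Y r ^ n \<partial>lborel)"
      unfolding half_gauss_def by (subst integral_density) (auto simp: half_gauss_density_nonneg)
    also have "\<dots> = (\<integral>r. 2 / sqrt pi * (indicator {0<..} r *\<^sub>R exp (- (1 * r\<^sup>2 + (real n * s\<^sup>2 / 4) / r\<^sup>2))) \<partial>lborel)"
      by (intro Bochner_Integration.integral_cong)
        (auto simp: half_gauss_density_def Y_def exp_of_nat_mult[symmetric] exp_add[symmetric] field_simps)
    also have "\<dots> = 2 / sqrt pi * (sqrt (pi / 1) / 2 * exp (- 2 * sqrt (1 * (real n * s\<^sup>2 / 4))))"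
      using has_bochner_integral_integral_eq[OF cauchy_schloemilch[of 1 "real n * s\<^sup>2 / 4"]] by (simp add: field_simps)
    also have "sqrt (1 * (real n * s\<^sup>2 / 4)) = s * sqrt n / 2"
      using s by (simp add: real_sqrt_mult real_sqrt_divide)
    finally show ?thesis by simp
  qed
  have "distr M borel (\<lambda>\<omega>. exp (- H s \<omega>)) = distr half_gauss borel Y"
  proof (rule real_distribution_eq_of_moments)
    show "real_distribution (distr M borel (\<lambda>\<omega>. exp (- H s \<omega>)))" by (rule M.real_distribution_distr) simp
    show "real_distribution (distr half_gauss borel Y)" by (rule G.real_distribution_distr) simp
    show "AE x in distr M borel (\<lambda>\<omega>. exp (- H s \<omega>)). x \<in> {0..1}"
      by (subst AE_distr_iff) (auto simp: Hpos)
    show "AE x in distr half_gauss borel Y. x \<in> {0..1}"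
      by (subst AE_distr_iff) (auto simp: Y_def)
    show "(LINT x|distr M borel (\<lambda>\<omega>. exp (- H s \<omega>)). x ^ n) = (LINT x|distr half_gauss borel Y. x ^ n)" for n
      using momH[of n] momY[of n] by (simp add: integral_distr)
  qed
  then have "measure (distr M borel (\<lambda>\<omega>. exp (- H s \<omega>))) {..exp (- b)} = measure (distr half_gauss borel Y) {..exp (- b)}"
    by simp
  moreover have "measure (distr M borel (\<lambda>\<omega>. exp (- H s \<omega>))) {..exp (- b)} = measure M {\<omega> \<in> space M. H s \<omega> \<ge> b}"
    by (subst measure_distr) (auto intro!: arg_cong[where f = "measure M"])
  moreover have "measure (distr half_gauss borel Y) {..exp (- b)} = measure half_gauss {r. b \<le> s\<^sup>2 / (4 * r\<^sup>2)}"
    by (subst measure_distr) (auto intro!: arg_cong[where f = "measure half_gauss"] simp: Y_def)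
  \<comment> \<open>The two sets differ on r <= 0, which carries no mass.\<close>
  moreover have "measure half_gauss {r. b \<le> s\<^sup>2 / (4 * r\<^sup>2)} = measure half_gauss {..s / (2 * sqrt b)}"
  proof (rule measure_eq_AE)
    show "AE r in half_gauss. (r \<in> {r. b \<le> s\<^sup>2 / (4 * r\<^sup>2)}) = (r \<in> {..s / (2 * sqrt b)})"
      using AE_half_gauss_pos
    proof eventually_elim
      case (elim r)
      have "b \<le> s\<^sup>2 / (4 * r\<^sup>2) \<longleftrightarrow> (2 * sqrt b * r)\<^sup>2 \<le> s\<^sup>2"
        using elim b by (simp add: field_simps power_mult_distrib)
      also have "\<dots> \<longleftrightarrow> 2 * sqrt b * r \<le> s"
        using elim b s by (simp add: power2_le_iff_abs_le abs_mult)
      also have "\<dots> \<longleftrightarrow> r \<le> s / (2 * sqrt b)"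
        using b by (simp add: field_simps)
      finally show ?case by simp
    qed
  qed measurable
  ultimately show ?thesis by simp
qed

text \<open>\<open>g s\<close> is the level s / (2 sqrt b) of the stable tail at b = (t - s) / (2
  lam)^2, so the half-Gaussian mass below \<open>g s\<close> is the probability of L(t) <= s. The
  first bijection serves the total mass, the second the distribution function.\<close>

lemma bij_betw_hitting_level:
  assumes lam: "lam > 0" and t: "t > 0"
  defines "g \<equiv> \<lambda>s. lam * s / sqrt (t - s)"
  shows "bij_betw g {0<..<t} {0<..}" "\<And>s. s \<in> {0<..<t} \<Longrightarrow> bij_betw g {0<..<s} {0<..<g s}"
proof -
  have mono: "g x < g y" if "0 < x" "x < y" "y < t" for x y
    unfolding g_def using that lam by (intro frac_less) auto
  have inj: "inj_on g {0<..<t}"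
    by (rule linorder_inj_onI') (metis greaterThanLessThan_iff less_irrefl mono)
  have pos: "g x > 0" if "x \<in> {0<..<t}" for x
    using that lam by (simp add: g_def)
  have surj: "\<exists>x\<in>{0<..<t}. g x = y" if y: "y > 0" for y
  proof -
    \<comment> \<open>Squaring lam x = y sqrt (t - x) gives an equation that is continuous up to x =
      t, where \<open>g\<close> itself blows up.\<close>
    have "\<exists>x\<ge>0. x \<le> t \<and> lam\<^sup>2 * x\<^sup>2 - y\<^sup>2 * (t - x) = 0"
      using t lam y by (intro IVT') (auto intro!: continuous_intros)
    then obtain x where x: "0 \<le> x" "x \<le> t" "lam\<^sup>2 * x\<^sup>2 = y\<^sup>2 * (t - x)" by auto
    have "x \<noteq> 0" "x \<noteq> t" using x(3) t lam y by auto
    then have xt: "x \<in> {0<..<t}" using x by auto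
    have "(lam * x)\<^sup>2 = (y * sqrt (t - x))\<^sup>2" using x by (simp add: power_mult_distrib)
    then have "lam * x = y * sqrt (t - x)" using xt lam y by (simp add: power2_eq_iff_nonneg)
    then have "g x = y" using xt by (simp add: g_def)
    then show ?thesis using xt by blast
  qed
  show "bij_betw g {0<..<t} {0<..}"
    unfolding bij_betw_def using inj pos surj by (auto simp: image_iff)
  show "bij_betw g {0<..<s} {0<..<g s}" if s: "s \<in> {0<..<t}" for s
    unfolding bij_betw_def
  proof
    show "inj_on g {0<..<s}" by (rule inj_on_subset[OF inj]) (use s in auto)
    show "g ` {0<..<s} = {0<..<g s}"
    proof
      show "g ` {0<..<s} \<subseteq> {0<..<g s}" using s pos mono by auto
      show "{0<..<g s} \<subseteq> g ` {0<..<s}"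
      proof
        fix y assume y: "y \<in> {0<..<g s}"
        then obtain x where x: "x \<in> {0<..<t}" "g x = y" using surj[of y] by auto
        have "x < s" using mono[of s x] x y s by (cases x s rule: linorder_cases) auto
        then show "y \<in> g ` {0<..<s}" using x by auto
      qed
    qed
  qed
qed

text \<open>The half-Gaussian density at g(s) = lam s / sqrt (t - s) times the derivative of g. The
  support ends at t because calH(s) >= s forces L(t) <= t.\<close>

definition hitting_density :: "real \<Rightarrow> real \<Rightarrow> real \<Rightarrow> real" where
  "hitting_density lam t s = indicator {0<..<t} s * (2 / sqrt pi * exp (- (lam\<^sup>2 * s\<^sup>2 / (t - s)))
     * (lam * ((t - s) powr (-1/2) + s / 2 * (t - s) powr (-3/2))))"

lemma hitting_density_measurable [measurable]: "hitting_density lam t \<in> borel_measurable borel"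
  unfolding hitting_density_def by measurable

lemma hitting_density_nonneg: "lam > 0 \<Longrightarrow> hitting_density lam t s \<ge> 0"
  by (auto simp: hitting_density_def indicator_def)

lemma measure_half_gauss_atMost:
  "has_integral_on half_gauss_density (measure half_gauss {..v}) {0<..<v}"
proof -
  have i: "integrable lborel half_gauss_density"
    using half_gauss_density_integral by (simp add: has_bochner_integral_iff)
  have ii: "integrable lborel (\<lambda>r. indicator {..v} r *\<^sub>R half_gauss_density r)"
    by (rule integrable_mult_indicator[OF _ i]) simp
  have "measure half_gauss {..v} = enn2real (\<integral>\<^sup>+r. ennreal (indicator {..v} r *\<^sub>R half_gauss_density r) \<partial>lborel)"
    unfolding measure_def half_gauss_def
    by (subst emeasure_density) (auto intro!: arg_cong[where f = enn2real] nn_integral_cong simp: indicator_def)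
  also have "\<dots> = (\<integral>r. indicator {..v} r *\<^sub>R half_gauss_density r \<partial>lborel)"
    using half_gauss_density_nonneg by (intro integral_eq_nn_integral[symmetric]) auto
  finally have "has_integral_on half_gauss_density (measure half_gauss {..v}) {..v}"
    using ii by (simp add: has_bochner_integral_iff)
  moreover have "AE r in lborel. indicator {..v} r *\<^sub>R half_gauss_density r = indicator {0<..<v} r *\<^sub>R half_gauss_density r"
    using AE_lborel_singleton[of v] by eventually_elim (auto simp: indicator_def half_gauss_density_def)
  ultimately show ?thesis
    by (subst (asm) has_bochner_integral_cong_AE) auto
qed

lemma hitting_density_substitution:
  assumes lam: "lam > 0" and S: "S \<in> sets borel" "S \<subseteq> {0<..<t}" and T: "T \<in> sets borel" "T \<subseteq> {0<..}"
    and bij: "bij_betw (\<lambda>s. lam * s / sqrt (t - s)) S T"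
    and v: "has_integral_on half_gauss_density v T"
  shows "has_integral_on (hitting_density lam t) v S"
proof -
  define g' where "g' = (\<lambda>s. lam * ((t - s) powr (-1/2) + s / 2 * (t - s) powr (-3/2)))"
  have "has_integral_on (\<lambda>s. \<bar>g' s\<bar> * half_gauss_density (lam * s / sqrt (t - s))) v S"
  proof (subst has_integral_on_substitution[OF bij _ S(1) T(1)])
    fix s assume "s \<in> S"
    then have s: "0 < s" "s < t" using S by auto
    have p: "(t - s) powr (-1/2) = 1 / sqrt (t - s)" "(t - s) powr (-3/2) = 1 / (sqrt (t - s) * (t - s))"
      using s powr_add[of "t - s" "1/2" 1] by (simp_all add: powr_minus_divide powr_half_sqrt)
    define d where "d = sqrt (t - s)"
    have d: "d > 0" "t - s = d\<^sup>2" using s by (simp_all add: d_def)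
    have "((\<lambda>s. lam * s / sqrt (t - s)) has_real_derivative
        (lam * sqrt (t - s) - lam * s * (- (inverse (sqrt (t - s)) / 2))) / (sqrt (t - s) * sqrt (t - s))) (at s)"
      using s by (auto intro!: derivative_eq_intros)
    also have "(lam * sqrt (t - s) - lam * s * (- (inverse (sqrt (t - s)) / 2))) / (sqrt (t - s) * sqrt (t - s)) = g' s"
      unfolding g'_def p d_def[symmetric] unfolding d(2) using d(1) by (simp add: field_simps power2_eq_square)
    finally show "((\<lambda>s. lam * s / sqrt (t - s)) has_real_derivative g' s) (at s)" .
  qed (use v in \<open>auto simp: g'_def\<close>)
  then show ?thesis
  proof (rule has_integral_on_eq)
    fix s assume sS: "s \<in> S"
    then have s: "0 < s" "s < t" using S by auto
    then have "g' s \<ge> 0" "lam * s / sqrt (t - s) > 0" using lam by (auto simp: g'_def)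
    then show "hitting_density lam t s = \<bar>g' s\<bar> * half_gauss_density (lam * s / sqrt (t - s))"
      using s lam by (simp add: hitting_density_def half_gauss_density_def g'_def power_divide power_mult_distrib mult_ac)
  qed simp
qed

lemma hitting_density_integral:
  assumes lam: "lam > 0" and t: "t > 0"
  shows "has_bochner_integral lborel (hitting_density lam t) 1"
    "\<And>s. s \<in> {0<..<t} \<Longrightarrow>
      has_integral_on (hitting_density lam t) (measure half_gauss {..lam * s / sqrt (t - s)}) {0<..<s}"
proof -
  have "has_integral_on half_gauss_density 1 {0<..}"
  proof -
    have "(\<lambda>x. indicator {0<..} x *\<^sub>R half_gauss_density x) = half_gauss_density"
      by (auto simp: fun_eq_iff half_gauss_density_def indicator_def)
    then show ?thesis using half_gauss_density_integral by simp
  qed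
  then have "has_integral_on (hitting_density lam t) 1 {0<..<t}"
    by (intro hitting_density_substitution[OF lam _ _ _ _ bij_betw_hitting_level(1)[OF lam t]]) auto
  moreover have "(\<lambda>x. indicator {0<..<t} x *\<^sub>R hitting_density lam t x) = hitting_density lam t"
    by (auto simp: fun_eq_iff hitting_density_def indicator_def)
  ultimately show "has_bochner_integral lborel (hitting_density lam t) 1" by simp
  show "has_integral_on (hitting_density lam t) (measure half_gauss {..lam * s / sqrt (t - s)}) {0<..<s}" if "s \<in> {0<..<t}" for s
    using that lam
    by (intro hitting_density_substitution[OF lam _ _ _ _ bij_betw_hitting_level(2)[OF lam t that]] measure_half_gauss_atMost) auto
qed

lemma calL_law:
  assumes M: "prob_space M" and H: "stable_half_subordinator M H" and lam: "lam > 0" and t: "t > 0"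
    and Lm[measurable]: "calL lam H t \<in> borel_measurable M"
  shows "distr M borel (calL lam H t) = density lborel (hitting_density lam t)"
    "\<And>\<omega>. \<omega> \<in> space M \<Longrightarrow> calL lam H t \<omega> > 0"
    "\<And>\<omega>. \<omega> \<in> space M \<Longrightarrow> calL lam H t \<omega> \<le> t"
proof -
  interpret M: prob_space M by fact
  have H0: "H 0 \<omega> = 0" and Hmono: "mono_on {0..} (\<lambda>t. H t \<omega>)"
    and Hright: "\<And>s. s \<ge> 0 \<Longrightarrow> continuous (at_right s) (\<lambda>s. H s \<omega>)" if "\<omega> \<in> space M" for \<omega>
    using H that by (auto simp: stable_half_subordinator_def stationary_indep_increments_def)
  have Hm: "H s \<in> borel_measurable M" if "s \<ge> 0" for s
    using H that by (auto simp: stable_half_subordinator_def stationary_indep_increments_def)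
  \<comment> \<open>If calH(s) < t, right continuity extends the strict inequality to an interval
    beyond s and monotonicity extends it to all earlier times, so the infimum exceeds s. The side
    condition admits s = 0: the set under the infimum omits 0, but calH(0) = 0 < t.\<close>
  have key: "calL lam H t \<omega> \<le> s \<longleftrightarrow> calH lam H s \<omega> \<ge> t" if \<omega>: "\<omega> \<in> space M" and s: "s \<ge> 0" and s0: "s > 0 \<or> calH lam H s \<omega> < t" for s \<omega>
  proof
    have bdd: "bdd_below {s. s > 0 \<and> calH lam H s \<omega> \<ge> t}" by (rule bdd_belowI[of _ 0]) auto
    show "calL lam H t \<omega> \<le> s" if "calH lam H s \<omega> \<ge> t"
      unfolding calL_def using that s0 by (intro cInf_lower bdd) auto
    show "calH lam H s \<omega> \<ge> t" if le: "calL lam H t \<omega> \<le> s"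
    proof (rule ccontr)
      assume "\<not> t \<le> calH lam H s \<omega>"
      then have lt: "calH lam H s \<omega> < t" by simp
      have "((\<lambda>u. calH lam H u \<omega>) \<longlongrightarrow> calH lam H s \<omega>) (at_right s)"
        unfolding calH_def using Hright[OF \<omega> s] by (auto simp: continuous_within intro!: tendsto_intros)
      from order_tendstoD(2)[OF this lt]
      have "\<forall>\<^sub>F u in at_right s. calH lam H u \<omega> < t" .
      then obtain d where d: "d > s" "\<And>u. s < u \<Longrightarrow> u < d \<Longrightarrow> calH lam H u \<omega> < t"
        unfolding eventually_at_right_field by blast
      have "d \<le> Inf {s. s > 0 \<and> calH lam H s \<omega> \<ge> t}"
      proof (rule cInf_greatest)
        have "H t \<omega> \<ge> 0" using mono_onD[OF Hmono[OF \<omega>], of 0 t] H0[OF \<omega>] t by simp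
        then show "{s. s > 0 \<and> calH lam H s \<omega> \<ge> t} \<noteq> {}" using t by (auto simp: calH_def intro!: exI[of _ t])
        fix u assume u: "u \<in> {s. s > 0 \<and> calH lam H s \<omega> \<ge> t}"
        show "d \<le> u"
        proof (rule ccontr)
          assume "\<not> d \<le> u"
          then have "u \<le> s" using d(2)[of u] u by force
          moreover have "calH lam H u \<omega> \<le> calH lam H s \<omega>"
            unfolding calH_def using mono_onD[OF Hmono[OF \<omega>], of u s] u \<open>u \<le> s\<close>
            by (intro add_mono mult_left_mono) auto
          ultimately show False using u lt by auto
        qed
      qed
      then show False using le d(1) by (simp add: calL_def)
    qed
  qed
  show Lpos: "calL lam H t \<omega> > 0" if "\<omega> \<in> space M" for \<omega>
    using key[OF that, of 0] t H0[OF that] by (simp add: calH_def)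
  show Lle: "calL lam H t \<omega> \<le> t" if "\<omega> \<in> space M" for \<omega>
  proof -
    have "H t \<omega> \<ge> 0" using mono_onD[OF Hmono[OF that], of 0 t] H0[OF that] t by simp
    then have "calH lam H t \<omega> \<ge> t" by (simp add: calH_def)
    then show ?thesis using key[OF that, of t] t by simp
  qed
  have Pr: "measure (distr M borel (calL lam H t)) {..s} = measure M {\<omega> \<in> space M. calL lam H t \<omega> \<le> s}" for s
    by (subst measure_distr) (auto intro!: arg_cong[where f = "measure M"])
  have i: "integrable lborel (hitting_density lam t)"
    using hitting_density_integral(1)[OF lam t] by (simp add: has_bochner_integral_iff)
  have dens: "measure (density lborel (hitting_density lam t)) {..s} = (\<integral>r. indicator {..s} r *\<^sub>R hitting_density lam t r \<partial>lborel)" for s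
  proof -
    have "measure (density lborel (hitting_density lam t)) {..s} = enn2real (\<integral>\<^sup>+r. ennreal (indicator {..s} r *\<^sub>R hitting_density lam t r) \<partial>lborel)"
      unfolding measure_def
      by (subst emeasure_density) (auto intro!: arg_cong[where f = enn2real] nn_integral_cong simp: indicator_def)
    then show ?thesis
      using hitting_density_nonneg[OF lam] by (subst integral_eq_nn_integral) auto
  qed
  have pd: "prob_space (density lborel (hitting_density lam t))"
  proof
    have "emeasure (density lborel (hitting_density lam t)) UNIV = (\<integral>\<^sup>+r. ennreal (hitting_density lam t r) \<partial>lborel)"
      by (simp add: emeasure_density)
    also have "\<dots> = ennreal 1"
      using hitting_density_integral(1)[OF lam t] hitting_density_nonneg[OF lam]
      by (subst nn_integral_eq_integral) (auto simp: has_bochner_integral_iff)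
    finally show "emeasure (density lborel (hitting_density lam t)) (space (density lborel (hitting_density lam t))) = 1" by simp
  qed
  show "distr M borel (calL lam H t) = density lborel (hitting_density lam t)"
  proof (rule cdf_unique)
    show "real_distribution (distr M borel (calL lam H t))" by (rule M.real_distribution_distr) simp
    show "real_distribution (density lborel (hitting_density lam t))"
      using pd by (intro real_distribution.intro real_distribution_axioms.intro) simp_all
    show "cdf (distr M borel (calL lam H t)) = cdf (density lborel (hitting_density lam t))"
    proof
      fix s
      \<comment> \<open>Outside (0, t) the distribution function is 0 or 1 by the two pathwise
        bounds on L.\<close>
      consider "s \<le> 0" | "0 < s" "s < t" | "s \<ge> t" by linarith
      then have "measure M {\<omega> \<in> space M. calL lam H t \<omega> \<le> s} = (\<integral>r. indicator {..s} r *\<^sub>R hitting_density lam t r \<partial>lborel)"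
      proof cases
        case 1
        have "{\<omega> \<in> space M. calL lam H t \<omega> \<le> s} = {}" using Lpos 1 by force
        moreover have "(\<lambda>r. indicator {..s} r *\<^sub>R hitting_density lam t r) = (\<lambda>_. 0)"
          using 1 by (auto simp: fun_eq_iff hitting_density_def indicator_def)
        ultimately show ?thesis by (simp only: measure_empty Bochner_Integration.integral_zero)
      next
        case 2
        have "{\<omega> \<in> space M. calL lam H t \<omega> \<le> s} = {\<omega> \<in> space M. H s \<omega> \<ge> (t - s) / (2 * lam)\<^sup>2}"
          using key[of _ s] 2 lam by (auto simp: calH_def field_simps)
        then have "measure M {\<omega> \<in> space M. calL lam H t \<omega> \<le> s} = measure half_gauss {..s / (2 * sqrt ((t - s) / (2 * lam)\<^sup>2))}"
          using stable_half_law[OF M H, of s "(t - s) / (2 * lam)\<^sup>2"] 2 lam by simp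
        also have "s / (2 * sqrt ((t - s) / (2 * lam)\<^sup>2)) = lam * s / sqrt (t - s)"
        proof -
          have "sqrt ((t - s) / (2 * lam)\<^sup>2) = sqrt (t - s) / (2 * lam)"
            using lam by (simp only: real_sqrt_divide real_sqrt_abs)
          then show ?thesis by simp
        qed
        also have "measure half_gauss {..lam * s / sqrt (t - s)} = (\<integral>r. indicator {0<..<s} r *\<^sub>R hitting_density lam t r \<partial>lborel)"
          using hitting_density_integral(2)[OF lam t, of s] 2 by (simp add: has_bochner_integral_iff)
        also have "\<dots> = (\<integral>r. indicator {..s} r *\<^sub>R hitting_density lam t r \<partial>lborel)"
        proof (rule integral_cong_AE)
          show "AE r in lborel. indicator {0<..<s} r *\<^sub>R hitting_density lam t r = indicator {..s} r *\<^sub>R hitting_density lam t r"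
            using AE_lborel_singleton[of s] by eventually_elim (auto simp: hitting_density_def indicator_def)
        qed measurable
        finally show ?thesis .
      next
        case 3
        have "calL lam H t \<omega> \<le> s" if "\<omega> \<in> space M" for \<omega>
          using Lle[OF that] 3 by simp
        then have "{\<omega> \<in> space M. calL lam H t \<omega> \<le> s} = space M" by auto
        moreover have "(\<lambda>r. indicator {..s} r *\<^sub>R hitting_density lam t r) = hitting_density lam t"
          using 3 by (auto simp: fun_eq_iff hitting_density_def indicator_def)
        ultimately show ?thesis
          using hitting_density_integral(1)[OF lam t] M.prob_space by (simp add: has_bochner_integral_iff)
      qed
      then show "cdf (distr M borel (calL lam H t)) s = cdf (density lborel (hitting_density lam t)) s"
        unfolding cdf_def Pr dens .
    qed
  qed
qed

section \<open>Brownian motion at an independent time\<close>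

lemma process_measurable_vimage_algebra:
  assumes "t \<in> I"
  shows "X t \<in> borel_measurable (vimage_algebra (space M) (\<lambda>\<omega>. \<lambda>t\<in>I. X t \<omega>) (Pi\<^sub>M I (\<lambda>_. borel)))"
proof -
  let ?V = "vimage_algebra (space M) (\<lambda>\<omega>. \<lambda>t\<in>I. X t \<omega>) (Pi\<^sub>M I (\<lambda>_. borel))"
  have "(\<lambda>\<omega>. \<lambda>t\<in>I. X t \<omega>) \<in> measurable ?V (Pi\<^sub>M I (\<lambda>_. borel))"
    by (rule measurable_vimage_algebra1) (auto simp: space_PiM)
  from measurable_compose[OF this measurable_component_singleton[OF assms]]
  show ?thesis using assms by simp
qed

text \<open>The sigma-algebra of f (X t) lies in that of the whole process X, and likewise for Y.
  Composition with \<open>f\<close> and \<open>g\<close> makes both variables complex-valued, so the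
  product rule for independent variables applies.\<close>

lemma indep_processes_expectation:
  fixes X :: "real \<Rightarrow> 'a \<Rightarrow> 'b::topological_space" and Y :: "real \<Rightarrow> 'a \<Rightarrow> 'c::topological_space"
    and f :: "'b \<Rightarrow> complex" and g :: "'c \<Rightarrow> complex"
  assumes M: "prob_space M" and indep: "indep_processes M I X J Y" and t: "t \<in> I" and s: "s \<in> J"
    and f[measurable]: "f \<in> borel_measurable borel" and g[measurable]: "g \<in> borel_measurable borel"
    and fb: "\<And>x. norm (f x) \<le> 1" and gb: "\<And>y. norm (g y) \<le> 1"
  shows "(CLINT \<omega>|M. f (X t \<omega>) * g (Y s \<omega>)) = (CLINT \<omega>|M. f (X t \<omega>)) * (CLINT \<omega>|M. g (Y s \<omega>))"
proof -
  interpret prob_space M by fact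
  let ?V = "vimage_algebra (space M) (\<lambda>\<omega>. \<lambda>t\<in>I. X t \<omega>) (Pi\<^sub>M I (\<lambda>_. borel))"
  let ?W = "vimage_algebra (space M) (\<lambda>\<omega>. \<lambda>t\<in>J. Y t \<omega>) (Pi\<^sub>M J (\<lambda>_. borel))"
  have [measurable]: "X t \<in> borel_measurable M" "Y s \<in> borel_measurable M"
    using indep t s by (auto simp: indep_processes_def)
  have ind: "indep_set (sets ?V) (sets ?W)"
    using indep by (simp add: indep_processes_def process_sigma_def)
  have fV: "(\<lambda>\<omega>. f (X t \<omega>)) \<in> borel_measurable ?V"
    by (rule measurable_compose[OF process_measurable_vimage_algebra[OF t] f])
  have gW: "(\<lambda>\<omega>. g (Y s \<omega>)) \<in> borel_measurable ?W"
    by (rule measurable_compose[OF process_measurable_vimage_algebra[OF s] g])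
  have sub: "sigma_sets (space M) {h -` A \<inter> space M |A. A \<in> sets (borel :: complex measure)} \<subseteq> sets K"
    if "h \<in> borel_measurable K" "space K = space M" for h K
    using sets.sigma_sets_subset[of "{h -` A \<inter> space M |A. A \<in> sets (borel :: complex measure)}" K]
      measurable_sets[OF that(1)] that(2) by auto
  have "indep_var borel (\<lambda>\<omega>. f (X t \<omega>)) borel (\<lambda>\<omega>. g (Y s \<omega>))"
    unfolding indep_var_eq
  proof (intro conjI)
    show "indep_set (sigma_sets (space M) {(\<lambda>\<omega>. f (X t \<omega>)) -` A \<inter> space M |A. A \<in> sets borel})
      (sigma_sets (space M) {(\<lambda>\<omega>. g (Y s \<omega>)) -` A \<inter> space M |A. A \<in> sets borel})"
      using ind unfolding indep_set_def
      by (rule indep_sets_mono_sets) (use sub[OF fV] sub[OF gW] in \<open>auto split: bool.split\<close>)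
  qed simp_all
  then show ?thesis
    by (rule indep_var_lebesgue_integral) (auto intro!: integrable_const_bound[where B = 1] fb gb)
qed

definition dyadic_index :: "nat \<Rightarrow> real \<Rightarrow> nat" where
  "dyadic_index n x = nat \<lceil>x * 2 ^ n\<rceil>"

lemma dyadic_index_measurable [measurable]: "dyadic_index n \<in> measurable borel (count_space UNIV)"
  unfolding dyadic_index_def by measurable

lemma dyadic_index_bounds:
  assumes "x \<ge> 0"
  shows "x \<le> dyadic_index n x / 2 ^ n" "dyadic_index n x / 2 ^ n \<le> x + (1/2) ^ n"
proof -
  have "real (dyadic_index n x) = of_int \<lceil>x * 2 ^ n\<rceil>"
    using assms by (simp add: dyadic_index_def)
  moreover have "x * 2 ^ n \<le> of_int \<lceil>x * 2 ^ n\<rceil>" "of_int \<lceil>x * 2 ^ n\<rceil> \<le> x * 2 ^ n + 1" by linarith+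
  ultimately show "x \<le> dyadic_index n x / 2 ^ n" "dyadic_index n x / 2 ^ n \<le> x + (1/2) ^ n"
    by (simp_all add: field_simps power_divide)
qed

lemma dyadic_index_tendsto:
  assumes "x \<ge> 0"
  shows "(\<lambda>n. dyadic_index n x / 2 ^ n) \<longlonglongrightarrow> x"
proof (rule tendsto_sandwich[OF _ _ tendsto_const])
  have "(\<lambda>n. x + (1/2) ^ n) \<longlonglongrightarrow> x + 0" by (intro tendsto_intros LIMSEQ_power_zero) simp
  then show "(\<lambda>n. x + (1/2) ^ n) \<longlonglongrightarrow> x" by simp
qed (use dyadic_index_bounds[OF assms] in auto)

text \<open>The characteristic function of B is given at deterministic times only. The random time
  is therefore rounded up to dyadic values: on each cell it is a constant and the expectation
  factorizes. Continuity of the paths then carries both measurability and the formula to the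
  limit.\<close>

lemma time_changed_char:
  fixes B :: "real \<Rightarrow> 'a \<Rightarrow> real \<times> real" and Y :: "real \<Rightarrow> 'a \<Rightarrow> real"
  assumes M: "prob_space M" and B: "planar_brownian_motion M B"
    and indep: "indep_processes M {0..} B J Y" and t: "t \<in> J" and a: "a \<ge> 0"
    and Y0: "\<And>\<omega>. \<omega> \<in> space M \<Longrightarrow> Y t \<omega> \<ge> 0" and Yb: "\<And>\<omega>. \<omega> \<in> space M \<Longrightarrow> Y t \<omega> \<le> b"
  shows "(\<lambda>\<omega>. B (a * Y t \<omega>) \<omega>) \<in> borel_measurable M"
    "(CLINT \<omega>|M. iexp (\<xi> \<bullet> B (a * Y t \<omega>) \<omega>)) = of_real (LINT \<omega>|M. exp (- (a * Y t \<omega>) * (norm \<xi>)\<^sup>2))"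
proof -
  interpret prob_space M by fact
  have Bm[measurable]: "B s \<in> borel_measurable M" if "s \<ge> 0" for s
    using B that by (auto simp: planar_brownian_motion_def stationary_indep_increments_def)
  have Bc: "continuous_on {0..} (\<lambda>s. B s \<omega>)" if "\<omega> \<in> space M" for \<omega>
    using B that by (auto simp: planar_brownian_motion_def)
  have Bchar: "(CLINT \<omega>|M. iexp (\<xi> \<bullet> B s \<omega>)) = of_real (exp (- s * (norm \<xi>)\<^sup>2))" if "s \<ge> 0" for s
    using B that unfolding planar_brownian_motion_def by blast
  have Ym[measurable]: "Y t \<in> borel_measurable M" using indep t by (auto simp: indep_processes_def)
  define K where "K = (\<lambda>n \<omega>. dyadic_index n (a * Y t \<omega>))"
  have Km[measurable]: "K n \<in> measurable M (count_space UNIV)" for n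
    unfolding K_def by measurable
  have BK[measurable]: "(\<lambda>\<omega>. B (real (K n \<omega>) / 2 ^ n) \<omega>) \<in> borel_measurable M" for n
    by (rule measurable_compose_countable[OF _ Km]) simp
  have Klim: "(\<lambda>n. real (K n \<omega>) / 2 ^ n) \<longlonglongrightarrow> a * Y t \<omega>" if "\<omega> \<in> space M" for \<omega>
    unfolding K_def using Y0[OF that] a by (intro dyadic_index_tendsto) simp
  have BKlim: "(\<lambda>n. B (real (K n \<omega>) / 2 ^ n) \<omega>) \<longlonglongrightarrow> B (a * Y t \<omega>) \<omega>" if "\<omega> \<in> space M" for \<omega>
    by (rule continuous_on_tendsto_compose[OF Bc[OF that] Klim[OF that]]) (use Y0[OF that] a in auto)
  show Wm[measurable]: "(\<lambda>\<omega>. B (a * Y t \<omega>) \<omega>) \<in> borel_measurable M"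
    by (rule borel_measurable_LIMSEQ_metric[OF BK BKlim])
  have disc: "(CLINT \<omega>|M. iexp (\<xi> \<bullet> B (real (K n \<omega>) / 2 ^ n) \<omega>))
     = of_real (LINT \<omega>|M. exp (- (real (K n \<omega>) / 2 ^ n) * (norm \<xi>)\<^sup>2))" for n
  proof -
    \<comment> \<open>The bound on \<open>Y\<close> caps the dyadic index, so the decomposition into
      cells is a finite sum.\<close>
    define N where "N = nat \<lceil>(a * b + 1) * 2 ^ n\<rceil>"
    have KN: "K n \<omega> \<le> N" if "\<omega> \<in> space M" for \<omega>
    proof -
      have "real (K n \<omega>) / 2 ^ n \<le> a * Y t \<omega> + (1/2) ^ n"
        unfolding K_def using Y0[OF that] a by (intro dyadic_index_bounds) simp
      also have "\<dots> \<le> a * b + 1"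
        using Yb[OF that] a by (intro add_mono mult_left_mono power_le_one) auto
      finally have "real (K n \<omega>) \<le> (a * b + 1) * 2 ^ n" by (simp add: field_simps)
      then show ?thesis unfolding N_def by linarith
    qed
    \<comment> \<open>The cell is expressed through Y t alone and in complex form, so that it can be
      the second factor in the product rule.\<close>
    define e where "e = (\<lambda>k. indicator {l. dyadic_index n (a * l) = k} :: real \<Rightarrow> complex)"
    have em[measurable]: "e k \<in> borel_measurable borel" for k
    proof -
      have "{l. dyadic_index n (a * l) = k} \<in> sets borel" by measurable
      then show ?thesis unfolding e_def by measurable
    qed
    have ee: "e k (Y t \<omega>) = of_bool (K n \<omega> = k)" for k \<omega>
      by (simp add: e_def K_def indicator_def)
    have ei: "integrable M (\<lambda>\<omega>. e k (Y t \<omega>))" for k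
      by (rule integrable_const_bound[where B = 1]) (auto simp: ee)
    have bei: "integrable M (\<lambda>\<omega>. iexp (\<xi> \<bullet> B (real k / 2 ^ n) \<omega>) * e k (Y t \<omega>))" for k
      by (rule integrable_const_bound[where B = 1]) (auto simp: ee norm_mult)
    have sum_bool: "(\<Sum>k\<le>N. h k * of_bool (K n \<omega> = k)) = h (K n \<omega>)" if "\<omega> \<in> space M" for h :: "nat \<Rightarrow> complex" and \<omega>
      using KN[OF that] by (simp add: of_bool_def if_distrib cong: if_cong)
    have "(CLINT \<omega>|M. iexp (\<xi> \<bullet> B (real (K n \<omega>) / 2 ^ n) \<omega>))
      = (CLINT \<omega>|M. (\<Sum>k\<le>N. iexp (\<xi> \<bullet> B (real k / 2 ^ n) \<omega>) * e k (Y t \<omega>)))"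
      by (intro Bochner_Integration.integral_cong) (simp_all only: ee sum_bool)
    also have "\<dots> = (\<Sum>k\<le>N. (CLINT \<omega>|M. iexp (\<xi> \<bullet> B (real k / 2 ^ n) \<omega>) * e k (Y t \<omega>)))"
      by (rule Bochner_Integration.integral_sum) (rule bei)
    also have "\<dots> = (\<Sum>k\<le>N. (CLINT \<omega>|M. iexp (\<xi> \<bullet> B (real k / 2 ^ n) \<omega>)) * (CLINT \<omega>|M. e k (Y t \<omega>)))"
      by (intro sum.cong refl indep_processes_expectation[OF M indep _ t]) (auto simp: e_def indicator_def)
    also have "\<dots> = (\<Sum>k\<le>N. of_real (exp (- (real k / 2 ^ n) * (norm \<xi>)\<^sup>2)) * (CLINT \<omega>|M. e k (Y t \<omega>)))"
      by (simp add: Bchar)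
    also have "\<dots> = (CLINT \<omega>|M. (\<Sum>k\<le>N. of_real (exp (- (real k / 2 ^ n) * (norm \<xi>)\<^sup>2)) * e k (Y t \<omega>)))"
      using ei by (subst Bochner_Integration.integral_sum) auto
    also have "\<dots> = (CLINT \<omega>|M. of_real (exp (- (real (K n \<omega>) / 2 ^ n) * (norm \<xi>)\<^sup>2)))"
      by (intro Bochner_Integration.integral_cong) (simp_all only: ee sum_bool)
    finally show ?thesis by (simp only: integral_complex_of_real)
  qed
  have lim1: "(\<lambda>n. CLINT \<omega>|M. iexp (\<xi> \<bullet> B (real (K n \<omega>) / 2 ^ n) \<omega>)) \<longlonglongrightarrow> (CLINT \<omega>|M. iexp (\<xi> \<bullet> B (a * Y t \<omega>) \<omega>))"
    by (rule integral_dominated_convergence[where w = "\<lambda>_. 1"])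
      (auto intro!: AE_I2 tendsto_intros BKlim)
  have lim2: "(\<lambda>n. LINT \<omega>|M. exp (- (real (K n \<omega>) / 2 ^ n) * (norm \<xi>)\<^sup>2)) \<longlonglongrightarrow> (LINT \<omega>|M. exp (- (a * Y t \<omega>) * (norm \<xi>)\<^sup>2))"
    by (rule integral_dominated_convergence[where w = "\<lambda>_. 1"])
      (auto intro!: AE_I2 tendsto_exp tendsto_mult tendsto_minus tendsto_const Klim simp del: times_divide_eq_left times_divide_eq_right mult_minus_left)
  show "(CLINT \<omega>|M. iexp (\<xi> \<bullet> B (a * Y t \<omega>) \<omega>)) = of_real (LINT \<omega>|M. exp (- (a * Y t \<omega>) * (norm \<xi>)\<^sup>2))"
    using LIMSEQ_unique[OF lim1[unfolded disc] tendsto_of_real[OF lim2]] .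
qed

section \<open>The density q as a mixture of heat kernels\<close>

text \<open>With w = s / (t - s), a = lam^2 t and b = z / (4 t) the exponents add up to a w + b + b
  / w, and the two summands of \<open>hitting_density\<close> become the weights w^(-3/2) and
  w^(-1/2). Their integrals are the two kernels of \<open>q_rad\<close>, because 2 sqrt (a b) = lam
  sqrt z.\<close>

lemma hitting_kern_integral:
  assumes lam: "lam > 0" and t: "t > 0" and z: "z > 0"
  shows "has_integral_on (\<lambda>s. hitting_density lam t s * (exp (- (lam\<^sup>2 * s)) * s powr (-3/2) * exp (- (z / (4 * s)))))
    (4 * lam * (kern lam (-1/2) (-1/2) z t + kern lam 0 (-3/2) z t / (4 * lam))) {0<..<t}"
proof -
  define a b where "a = lam\<^sup>2 * t" and "b = z / (4 * t)"
  have a: "a > 0" and b: "b > 0" using assms by (simp_all add: a_def b_def)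
  define C where "C = 2 * lam / sqrt pi * exp (- b) / t"
  define f where "f = (\<lambda>w. C * (w powr (-3/2) * exp (- (a * w + b / w)) + 1/2 * (w powr (-1/2) * exp (- (a * w + b / w)))))"
  have f: "has_integral_on f (C * (sqrt (pi / b) * exp (- 2 * sqrt (a * b)) + 1/2 * (sqrt (pi / a) * exp (- 2 * sqrt (a * b))))) {0<..}"
    unfolding f_def using a b
    by (intro has_integral_on_cmult has_integral_on_add has_integral_on_powr_exp_half has_integral_on_powr_exp_three_half) auto
  have bij: "bij_betw (\<lambda>s. s / (t - s)) {0<..<t} {0<..}"
  proof (rule bij_betwI[where g = "\<lambda>w. t * w / (1 + w)"])
    show "(\<lambda>w. t * w / (1 + w)) \<in> {0<..} \<rightarrow> {0<..<t}" using t by (auto simp: field_simps)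
    fix s assume "s \<in> {0<..<t}"
    then have "t - s > 0" by simp
    then show "t * (s / (t - s)) / (1 + s / (t - s)) = s" using t by (simp add: field_simps)
  next
    fix w :: real assume "w \<in> {0<..}"
    then have "1 + w > 0" by simp
    then have "t - t * w / (1 + w) = t / (1 + w)" by (simp add: field_simps)
    then show "t * w / (1 + w) / (t - t * w / (1 + w)) = w" using t \<open>1 + w > 0\<close> by simp
  qed (use t in auto)
  have "has_integral_on (\<lambda>s. \<bar>t / (t - s)\<^sup>2\<bar> * f (s / (t - s)))
     (C * (sqrt (pi / b) * exp (- 2 * sqrt (a * b)) + 1/2 * (sqrt (pi / a) * exp (- 2 * sqrt (a * b))))) {0<..<t}"
    using f by (subst has_integral_on_substitution[OF bij])
      (auto intro!: derivative_eq_intros simp: f_def power2_eq_square field_simps)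
  then show ?thesis
  proof (rule has_integral_on_eq)
    fix s assume "s \<in> {0<..<t}"
    then have s: "0 < s" "s < t" by auto
    define r where "r = t - s"
    have r: "r > 0" "t = r + s" using s by (simp_all add: r_def)
    define p q where "p = sqrt s" and "q = sqrt r"
    have pq: "p > 0" "q > 0" "s = p\<^sup>2" "r = q\<^sup>2" using s r by (simp_all add: p_def q_def)
    have P: "s powr (-3/2) = 1 / (p * s)" "r powr (-1/2) = 1 / q" "r powr (-3/2) = 1 / (q * r)"
      "(s / r) powr (-3/2) = (q * r) / (p * s)" "(s / r) powr (-1/2) = q / p"
      using s r powr_add[of s "1/2" 1] powr_add[of r "1/2" 1] powr_add[of "s / r" "1/2" 1]
      by (simp_all add: powr_minus_divide powr_half_sqrt p_def q_def real_sqrt_divide)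
    have e: "exp (- (lam\<^sup>2 * s\<^sup>2 / r)) * (exp (- (lam\<^sup>2 * s)) * exp (- (z / (4 * s)))) = exp (- b) * exp (- (a * (s / r) + b / (s / r)))"
    proof -
      have "z / (4 * s) = b + b / (s / r)"
        using s r(1) t unfolding b_def by (simp add: r_def field_simps)
      moreover have "lam\<^sup>2 * s\<^sup>2 / r + lam\<^sup>2 * s = a * (s / r)"
        using s r unfolding a_def by (simp add: power2_eq_square field_simps)
      ultimately show ?thesis unfolding exp_add[symmetric] by (simp add: algebra_simps)
    qed
    define E where "E = exp (- b) * exp (- (a * (s / r) + b / (s / r)))"
    have "hitting_density lam t s * (exp (- (lam\<^sup>2 * s)) * s powr (-3/2) * exp (- (z / (4 * s))))
      = 2 / sqrt pi * lam * (s powr (-3/2) * (r powr (-1/2) + s / 2 * r powr (-3/2)))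
        * (exp (- (lam\<^sup>2 * s\<^sup>2 / r)) * (exp (- (lam\<^sup>2 * s)) * exp (- (z / (4 * s)))))"
      using s by (simp add: hitting_density_def r_def mult_ac)
    also have "\<dots> = 2 / sqrt pi * lam * E * (s powr (-3/2) * (r powr (-1/2) + s / 2 * r powr (-3/2)))"
      unfolding e E_def by (simp add: mult_ac)
    also have "s powr (-3/2) * (r powr (-1/2) + s / 2 * r powr (-3/2)) = t / r\<^sup>2 * (1 / t * ((s / r) powr (-3/2) + 1/2 * (s / r) powr (-1/2)))"
      unfolding P using t pq by (simp add: pq(3,4) field_simps power2_eq_square)
    also have "2 / sqrt pi * lam * E * (t / r\<^sup>2 * (1 / t * ((s / r) powr (-3/2) + 1/2 * (s / r) powr (-1/2)))) = \<bar>t / r\<^sup>2\<bar> * f (s / r)"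
      using t by (simp add: f_def C_def E_def algebra_simps)
    finally show "hitting_density lam t s * (exp (- (lam\<^sup>2 * s)) * s powr (-3/2) * exp (- (z / (4 * s)))) = \<bar>t / (t - s)\<^sup>2\<bar> * f (s / (t - s))"
      unfolding r_def .
  next
    define p q where "p = sqrt t" and "q = sqrt z"
    have pq: "p > 0" "q > 0" "t = p\<^sup>2" "z = q\<^sup>2" using t z by (simp_all add: p_def q_def)
    have S: "sqrt (a * b) = lam * q / 2" "sqrt (pi / b) = sqrt pi * (2 * p / q)" "sqrt (pi / a) = sqrt pi / (lam * p)"
      using lam pq(1,2) unfolding a_def b_def pq(3,4) by (simp_all add: real_sqrt_divide real_sqrt_mult power_mult_distrib)
    have P: "z powr (-1/2) = 1 / q" "t powr (-1/2) = 1 / p" "t powr (-3/2) = 1 / (p * t)"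
      using t z powr_add[of t "1/2" 1] by (simp_all add: powr_minus_divide powr_half_sqrt p_def q_def)
    have e: "exp (- (lam * sqrt z) - z / (4 * t)) = exp (- b) * exp (- (lam * q))"
      by (simp add: exp_add[symmetric] b_def q_def)
    have z0: "z powr 0 = 1" using z by simp
    show "C * (sqrt (pi / b) * exp (- 2 * sqrt (a * b)) + 1/2 * (sqrt (pi / a) * exp (- 2 * sqrt (a * b)))) =
      4 * lam * (kern lam (-1/2) (-1/2) z t + kern lam 0 (-3/2) z t / (4 * lam))"
      unfolding kern_def P e S C_def z0 using lam pq by (simp add: pq(3) field_simps power2_eq_square)
  qed
qed

text \<open>Completing the square turns the integrand into a multiple of the normal density with
  mean 2 lam s and variance 2 s.\<close>

lemma exponential_gaussian_integral:
  fixes lam s :: real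
  assumes s: "s > 0"
  shows "has_bochner_integral lborel (\<lambda>\<tau>. exp (lam * \<tau>) * exp (- (\<tau>\<^sup>2 / (4 * s)))) (sqrt (4 * pi * s) * exp (lam\<^sup>2 * s))"
proof -
  have "has_bochner_integral lborel (normal_density (2 * lam * s) (sqrt (2 * s))) 1"
    using s by (simp add: has_bochner_integral_iff)
  from has_bochner_integral_mult_right[OF this, of "sqrt (4 * pi * s) * exp (lam\<^sup>2 * s)"]
  have "has_bochner_integral lborel (\<lambda>\<tau>. sqrt (4 * pi * s) * exp (lam\<^sup>2 * s) * normal_density (2 * lam * s) (sqrt (2 * s)) \<tau>)
    (sqrt (4 * pi * s) * exp (lam\<^sup>2 * s))" by simp
  moreover have "sqrt (4 * pi * s) * exp (lam\<^sup>2 * s) * normal_density (2 * lam * s) (sqrt (2 * s)) \<tau> = exp (lam * \<tau>) * exp (- (\<tau>\<^sup>2 / (4 * s)))" for \<tau>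
  proof -
    have "lam\<^sup>2 * s + - (\<tau> - 2 * lam * s)\<^sup>2 / (2 * (sqrt (2 * s))\<^sup>2) = lam * \<tau> + - (\<tau>\<^sup>2 / (4 * s))"
      using s by (simp add: field_simps power2_eq_square)
    then have "exp (lam\<^sup>2 * s) * exp (- (\<tau> - 2 * lam * s)\<^sup>2 / (2 * (sqrt (2 * s))\<^sup>2)) = exp (lam * \<tau>) * exp (- (\<tau>\<^sup>2 / (4 * s)))"
      unfolding exp_add[symmetric] by (rule arg_cong)
    moreover have "sqrt (2 * pi * (sqrt (2 * s))\<^sup>2) = sqrt (4 * pi * s)" using s by (simp add: mult_ac)
    moreover have "A * E1 * (1 / A * E2) = E1 * E2" if "A > 0" for A E1 E2 :: real
      using that by simp
    ultimately show ?thesis unfolding normal_density_def using s by (simp only: real_sqrt_gt_0_iff) simp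
  qed
  ultimately show ?thesis by simp
qed

text \<open>The density of the planar Brownian motion at time c^2 s, with variance 2 c^2 s in each
  coordinate. For s <= 0 the value has no meaning; in the mixture it is multiplied by
  \<open>hitting_density\<close>, which vanishes there.\<close>

definition heat_kern :: "real \<Rightarrow> real \<Rightarrow> real \<times> real \<Rightarrow> real" where
  "heat_kern c s v = exp (- (((fst v)\<^sup>2 + (snd v)\<^sup>2) / (4 * c\<^sup>2 * s))) / (4 * pi * c\<^sup>2 * s)"

lemma heat_kern_measurable [measurable (raw)]:
  assumes "f \<in> borel_measurable M" "g \<in> borel_measurable M"
  shows "(\<lambda>x. heat_kern c (f x) (g x)) \<in> borel_measurable M"
proof -
  have [measurable]: "fst \<in> borel_measurable (borel :: (real \<times> real) measure)"
    "snd \<in> borel_measurable (borel :: (real \<times> real) measure)"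
    by (auto intro!: borel_measurable_continuous_onI continuous_intros)
  show ?thesis unfolding heat_kern_def using assms by measurable
qed

definition mixture_density :: "real \<Rightarrow> real \<Rightarrow> real \<Rightarrow> real \<times> real \<Rightarrow> real" where
  "mixture_density c lam t v = (\<integral>s. hitting_density lam t s * heat_kern c s v \<partial>lborel)"

text \<open>Both sides are iterated integrals of one nonnegative function \<open>k\<close>:
  integration over s first yields the tau integrand of \<open>q_rad\<close>, integration over tau
  first yields the integrand of the mixture.\<close>

lemma q_rad_eq_mixture:
  assumes c: "c > 0" and lam: "lam > 0" and t: "t > 0" and v: "(x, y) \<noteq> (0, 0)"
  shows "q_rad c lam ((x\<^sup>2 + y\<^sup>2) / c\<^sup>2) t = mixture_density c lam t (x, y)"
proof -
  define R where "R = (x\<^sup>2 + y\<^sup>2) / c\<^sup>2"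
  have R: "R > 0" using c v by (auto simp: R_def sum_power2_gt_zero_iff)
  have l: "lam \<ge> 0" using lam by simp
  define K where "K = q_const c lam / (4 * lam)"
  \<comment> \<open>The factor e^(-lam^2 s) anticipates the e^(lam^2 s) that the tau integral
    produces, and s^(-3/2) times its sqrt (4 pi s) leaves the 1 / s of the planar heat
    kernel.\<close>
  define k where "k = (\<lambda>\<tau> s. K * exp (lam * \<tau>) * (indicator {0<..<t} s * (hitting_density lam t s *
     (exp (- (lam\<^sup>2 * s)) * s powr (-3/2) * exp (- ((R + \<tau>\<^sup>2) / (4 * s)))))))"
  have K: "K > 0" using c lam by (simp add: K_def q_const_def)
  have km[measurable]: "(\<lambda>(\<tau>, s). k \<tau> s) \<in> borel_measurable (lborel \<Otimes>\<^sub>M lborel)"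
    unfolding k_def by measurable
  define h where "h = (\<lambda>\<tau>. q_const c lam * (wkern lam (-1/2) (-1/2) R t \<tau> + wkern lam 0 (-3/2) R t \<tau> / (4 * lam)))"
  have w: "integrable lborel (wkern lam m n R t)" for m n
    using wkern_integrable[OF R t l] .
  have h_int: "integrable lborel h" unfolding h_def using w by simp
  have h_val: "(\<integral>\<tau>. h \<tau> \<partial>lborel) = q_rad c lam R t"
    unfolding h_def q_rad_def line_kern_def using w by simp
  have inner: "has_bochner_integral lborel (k \<tau>) (h \<tau>)" for \<tau>
  proof -
    have "R + \<tau>\<^sup>2 > 0" using R by (intro add_pos_nonneg) auto
    from has_bochner_integral_mult_right[OF hitting_kern_integral[OF lam t this], of "K * exp (lam * \<tau>)"]
    moreover have "K * exp (lam * \<tau>) * (4 * lam * (kern lam (-1/2) (-1/2) (R + \<tau>\<^sup>2) t + kern lam 0 (-3/2) (R + \<tau>\<^sup>2) t / (4 * lam))) = h \<tau>"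
    proof -
      have "K * (4 * lam) = q_const c lam" using lam by (simp add: K_def)
      moreover have "K * exp (lam * \<tau>) * (4 * lam * G) = K * (4 * lam) * (exp (lam * \<tau>) * G)" for G by simp
      ultimately show ?thesis by (simp only:) (simp add: h_def wkern_def distrib_left)
    qed
    ultimately show ?thesis unfolding k_def by (simp only: real_scaleR_def)
  qed
  have kpos: "k \<tau> s \<ge> 0" for \<tau> s
    unfolding k_def using K hitting_density_nonneg[OF lam] by (intro mult_nonneg_nonneg) auto
  have kint: "integrable (lborel \<Otimes>\<^sub>M lborel) (\<lambda>(\<tau>, s). k \<tau> s)"
  proof (rule lborel_pair.Fubini_integrable)
    show "integrable lborel (\<lambda>x. LBINT y. norm (case (x, y) of (\<tau>, s) \<Rightarrow> k \<tau> s))"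
      using h_int kpos by (simp add: has_bochner_integral_integral_eq[OF inner])
    show "AE x in lborel. integrable lborel (\<lambda>y. case (x, y) of (\<tau>, s) \<Rightarrow> k \<tau> s)"
      using inner by (auto simp: has_bochner_integral_iff)
  qed fact
  have "(LBINT \<tau>. k \<tau> s) = hitting_density lam t s * heat_kern c s (x, y)" for s
  proof (cases "s \<in> {0<..<t}")
    case True
    then have s: "s > 0" by simp
    define D where "D = K * (hitting_density lam t s * (exp (- (lam\<^sup>2 * s)) * s powr (-3/2) * exp (- (R / (4 * s)))))"
    have "k \<tau> s = D * (exp (lam * \<tau>) * exp (- (\<tau>\<^sup>2 / (4 * s))))" for \<tau>
    proof -
      have "exp (- ((R + \<tau>\<^sup>2) / (4 * s))) = exp (- (R / (4 * s))) * exp (- (\<tau>\<^sup>2 / (4 * s)))"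
        by (simp add: exp_add[symmetric] add_divide_distrib)
      then show ?thesis using True by (simp add: k_def D_def)
    qed
    then have "(LBINT \<tau>. k \<tau> s) = D * (sqrt (4 * pi * s) * exp (lam\<^sup>2 * s))"
      using has_bochner_integral_integral_eq[OF exponential_gaussian_integral[OF s, of lam]] by simp
    also have "\<dots> = hitting_density lam t s * (K * (s powr (-3/2) * sqrt (4 * pi * s)) * exp (- (R / (4 * s)))
        * (exp (- (lam\<^sup>2 * s)) * exp (lam\<^sup>2 * s)))"
      by (simp add: D_def)
    also have "exp (- (lam\<^sup>2 * s)) * exp (lam\<^sup>2 * s) = 1" by (simp add: exp_minus)
    also have "K * (s powr (-3/2) * sqrt (4 * pi * s)) = 1 / (4 * pi * c\<^sup>2 * s)"
    proof -
      have "s powr (-3/2) = 1 / (sqrt s * s)"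
        using s powr_add[of s "1/2" 1] by (simp add: powr_minus_divide powr_half_sqrt)
      then show ?thesis using s lam c by (simp add: K_def q_const_def real_sqrt_mult field_simps)
    qed
    also have "R / (4 * s) = ((fst (x, y))\<^sup>2 + (snd (x, y))\<^sup>2) / (4 * c\<^sup>2 * s)"
      by (simp add: R_def mult_ac)
    finally show ?thesis by (simp add: heat_kern_def)
  qed (simp add: k_def hitting_density_def)
  then show ?thesis
    using lborel_pair.Fubini_integral[OF kint] h_val
    by (simp add: has_bochner_integral_integral_eq[OF inner] mixture_density_def R_def)
qed

lemma gaussian_char:
  assumes \<sigma>: "\<sigma> > 0"
  shows "has_bochner_integral lborel (\<lambda>x. of_real (normal_density 0 \<sigma> x) * iexp (a * x)) (of_real (exp (- (\<sigma>\<^sup>2 * a\<^sup>2 / 2))) :: complex)"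
proof -
  have int: "integrable lborel (\<lambda>x. of_real (normal_density 0 \<sigma> x) * iexp (a * x))"
    using integrable_normal_density[OF \<sigma>, of 0]
    by (rule Bochner_Integration.integrable_bound) (auto simp: norm_mult)
  have nd: "\<sigma> * normal_density 0 \<sigma> (0 + \<sigma> * x) = std_normal_density x" for x
    using \<sigma> by (simp add: normal_density_def std_normal_density_def power_mult_distrib real_sqrt_mult)
  have "(CLBINT x. of_real (normal_density 0 \<sigma> x) * iexp (a * x))
    = \<bar>\<sigma>\<bar> *\<^sub>R (CLBINT x. of_real (normal_density 0 \<sigma> (0 + \<sigma> * x)) * iexp (a * (0 + \<sigma> * x)))"
    using \<sigma> by (intro lborel_integral_real_affine) auto
  also have "\<dots> = (CLBINT x. \<sigma> *\<^sub>R (of_real (normal_density 0 \<sigma> (0 + \<sigma> * x)) * iexp (a * (0 + \<sigma> * x))))"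
    using \<sigma> by simp
  also have "\<dots> = (CLBINT x. std_normal_density x *\<^sub>R iexp ((\<sigma> * a) * x))"
    unfolding nd[symmetric] by (simp add: scaleR_conv_of_real mult_ac)
  also have "\<dots> = char std_normal_distribution (\<sigma> * a)"
    unfolding char_def by (subst integral_density) auto
  also have "\<dots> = of_real (exp (- (\<sigma>\<^sup>2 * a\<^sup>2 / 2)))"
    by (simp add: char_std_normal_distribution power_mult_distrib)
  finally show ?thesis using int by (simp only: has_bochner_integral_iff)
qed

lemma heat_kern_nonneg: "s > 0 \<Longrightarrow> heat_kern c s v \<ge> 0"
  by (simp add: heat_kern_def)

lemma heat_kern_char:
  assumes c: "c > 0" and s: "s > 0"
  shows "has_bochner_integral lborel (\<lambda>v. of_real (heat_kern c s v) * iexp (\<xi> \<bullet> v)) (of_real (exp (- (c\<^sup>2 * s * (norm \<xi>)\<^sup>2))) :: complex)"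
proof -
  define \<sigma> where "\<sigma> = sqrt (2 * c\<^sup>2 * s)"
  have \<sigma>: "\<sigma> > 0" "\<sigma>\<^sup>2 = 2 * c\<^sup>2 * s" using c s by (simp_all add: \<sigma>_def)
  obtain a b where \<xi>: "\<xi> = (a, b)" by (cases \<xi>)
  let ?g = "\<lambda>a x. of_real (normal_density 0 \<sigma> x) * iexp (a * x) :: complex"
  note G = gaussian_char[OF \<sigma>(1)]
  have eq: "of_real (heat_kern c s (x, y)) * iexp (\<xi> \<bullet> (x, y)) = ?g a x * ?g b y" for x y
  proof -
    have "heat_kern c s (x, y) = normal_density 0 \<sigma> x * normal_density 0 \<sigma> y"
    proof -
      have "sqrt (2 * pi * \<sigma>\<^sup>2) * sqrt (2 * pi * \<sigma>\<^sup>2) = 4 * pi * c\<^sup>2 * s"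
        using c s \<sigma> by simp
      moreover have "exp (- ((x\<^sup>2 + y\<^sup>2) / (4 * c\<^sup>2 * s))) = exp (- x\<^sup>2 / (2 * \<sigma>\<^sup>2)) * exp (- y\<^sup>2 / (2 * \<sigma>\<^sup>2))"
        unfolding exp_add[symmetric] \<sigma>(2) by (simp add: add_divide_distrib)
      ultimately show ?thesis using c s by (simp add: heat_kern_def normal_density_def abs_mult mult_ac)
    qed
    then show ?thesis by (simp add: \<xi> inner_prod_def exp_add distrib_left)
  qed
  have m[measurable]: "?g a \<in> borel_measurable borel" for a by measurable
  have nint: "integrable lborel (\<lambda>y. norm (?g b y))" for b
    using G[of b] by (simp only: has_bochner_integral_iff integrable_norm)
  have int: "integrable (lborel \<Otimes>\<^sub>M lborel) (\<lambda>(x, y). ?g a x * ?g b y)"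
  proof (rule lborel_pair.Fubini_integrable)
    have "(\<lambda>x. LBINT y. norm (case (x, y) of (x, y) \<Rightarrow> ?g a x * ?g b y)) = (\<lambda>x. norm (?g a x) * (LBINT y. norm (?g b y)))"
      by (simp add: norm_mult)
    then show "integrable lborel (\<lambda>x. LBINT y. norm (case (x, y) of (x, y) \<Rightarrow> ?g a x * ?g b y))"
      using integrable_mult_left[OF nint[of a]] by simp
    show "AE x in lborel. integrable lborel (\<lambda>y. case (x, y) of (x, y) \<Rightarrow> ?g a x * ?g b y)"
      using G[of b] by (intro AE_I2) (simp only: has_bochner_integral_iff split_conv integrable_mult_right)
  qed measurable
  have val: "integral\<^sup>L (lborel \<Otimes>\<^sub>M lborel) (\<lambda>(x, y). ?g a x * ?g b y) = of_real (exp (- (c\<^sup>2 * s * (norm \<xi>)\<^sup>2)))"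
  proof -
    have "integral\<^sup>L (lborel \<Otimes>\<^sub>M lborel) (\<lambda>(x, y). ?g a x * ?g b y) = (CLBINT x. CLBINT y. ?g a x * ?g b y)"
      using lborel_pair.integral_fst[OF int] by simp
    also have "\<dots> = of_real (exp (- (\<sigma>\<^sup>2 * a\<^sup>2 / 2))) * of_real (exp (- (\<sigma>\<^sup>2 * b\<^sup>2 / 2)))"
      by (simp only: integral_mult_right_zero integral_mult_left_zero has_bochner_integral_integral_eq[OF G])
    also have "\<dots> = of_real (exp (- (\<sigma>\<^sup>2 * a\<^sup>2 / 2) + - (\<sigma>\<^sup>2 * b\<^sup>2 / 2)))"
      by (simp only: exp_add of_real_mult)
    also have "- (\<sigma>\<^sup>2 * a\<^sup>2 / 2) + - (\<sigma>\<^sup>2 * b\<^sup>2 / 2) = - (c\<^sup>2 * s * (norm \<xi>)\<^sup>2)"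
      by (simp add: \<xi> \<sigma>(2) norm_Pair algebra_simps)
    finally show ?thesis .
  qed
  have "(\<lambda>v. of_real (heat_kern c s v) * iexp (\<xi> \<bullet> v)) = (\<lambda>(x, y). ?g a x * ?g b y)"
    by (auto simp only: fun_eq_iff eq split_conv split_paired_all)
  then show ?thesis
    using int val unfolding lborel_prod by (simp only: has_bochner_integral_iff)
qed

lemma heat_kern_integral:
  assumes c: "c > 0" and s: "s > 0"
  shows "has_bochner_integral lborel (heat_kern c s) 1"
proof -
  have "has_bochner_integral lborel (\<lambda>v. complex_of_real (heat_kern c s v)) (of_real 1)"
    using heat_kern_char[OF c s, of 0] by simp
  from has_bochner_integral_bounded_linear[OF bounded_linear_Re this] show ?thesis by simp
qed

text \<open>The modulus of the double integrand integrates over v to \<open>hitting_density\<close>,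
  which has mass 1; this justifies exchanging the integrals.\<close>

lemma mixture_density_char:
  assumes c: "c > 0" and lam: "lam > 0" and t: "t > 0"
  shows "has_bochner_integral lborel (\<lambda>v. of_real (mixture_density c lam t v) * iexp (\<xi> \<bullet> v))
    (of_real (LBINT s. hitting_density lam t s * exp (- (c\<^sup>2 * s * (norm \<xi>)\<^sup>2))) :: complex)"
proof -
  define f where "f = (\<lambda>s v. of_real (hitting_density lam t s * heat_kern c s v) * iexp (\<xi> \<bullet> v) :: complex)"
  have fm[measurable]: "(\<lambda>(s, v). f s v) \<in> borel_measurable (lborel \<Otimes>\<^sub>M lborel)"
    unfolding f_def by measurable
  have hi: "integrable lborel (hitting_density lam t)"
    using hitting_density_integral(1)[OF lam t] by (simp add: has_bochner_integral_iff)
  have zero: "hitting_density lam t s = 0" if "\<not> s > 0" for s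
    using that by (simp add: hitting_density_def)
  have inner: "has_bochner_integral lborel (f s) (of_real (hitting_density lam t s * exp (- (c\<^sup>2 * s * (norm \<xi>)\<^sup>2))))" for s
  proof (cases "s > 0")
    case True
    from has_bochner_integral_mult_right[OF heat_kern_char[OF c True, of \<xi>], of "of_real (hitting_density lam t s)"]
    show ?thesis by (simp add: f_def mult_ac)
  qed (simp add: f_def zero has_bochner_integral_zero)
  have norm: "(LBINT v. norm (f s v)) = hitting_density lam t s" for s
  proof (cases "s > 0")
    case True
    have "(LBINT v. norm (f s v)) = (LBINT v. hitting_density lam t s * heat_kern c s v)"
      using heat_kern_nonneg[OF True, of c] hitting_density_nonneg[OF lam, of t s]
      by (intro Bochner_Integration.integral_cong) (auto simp: f_def norm_mult abs_mult)
    then show ?thesis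
      using has_bochner_integral_integral_eq[OF heat_kern_integral[OF c True]] by simp
  qed (simp add: f_def zero)
  have int: "integrable (lborel \<Otimes>\<^sub>M lborel) (\<lambda>(s, v). f s v)"
  proof (rule lborel_pair.Fubini_integrable[OF fm])
    show "integrable lborel (\<lambda>x. LBINT y. norm (case (x, y) of (s, v) \<Rightarrow> f s v))"
      using hi norm by simp
    show "AE x in lborel. integrable lborel (\<lambda>y. case (x, y) of (s, v) \<Rightarrow> f s v)"
      using inner by (simp add: has_bochner_integral_iff)
  qed
  have "(CLBINT s. f s v) = of_real (mixture_density c lam t v) * iexp (\<xi> \<bullet> v)" for v
    unfolding f_def mixture_density_def
    by (simp only: integral_mult_left_zero integral_complex_of_real)
  moreover have "(LBINT v. (CLBINT s. f s v)) = of_real (LBINT s. hitting_density lam t s * exp (- (c\<^sup>2 * s * (norm \<xi>)\<^sup>2)))"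
    using lborel_pair.Fubini_integral[OF int] by (simp only: has_bochner_integral_integral_eq[OF inner] integral_complex_of_real)
  ultimately show ?thesis
    using lborel_pair.integrable_snd[OF int] by (simp only: has_bochner_integral_iff)
qed

lemma mixture_density_measurable [measurable]: "mixture_density c lam t \<in> borel_measurable borel"
  unfolding mixture_density_def by measurable

lemma mixture_density_nonneg:
  assumes "lam > 0"
  shows "mixture_density c lam t v \<ge> 0"
  unfolding mixture_density_def
proof (intro Bochner_Integration.integral_nonneg)
  fix s show "hitting_density lam t s * heat_kern c s v \<ge> 0"
  proof (cases "s > 0")
    case True
    then show ?thesis
      using hitting_density_nonneg[OF assms] heat_kern_nonneg by (intro mult_nonneg_nonneg) auto
  qed (simp add: hitting_density_def)
qed

lemma prob_space_mixture:
  assumes c: "c > 0" and lam: "lam > 0" and t: "t > 0"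
  shows "prob_space (density lborel (mixture_density c lam t))"
proof
  have 1: "has_bochner_integral lborel (mixture_density c lam t) 1"
    using has_bochner_integral_bounded_linear[OF bounded_linear_Re mixture_density_char[OF c lam t, of 0]]
      has_bochner_integral_integral_eq[OF hitting_density_integral(1)[OF lam t]] by simp
  have "emeasure (density lborel (mixture_density c lam t)) UNIV = (\<integral>\<^sup>+v. ennreal (mixture_density c lam t v) \<partial>lborel)"
    by (simp add: emeasure_density)
  also have "\<dots> = ennreal 1"
    using 1 mixture_density_nonneg[OF lam] by (subst nn_integral_eq_integral) (auto simp: has_bochner_integral_iff)
  finally show "emeasure (density lborel (mixture_density c lam t)) (space (density lborel (mixture_density c lam t))) = 1"
    by simp
qed

lemma W2_distributed:
  fixes M :: "'a measure"
  assumes M: "prob_space M" and c: "c > 0" and lam: "lam > 0"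
    and B: "planar_brownian_motion M B" and H: "stable_half_subordinator M H"
    and indep: "indep_processes M {0..} B {0<..} (calL lam H)" and t: "t > 0"
  shows "distributed M lborel (W2 c lam B H t) (\<lambda>(x, y). ennreal (q_density c lam x y t))"
proof -
  interpret M: prob_space M by fact
  have tJ: "t \<in> {0<..}" using t by simp
  have Lm[measurable]: "calL lam H t \<in> borel_measurable M"
    using indep t by (auto simp: indep_processes_def)
  note L = calL_law[OF M H lam t Lm]
  note T = time_changed_char[OF M B indep tJ, of "c\<^sup>2" t, OF _ less_imp_le[OF L(2)] L(3)]
  have W: "W2 c lam B H t = (\<lambda>\<omega>. B (c\<^sup>2 * calL lam H t \<omega>) \<omega>)"
    by (simp add: W2_def fun_eq_iff)
  have Wm[measurable]: "W2 c lam B H t \<in> borel_measurable M"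
    unfolding W by (rule T(1)) auto
  have "distr M borel (W2 c lam B H t) = density lborel (mixture_density c lam t)"
  proof (rule char_prod_unique)
    show "prob_space (distr M borel (W2 c lam B H t))" by (rule M.prob_space_distr) simp
    show "prob_space (density lborel (mixture_density c lam t))" by (rule prob_space_mixture[OF c lam t])
    fix \<xi> :: "real \<times> real"
    have "(CLINT v|distr M borel (W2 c lam B H t). iexp (\<xi> \<bullet> v)) = (CLINT \<omega>|M. iexp (\<xi> \<bullet> W2 c lam B H t \<omega>))"
      by (rule integral_distr) auto
    also have "\<dots> = of_real (LINT \<omega>|M. exp (- (c\<^sup>2 * calL lam H t \<omega>) * (norm \<xi>)\<^sup>2))"
      unfolding W by (rule T(2)) auto
    also have "(LINT \<omega>|M. exp (- (c\<^sup>2 * calL lam H t \<omega>) * (norm \<xi>)\<^sup>2))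
        = (LINT s|distr M borel (calL lam H t). exp (- (c\<^sup>2 * s) * (norm \<xi>)\<^sup>2))"
      by (rule integral_distr[symmetric]) auto
    also have "\<dots> = (LBINT s. hitting_density lam t s * exp (- (c\<^sup>2 * s * (norm \<xi>)\<^sup>2)))"
      unfolding L(1) using hitting_density_nonneg[OF lam] by (subst integral_density) auto
    also have "of_real \<dots> = (CLBINT v. of_real (mixture_density c lam t v) * iexp (\<xi> \<bullet> v))"
      by (rule has_bochner_integral_integral_eq[OF mixture_density_char[OF c lam t], symmetric])
    also have "\<dots> = (CLINT v|density lborel (mixture_density c lam t). iexp (\<xi> \<bullet> v))"
      using mixture_density_nonneg[OF lam] by (subst integral_density) (auto simp: scaleR_conv_of_real)
    finally show "(CLINT v|distr M borel (W2 c lam B H t). iexp (\<xi> \<bullet> v)) = (CLINT v|density lborel (mixture_density c lam t). iexp (\<xi> \<bullet> v))" .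
  qed simp_all
  \<comment> \<open>\<open>q_density\<close> agrees with the mixture except possibly at the origin,
    where the integral defining it diverges. A change at one point keeps measurability in (x, y) and
    does not affect the measure.\<close>
  moreover have q: "(\<lambda>(x, y). ennreal (q_density c lam x y t))
      = (\<lambda>v. if v = (0, 0) then ennreal (q_density c lam 0 0 t) else ennreal (mixture_density c lam t v))"
    using q_density_eq(1)[OF c lam t] q_rad_eq_mixture[OF c lam t] by (auto simp: fun_eq_iff)
  have qm[measurable]: "(\<lambda>(x, y). ennreal (q_density c lam x y t)) \<in> borel_measurable borel"
    unfolding q by measurable
  moreover have "density lborel (mixture_density c lam t) = density lborel (\<lambda>(x, y). ennreal (q_density c lam x y t))"
  proof (rule density_cong)
    show "AE v in lborel. ennreal (mixture_density c lam t v) = (case v of (x, y) \<Rightarrow> ennreal (q_density c lam x y t))"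
      unfolding q using AE_lborel_singleton[of "(0, 0) :: real \<times> real"] by eventually_elim simp
  qed simp_all
  ultimately have "distr M borel (W2 c lam B H t) = density lborel (\<lambda>(x, y). ennreal (q_density c lam x y t))" by simp
  moreover have "distr M lborel (W2 c lam B H t) = distr M borel (W2 c lam B H t)"
    by (rule distr_cong) simp_all
  ultimately show ?thesis
    unfolding distributed_def using qm Wm by simp
qed

theorem theorem4p4:
  fixes M :: "'a measure"
    and B :: "real \<Rightarrow> 'a \<Rightarrow> real \<times> real"
    and H :: "real \<Rightarrow> 'a \<Rightarrow> real"
    and c lam :: real
  assumes "prob_space M"
    and "c > 0" and "lam > 0"
    and "planar_brownian_motion M B"
    and "stable_half_subordinator M H"
    and "indep_processes M {0..} B {0<..} (calL lam H)"
  shows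
    "(\<forall>x y t. t > 0 \<and> (x, y) \<noteq> (0, 0) \<longrightarrow>
        set_integrable lborel {0<..} (q_integrand c lam x y t) \<and>
        q_density c lam x y t \<ge> 0 \<and>
        (\<lambda>u. q_density c lam x y u) differentiable (at t) \<and>
        caputo_half_differentiable (\<lambda>u. q_density c lam x y u) t \<and>
        twice_differentiable_at (\<lambda>u. q_density c lam u y t) x \<and>
        twice_differentiable_at (\<lambda>u. q_density c lam x u t) y \<and>
        deriv (\<lambda>u. q_density c lam x y u) t
            + 2 * lam * caputo_half_deriv (\<lambda>u. q_density c lam x y u) t
          = c\<^sup>2 * (deriv (deriv (\<lambda>u. q_density c lam u y t)) x
                 + deriv (deriv (\<lambda>u. q_density c lam x u t)) y)) \<and>
     (\<forall>t>0. distributed M lborel (W2 c lam B H t)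
        (\<lambda>(x, y). ennreal (q_density c lam x y t)))"
proof (intro conjI[of "\<forall>x y t. _ x y t"] allI impI)
  fix t :: real assume "t > 0"
  then show "distributed M lborel (W2 c lam B H t) (\<lambda>(x, y). ennreal (q_density c lam x y t))"
    by (rule W2_distributed[OF assms])
qed (use q_density_pde[OF assms(2,3)] in blast)

end
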